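(* Let $R$ be a noetherian commutative ring, let $P=(A,C)$ be a measuring $\alpha$-pairing over $R$, and let $Q=(M,N)$ be a right $P$-pairing. 1. If $Q$ is coreflexive, then $M^{r}=M^{\circ}$. 2. Let $M$ be cofinitely $R$-cogenerated. (a) If $\chi_Q$ induces an isomorphism $N\simeq M^{\circ}$ (i.e. $\chi_Q:N\to M^{\ast}$ is injective with image $M^{\circ}$), then $Q$ is coreflexive. (b) Let $Q$ be weakly coreflexive. Then $Q$ is coreflexive if and only if $\chi_Q$ induces an isomorphism $N\simeq M^{\circ}$.
   Context: $R$ is a commutative ring with $1\neq 0$; $\otimes,\mathrm{Hom}$ are over $R$, and $L^{\ast}=\mathrm{Hom}_R(L,R)$. Algebras are associative unital, modules unitary, coalgebras coassociative and counital. For an $R$-coalgebra $(C,\Delta,\varepsilon)$, $C^{\ast}$ is an $R$-algebra under convolution $(f\star g)(c)=\sum f(c_1)g(c_2)$ with unit $\varepsilon$. An $R$-pairing $(V,W)$ is a pair of $R$-modules with an $R$-bilinear form $\langle\,,\rangle:V\times W\to R$; it induces $\kappa:V\to W^{\ast}$ and $\chi:W\to V^{\ast}$. It is an $\alpha$-pairing if for every $R$-module $X$ the map $X\otimes W\to \mathrm{Hom}_R(V,X)$, $\sum x_i\otimes w_i\mapsto[v\mapsto\sum x_i\langle v,w_i\rangle]$ is injective. A measuring $R$-pairing $(A,C)$ is an $R$-pairing with $A$ an $R$-algebra, $C$ an $R$-coalgebra and $\kappa:A\to C^{\ast}$ an algebra morphism; a measuring $\alpha$-pairing is one that is also an $\alpha$-pairing.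 Every right $C$-comodule $N$ (coaction $n\mapsto\sum n_{<0>}\otimes n_{<1>}$) is a left $A$-module by $an=\sum n_{<0>}\langle a,n_{<1>}\rangle$, and $N^{\ast}$ is a right $A$-module by $(fa)(n)=f(an)$. For a right $A$-module $M$, $M^{\ast}$ is a left $A$-module by $(af)(m)=f(ma)$. A right $P$-pairing is an $R$-pairing $Q=(M,N)$ with $M$ a right $A$-module, $N$ a right $C$-comodule and $\kappa_Q:M\to N^{\ast}$ right $A$-linear. For a left $A$-module $X$, $\mathrm{Rat}^C({}_AX)=\{x\in X\mid \exists \sum x_i\otimes c_i\in X\otimes C \text{ with } ax=\sum x_i\langle a,c_i\rangle\ \forall a\in A\}$. For a right $A$-module $M$ put $M^{r}:=\mathrm{Rat}^C({}_AM^{\ast})$. An $A$-submodule (or ideal) $L\subseteq M$ is $R$-cofinite if $M/L$ is a finitely generated $R$-module. $M^{\circ}:=\{f\in M^{\ast}\mid f(L)=0 \text{ for some } R\text{-cofinite right } A\text{-submodule } L\subseteq M\}$ (equivalently, $f(MI)=0$ for some $R$-cofinite ideal $I$ of $A$). $M$ is cofinitely $R$-cogenerated if for every $R$-cofinite $A$-submodule $L\subseteq M$, $M/L$ is $R$-cogenerated (embeds in a product of copies of $R$). The linear weak topology $M[\mathfrak{T}_{ls}(N)]$ has as neighbourhood basis of $0$ the submodules $K^{\perp}=\{m\in M\mid\langle m,K\rangle=0\}$, $K\subseteq N$ a finitely generated $R$-submodule. The cofinite topology $\mathrm{Cf}(M)$ has as neighbourhood basis of $0$ all $R$-cofinite $A$-submodules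 of $M$. $Q$ is coreflexive if $M[\mathfrak{T}_{ls}(N)]=\mathrm{Cf}(M)$; $Q$ is weakly coreflexive if $N=M^{r}$ via $\chi_Q$ (i.e. $\chi_Q:N\to M^{\ast}$ is injective with image $M^r$). *)

theory Defs
  imports "HOL-Algebra.Module" "HOL-Algebra.Ring_Divisibility" "HOL-Analysis.Abstract_Topology"
begin

text \<open>
  Throughout, \<open>R\<close> is a commutative ring and an \<open>R\<close>-module is a record satisfying the locale
  \<^locale>\<open>Module.module\<close>. The fields \<open>mult\<close> and \<open>one\<close> of the record are only meaningful
  for algebras and are left \<open>undefined\<close> in modules that carry no multiplication.
\<close>

section \<open>Modules\<close>

definition mod_hom ::
    "('r, 'z) ring_scheme \<Rightarrow> ('r, 'm) module \<Rightarrow> ('r, 'n) module \<Rightarrow> ('m \<Rightarrow> 'n) set" where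
  "mod_hom R M N = {f \<in> carrier M \<rightarrow> carrier N.
     (\<forall>x\<in>carrier M. \<forall>y\<in>carrier M. f (x \<oplus>\<^bsub>M\<^esub> y) = f x \<oplus>\<^bsub>N\<^esub> f y) \<and>
     (\<forall>r\<in>carrier R. \<forall>x\<in>carrier M. f (r \<odot>\<^bsub>M\<^esub> x) = r \<odot>\<^bsub>N\<^esub> f x)}"

definition bilinear_map ::
    "('r, 'z) ring_scheme \<Rightarrow> ('r, 'm) module \<Rightarrow> ('r, 'n) module \<Rightarrow> ('r, 'p) module
      \<Rightarrow> ('m \<Rightarrow> 'n \<Rightarrow> 'p) \<Rightarrow> bool" where
  "bilinear_map R M N P f \<longleftrightarrow>
     (\<forall>x\<in>carrier M. f x \<in> mod_hom R N P) \<and> (\<forall>y\<in>carrier N. (\<lambda>x. f x y) \<in> mod_hom R M P)"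

definition regular_module :: "('r, 'z) ring_scheme \<Rightarrow> ('r, 'r) module" where
  "regular_module R = \<lparr>carrier = carrier R, mult = mult R, one = one R, zero = zero R,
     add = add R, smult = mult R\<rparr>"

definition power_module :: "('r, 'm) module \<Rightarrow> 'i set \<Rightarrow> ('r, 'i \<Rightarrow> 'm) module" where
  "power_module M I = \<lparr>carrier = I \<rightarrow>\<^sub>E carrier M, mult = undefined, one = undefined,
     zero = (\<lambda>i\<in>I. \<zero>\<^bsub>M\<^esub>), add = (\<lambda>f g. \<lambda>i\<in>I. f i \<oplus>\<^bsub>M\<^esub> g i),
     smult = (\<lambda>r f. \<lambda>i\<in>I. r \<odot>\<^bsub>M\<^esub> f i)\<rparr>"

definition hom_module ::
    "('r, 'z) ring_scheme \<Rightarrow> ('r, 'm) module \<Rightarrow> ('r, 'n) module \<Rightarrow> ('r, 'm \<Rightarrow> 'n) module" where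
  "hom_module R M N =
     (power_module N (carrier M))\<lparr>carrier := mod_hom R M N \<inter> extensional (carrier M)\<rparr>"

definition dual_module :: "('r, 'z) ring_scheme \<Rightarrow> ('r, 'm) module \<Rightarrow> ('r, 'm \<Rightarrow> 'r) module" where
  "dual_module R M = hom_module R M (regular_module R)"

definition quot_module :: "('r, 'm) module \<Rightarrow> 'm set \<Rightarrow> ('r, 'm set) module" where
  "quot_module M L = \<lparr>carrier = a_rcosets\<^bsub>M\<^esub> L, mult = undefined, one = undefined,
     zero = L, add = set_add M, smult = (\<lambda>r X. \<Union>x\<in>X. L +>\<^bsub>M\<^esub> (r \<odot>\<^bsub>M\<^esub> x))\<rparr>"

definition mod_span :: "('r, 'z) ring_scheme \<Rightarrow> ('r, 'm) module \<Rightarrow> 'm set \<Rightarrow> 'm set" where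
  "mod_span R M S = (\<lambda>H. submodule H R M) hull S"

definition fin_gen_module :: "('r, 'z) ring_scheme \<Rightarrow> ('r, 'm) module \<Rightarrow> bool" where
  "fin_gen_module R M \<longleftrightarrow> (\<exists>S. S \<subseteq> carrier M \<and> finite S \<and> mod_span R M S = carrier M)"

text \<open>
  \<open>X\<close> embeds in a product of copies of \<open>R\<close>. The index set may be taken among sets of
  functionals on \<open>X\<close>; see lemma \<open>cogeneratedI\<close> below for index sets of arbitrary type.
\<close>

definition cogenerated :: "('r, 'z) ring_scheme \<Rightarrow> ('r, 'x) module \<Rightarrow> bool" where
  "cogenerated R X \<longleftrightarrow>
     (\<exists>I :: ('x \<Rightarrow> 'r) set. \<exists>j \<in> mod_hom R X (power_module (regular_module R) I). inj_on j (carrier X))"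


section \<open>Tensor products\<close>

definition free_module :: "('r, 'z) ring_scheme \<Rightarrow> 's set \<Rightarrow> ('r, 's \<Rightarrow> 'r) module" where
  "free_module R S = \<lparr>carrier = {\<phi>. (\<forall>s\<in>S. \<phi> s \<in> carrier R) \<and> (\<forall>s. s \<notin> S \<longrightarrow> \<phi> s = \<zero>\<^bsub>R\<^esub>) \<and>
        finite {s. \<phi> s \<noteq> \<zero>\<^bsub>R\<^esub>}},
     mult = undefined, one = undefined, zero = (\<lambda>s. \<zero>\<^bsub>R\<^esub>),
     add = (\<lambda>\<phi> \<psi> s. \<phi> s \<oplus>\<^bsub>R\<^esub> \<psi> s), smult = (\<lambda>r \<phi> s. r \<otimes>\<^bsub>R\<^esub> \<phi> s)\<rparr>"

definition free_gen :: "('r, 'z) ring_scheme \<Rightarrow> 's \<Rightarrow> 's \<Rightarrow> 'r" where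
  "free_gen R s = (\<lambda>t. if t = s then \<one>\<^bsub>R\<^esub> else \<zero>\<^bsub>R\<^esub>)"

definition tensor_rels ::
    "('r, 'z) ring_scheme \<Rightarrow> ('r, 'm) module \<Rightarrow> ('r, 'n) module \<Rightarrow> ('m \<times> 'n \<Rightarrow> 'r) set" where
  "tensor_rels R M N = (let F = free_module R (carrier M \<times> carrier N); e = free_gen R in
     {e (x \<oplus>\<^bsub>M\<^esub> x', y) \<ominus>\<^bsub>F\<^esub> (e (x, y) \<oplus>\<^bsub>F\<^esub> e (x', y)) | x x' y.
        x \<in> carrier M \<and> x' \<in> carrier M \<and> y \<in> carrier N} \<union>
     {e (x, y \<oplus>\<^bsub>N\<^esub> y') \<ominus>\<^bsub>F\<^esub> (e (x, y) \<oplus>\<^bsub>F\<^esub> e (x, y')) | x y y'.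
        x \<in> carrier M \<and> y \<in> carrier N \<and> y' \<in> carrier N} \<union>
     {e (r \<odot>\<^bsub>M\<^esub> x, y) \<ominus>\<^bsub>F\<^esub> (r \<odot>\<^bsub>F\<^esub> e (x, y)) | r x y.
        r \<in> carrier R \<and> x \<in> carrier M \<and> y \<in> carrier N} \<union>
     {e (x, r \<odot>\<^bsub>N\<^esub> y) \<ominus>\<^bsub>F\<^esub> (r \<odot>\<^bsub>F\<^esub> e (x, y)) | r x y.
        r \<in> carrier R \<and> x \<in> carrier M \<and> y \<in> carrier N})"

definition tensor_kernel ::
    "('r, 'z) ring_scheme \<Rightarrow> ('r, 'm) module \<Rightarrow> ('r, 'n) module \<Rightarrow> ('m \<times> 'n \<Rightarrow> 'r) set" where
  "tensor_kernel R M N =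
     mod_span R (free_module R (carrier M \<times> carrier N)) (tensor_rels R M N)"

definition tensor ::
    "('r, 'z) ring_scheme \<Rightarrow> ('r, 'm) module \<Rightarrow> ('r, 'n) module
      \<Rightarrow> ('r, ('m \<times> 'n \<Rightarrow> 'r) set) module" where
  "tensor R M N = quot_module (free_module R (carrier M \<times> carrier N)) (tensor_kernel R M N)"

definition pure_tensor ::
    "('r, 'z) ring_scheme \<Rightarrow> ('r, 'm) module \<Rightarrow> ('r, 'n) module \<Rightarrow> 'm \<Rightarrow> 'n
      \<Rightarrow> ('m \<times> 'n \<Rightarrow> 'r) set" where
  "pure_tensor R M N x y =
     tensor_kernel R M N +>\<^bsub>free_module R (carrier M \<times> carrier N)\<^esub> free_gen R (x, y)"

definition free_lift :: "('r, 'z) ring_scheme \<Rightarrow> ('r, 'p) module \<Rightarrow> ('s \<Rightarrow> 'p) \<Rightarrow> ('s \<Rightarrow> 'r) \<Rightarrow> 'p" where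
  "free_lift R P f \<phi> = (\<Oplus>\<^bsub>P\<^esub>s\<in>{s. \<phi> s \<noteq> \<zero>\<^bsub>R\<^esub>}. \<phi> s \<odot>\<^bsub>P\<^esub> f s)"

text \<open>
  The linear map from the tensor product induced by a bilinear map \<open>f\<close>:
  \<open>\<Sum> x\<^sub>i \<otimes> y\<^sub>i\<close> is sent to \<open>\<Sum> f x\<^sub>i y\<^sub>i\<close>. It does not depend on the representative by
  lemma \<open>tensor_lift_coset\<close> below.
\<close>

definition tensor_lift ::
    "('r, 'z) ring_scheme \<Rightarrow> ('r, 'p) module \<Rightarrow> ('m \<Rightarrow> 'n \<Rightarrow> 'p) \<Rightarrow> ('m \<times> 'n \<Rightarrow> 'r) set \<Rightarrow> 'p" where
  "tensor_lift R P f t = the_elem (free_lift R P (case_prod f) ` t)"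

definition tensor_map ::
    "('r, 'z) ring_scheme \<Rightarrow> ('r, 'm) module \<Rightarrow> ('r, 'n) module \<Rightarrow> ('k \<Rightarrow> 'm) \<Rightarrow> ('l \<Rightarrow> 'n)
      \<Rightarrow> ('k \<times> 'l \<Rightarrow> 'r) set \<Rightarrow> ('m \<times> 'n \<Rightarrow> 'r) set" where
  "tensor_map R M N f g =
     tensor_lift R (tensor R M N) (\<lambda>x y. pure_tensor R M N (f x) (g y))"

definition tensor_assoc where
  "tensor_assoc R K M N =
     tensor_lift R (tensor R K (tensor R M N))
       (\<lambda>t z. tensor_lift R (tensor R K (tensor R M N))
         (\<lambda>x y. pure_tensor R K (tensor R M N) x (pure_tensor R M N y z)) t)"


section \<open>Algebras, coalgebras, modules and comodules over them\<close>

locale r_algebra = Module.module R A + ring A for R (structure) and A (structure) +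
  assumes smult_mult_l:
      "\<lbrakk>r \<in> carrier R; a \<in> carrier A; b \<in> carrier A\<rbrakk>
        \<Longrightarrow> (r \<odot>\<^bsub>A\<^esub> a) \<otimes>\<^bsub>A\<^esub> b = r \<odot>\<^bsub>A\<^esub> (a \<otimes>\<^bsub>A\<^esub> b)"
    and smult_mult_r:
      "\<lbrakk>r \<in> carrier R; a \<in> carrier A; b \<in> carrier A\<rbrakk>
        \<Longrightarrow> a \<otimes>\<^bsub>A\<^esub> (r \<odot>\<^bsub>A\<^esub> b) = r \<odot>\<^bsub>A\<^esub> (a \<otimes>\<^bsub>A\<^esub> b)"

definition right_module ::
    "('r, 'z) ring_scheme \<Rightarrow> ('r, 'a) module \<Rightarrow> ('r, 'm) module \<Rightarrow> ('m \<Rightarrow> 'a \<Rightarrow> 'm) \<Rightarrow> bool" where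
  "right_module R A M ract \<longleftrightarrow> Module.module R M \<and> bilinear_map R M A M ract \<and>
     (\<forall>m\<in>carrier M. ract m \<one>\<^bsub>A\<^esub> = m) \<and>
     (\<forall>m\<in>carrier M. \<forall>a\<in>carrier A. \<forall>b\<in>carrier A. ract m (a \<otimes>\<^bsub>A\<^esub> b) = ract (ract m a) b)"

definition coalgebra ::
    "('r, 'z) ring_scheme \<Rightarrow> ('r, 'c) module \<Rightarrow> ('c \<Rightarrow> ('c \<times> 'c \<Rightarrow> 'r) set) \<Rightarrow> ('c \<Rightarrow> 'r) \<Rightarrow> bool" where
  "coalgebra R C \<Delta> \<epsilon> \<longleftrightarrow> Module.module R C \<and>
     \<Delta> \<in> mod_hom R C (tensor R C C) \<and> \<epsilon> \<in> mod_hom R C (regular_module R) \<and>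
     (\<forall>c\<in>carrier C.
        tensor_assoc R C C C (tensor_map R (tensor R C C) C \<Delta> id (\<Delta> c))
          = tensor_map R C (tensor R C C) id \<Delta> (\<Delta> c) \<and>
        tensor_lift R C (\<lambda>x y. \<epsilon> x \<odot>\<^bsub>C\<^esub> y) (\<Delta> c) = c \<and>
        tensor_lift R C (\<lambda>x y. \<epsilon> y \<odot>\<^bsub>C\<^esub> x) (\<Delta> c) = c)"

definition right_comodule ::
    "('r, 'z) ring_scheme \<Rightarrow> ('r, 'c) module \<Rightarrow> ('c \<Rightarrow> ('c \<times> 'c \<Rightarrow> 'r) set) \<Rightarrow> ('c \<Rightarrow> 'r)
      \<Rightarrow> ('r, 'n) module \<Rightarrow> ('n \<Rightarrow> ('n \<times> 'c \<Rightarrow> 'r) set) \<Rightarrow> bool" where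
  "right_comodule R C \<Delta> \<epsilon> N \<rho> \<longleftrightarrow> Module.module R N \<and>
     \<rho> \<in> mod_hom R N (tensor R N C) \<and>
     (\<forall>n\<in>carrier N.
        tensor_assoc R N C C (tensor_map R (tensor R N C) C \<rho> id (\<rho> n))
          = tensor_map R N (tensor R C C) id \<Delta> (\<rho> n) \<and>
        tensor_lift R N (\<lambda>x c. \<epsilon> c \<odot>\<^bsub>N\<^esub> x) (\<rho> n) = n)"

text \<open>The convolution algebra \<open>C\<^sup>*\<close>.\<close>

definition conv_algebra ::
    "('r, 'z) ring_scheme \<Rightarrow> ('r, 'c) module \<Rightarrow> ('c \<Rightarrow> ('c \<times> 'c \<Rightarrow> 'r) set) \<Rightarrow> ('c \<Rightarrow> 'r)
      \<Rightarrow> ('r, 'c \<Rightarrow> 'r) module" where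
  "conv_algebra R C \<Delta> \<epsilon> = (dual_module R C)\<lparr>
     mult := (\<lambda>f g. \<lambda>c\<in>carrier C.
       tensor_lift R (regular_module R) (\<lambda>x y. f x \<otimes>\<^bsub>R\<^esub> g y) (\<Delta> c)),
     one := (\<lambda>c\<in>carrier C. \<epsilon> c)\<rparr>"


section \<open>Pairings\<close>

definition pairing ::
    "('r, 'z) ring_scheme \<Rightarrow> ('r, 'v) module \<Rightarrow> ('r, 'w) module \<Rightarrow> ('v \<Rightarrow> 'w \<Rightarrow> 'r) \<Rightarrow> bool" where
  "pairing R V W q \<longleftrightarrow> Module.module R V \<and> Module.module R W \<and>
     bilinear_map R V W (regular_module R) q"

definition kappa :: "('r, 'w) module \<Rightarrow> ('v \<Rightarrow> 'w \<Rightarrow> 'r) \<Rightarrow> 'v \<Rightarrow> 'w \<Rightarrow> 'r" where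
  "kappa W q v = (\<lambda>w\<in>carrier W. q v w)"

definition chi :: "('r, 'v) module \<Rightarrow> ('v \<Rightarrow> 'w \<Rightarrow> 'r) \<Rightarrow> 'w \<Rightarrow> 'v \<Rightarrow> 'r" where
  "chi V q w = (\<lambda>v\<in>carrier V. q v w)"

definition alpha_map ::
    "('r, 'z) ring_scheme \<Rightarrow> ('r, 'v) module \<Rightarrow> ('v \<Rightarrow> 'w \<Rightarrow> 'r) \<Rightarrow> ('r, 'x) module
      \<Rightarrow> ('x \<times> 'w \<Rightarrow> 'r) set \<Rightarrow> 'v \<Rightarrow> 'x" where
  "alpha_map R V q X t = (\<lambda>v\<in>carrier V. tensor_lift R X (\<lambda>x w. q v w \<odot>\<^bsub>X\<^esub> x) t)"

text \<open>
  A formula cannot quantify over all modules on all types. The modules \<open>X\<close> below range over those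
  whose elements are of type \<^typ>\<open>(nat \<Rightarrow> 'r) set\<close>; up to isomorphism these include all finitely
  generated modules, and that suffices: lemma \<open>alpha_pairingD\<close> below derives the condition for
  modules \<open>X\<close> of any type.
\<close>

definition alpha_pairing ::
    "('r, 'z) ring_scheme \<Rightarrow> ('r, 'v) module \<Rightarrow> ('r, 'w) module \<Rightarrow> ('v \<Rightarrow> 'w \<Rightarrow> 'r) \<Rightarrow> bool" where
  "alpha_pairing R V W q \<longleftrightarrow> pairing R V W q \<and>
     (\<forall>X :: ('r, (nat \<Rightarrow> 'r) set) module. Module.module R X
        \<longrightarrow> inj_on (alpha_map R V q X) (carrier (tensor R X W)))"

definition measuring_pairing ::
    "('r, 'z) ring_scheme \<Rightarrow> ('r, 'a) module \<Rightarrow> ('r, 'c) module \<Rightarrow> ('c \<Rightarrow> ('c \<times> 'c \<Rightarrow> 'r) set)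
      \<Rightarrow> ('c \<Rightarrow> 'r) \<Rightarrow> ('a \<Rightarrow> 'c \<Rightarrow> 'r) \<Rightarrow> bool" where
  "measuring_pairing R A C \<Delta> \<epsilon> p \<longleftrightarrow> pairing R A C p \<and> r_algebra R A \<and> coalgebra R C \<Delta> \<epsilon> \<and>
     kappa C p \<in> ring_hom A (conv_algebra R C \<Delta> \<epsilon>) \<inter> mod_hom R A (conv_algebra R C \<Delta> \<epsilon>)"

definition measuring_alpha_pairing where
  "measuring_alpha_pairing R A C \<Delta> \<epsilon> p \<longleftrightarrow>
     measuring_pairing R A C \<Delta> \<epsilon> p \<and> alpha_pairing R A C p"

text \<open>The left \<open>A\<close>-action on a right \<open>C\<close>-comodule, and the actions on dual modules.\<close>

definition comodule_act ::
    "('r, 'z) ring_scheme \<Rightarrow> ('a \<Rightarrow> 'c \<Rightarrow> 'r) \<Rightarrow> ('r, 'n) module \<Rightarrow> ('n \<Rightarrow> ('n \<times> 'c \<Rightarrow> 'r) set)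
      \<Rightarrow> 'a \<Rightarrow> 'n \<Rightarrow> 'n" where
  "comodule_act R p N \<rho> a n = tensor_lift R N (\<lambda>x c. p a c \<odot>\<^bsub>N\<^esub> x) (\<rho> n)"

definition dual_right_act :: "('r, 'n) module \<Rightarrow> ('a \<Rightarrow> 'n \<Rightarrow> 'n) \<Rightarrow> ('n \<Rightarrow> 'r) \<Rightarrow> 'a \<Rightarrow> 'n \<Rightarrow> 'r" where
  "dual_right_act N lact f a = (\<lambda>n\<in>carrier N. f (lact a n))"

definition dual_left_act :: "('r, 'm) module \<Rightarrow> ('m \<Rightarrow> 'a \<Rightarrow> 'm) \<Rightarrow> 'a \<Rightarrow> ('m \<Rightarrow> 'r) \<Rightarrow> 'm \<Rightarrow> 'r" where
  "dual_left_act M ract a f = (\<lambda>m\<in>carrier M. f (ract m a))"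

definition right_P_pairing where
  "right_P_pairing R A C \<Delta> \<epsilon> p M ract N \<rho> q \<longleftrightarrow>
     pairing R M N q \<and> right_module R A M ract \<and> right_comodule R C \<Delta> \<epsilon> N \<rho> \<and>
     (\<forall>m\<in>carrier M. \<forall>a\<in>carrier A.
        kappa N q (ract m a) = dual_right_act N (comodule_act R p N \<rho>) (kappa N q m) a)"


section \<open>Rational part and finite dual\<close>

definition Rat ::
    "('r, 'z) ring_scheme \<Rightarrow> ('r, 'a) module \<Rightarrow> ('r, 'c) module \<Rightarrow> ('a \<Rightarrow> 'c \<Rightarrow> 'r)
      \<Rightarrow> ('r, 'x) module \<Rightarrow> ('a \<Rightarrow> 'x \<Rightarrow> 'x) \<Rightarrow> 'x set" where
  "Rat R A C p X lact = {x \<in> carrier X. \<exists>t\<in>carrier (tensor R X C).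
     \<forall>a\<in>carrier A. lact a x = tensor_lift R X (\<lambda>y c. p a c \<odot>\<^bsub>X\<^esub> y) t}"

definition rat_dual where
  "rat_dual R A C p M ract = Rat R A C p (dual_module R M) (dual_left_act M ract)"

definition cofinite_submodule ::
    "('r, 'z) ring_scheme \<Rightarrow> ('r, 'a) module \<Rightarrow> ('r, 'm) module \<Rightarrow> ('m \<Rightarrow> 'a \<Rightarrow> 'm)
      \<Rightarrow> 'm set \<Rightarrow> bool" where
  "cofinite_submodule R A M ract L \<longleftrightarrow> submodule L R M \<and>
     (\<forall>x\<in>L. \<forall>a\<in>carrier A. ract x a \<in> L) \<and> fin_gen_module R (quot_module M L)"

definition finite_dual where
  "finite_dual R A M ract = {f \<in> carrier (dual_module R M).
     \<exists>L. cofinite_submodule R A M ract L \<and> (\<forall>x\<in>L. f x = \<zero>\<^bsub>R\<^esub>)}"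

definition cofinitely_cogenerated where
  "cofinitely_cogenerated R A M ract \<longleftrightarrow>
     (\<forall>L. cofinite_submodule R A M ract L \<longrightarrow> cogenerated R (quot_module M L))"


section \<open>Linear topologies and coreflexivity\<close>

text \<open>
  The translation-invariant topology with neighbourhood basis \<open>\<BB>\<close> of \<open>0\<close>, where \<open>\<BB>\<close> is a filter
  base of subgroups; see lemma \<open>openin_linear_topology\<close> below.
\<close>

definition linear_topology :: "('r, 'm) module \<Rightarrow> 'm set set \<Rightarrow> 'm topology" where
  "linear_topology M \<BB> = topology_generated_by {B +>\<^bsub>M\<^esub> x | B x. B \<in> \<BB> \<and> x \<in> carrier M}"

definition annihilator ::
    "('r, 'z) ring_scheme \<Rightarrow> ('r, 'm) module \<Rightarrow> ('m \<Rightarrow> 'n \<Rightarrow> 'r) \<Rightarrow> 'n set \<Rightarrow> 'm set" where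
  "annihilator R M q K = {m \<in> carrier M. \<forall>n\<in>K. q m n = \<zero>\<^bsub>R\<^esub>}"

definition linear_weak_topology ::
    "('r, 'z) ring_scheme \<Rightarrow> ('r, 'm) module \<Rightarrow> ('r, 'n) module \<Rightarrow> ('m \<Rightarrow> 'n \<Rightarrow> 'r)
      \<Rightarrow> 'm topology" where
  "linear_weak_topology R M N q = linear_topology M
     {annihilator R M q K | K. submodule K R N \<and> fin_gen_module R (N\<lparr>carrier := K\<rparr>)}"

definition cofinite_topology where
  "cofinite_topology R A M ract = linear_topology M {L. cofinite_submodule R A M ract L}"

definition coreflexive where
  "coreflexive R A M ract N q \<longleftrightarrow>
     linear_weak_topology R M N q = cofinite_topology R A M ract"

definition weakly_coreflexive where
  "weakly_coreflexive R A C p M ract N q \<longleftrightarrow>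
     bij_betw (chi M q) (carrier N) (rat_dual R A C p M ract)"


section \<open>Independence of representatives and of the choice of types\<close>


lemma mod_homD:
  assumes "h \<in> mod_hom R M P"
  shows "x \<in> carrier M \<Longrightarrow> h x \<in> carrier P"
    and "\<lbrakk>x \<in> carrier M; y \<in> carrier M\<rbrakk> \<Longrightarrow> h (x \<oplus>\<^bsub>M\<^esub> y) = h x \<oplus>\<^bsub>P\<^esub> h y"
    and "\<lbrakk>r \<in> carrier R; x \<in> carrier M\<rbrakk> \<Longrightarrow> h (r \<odot>\<^bsub>M\<^esub> x) = r \<odot>\<^bsub>P\<^esub> h x"
  using assms by (auto simp: mod_hom_def)

lemma mod_hom_zero:
  assumes "Module.module R M" "Module.module R P" "h \<in> mod_hom R M P"
  shows "h \<zero>\<^bsub>M\<^esub> = \<zero>\<^bsub>P\<^esub>"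
proof -
  interpret M: Module.module R M by fact
  interpret P: Module.module R P by fact
  have "h (\<zero>\<^bsub>R\<^esub> \<odot>\<^bsub>M\<^esub> \<zero>\<^bsub>M\<^esub>) = \<zero>\<^bsub>R\<^esub> \<odot>\<^bsub>P\<^esub> h \<zero>\<^bsub>M\<^esub>"
    using mod_homD[OF assms(3)] by blast
  then show ?thesis
    using mod_homD(1)[OF assms(3)] by simp
qed

lemma mod_hom_uminus:
  assumes "Module.module R M" "Module.module R P" "h \<in> mod_hom R M P" "x \<in> carrier M"
  shows "h (\<ominus>\<^bsub>M\<^esub> x) = \<ominus>\<^bsub>P\<^esub> h x"
proof -
  interpret M: Module.module R M by fact
  interpret P: Module.module R P by fact
  have "h (\<ominus>\<^bsub>M\<^esub> x) \<oplus>\<^bsub>P\<^esub> h x = \<zero>\<^bsub>P\<^esub>"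
    using mod_homD(2)[OF assms(3), of "\<ominus>\<^bsub>M\<^esub> x" x] assms(4) mod_hom_zero[OF assms(1-3)]
    by (simp add: M.l_neg)
  then show ?thesis
    using assms(4) mod_homD(1)[OF assms(3)] by (simp add: P.minus_equality)
qed

lemma mod_hom_minus:
  assumes "Module.module R M" "Module.module R P" "h \<in> mod_hom R M P" "x \<in> carrier M" "y \<in> carrier M"
  shows "h (x \<ominus>\<^bsub>M\<^esub> y) = h x \<ominus>\<^bsub>P\<^esub> h y"
proof -
  interpret M: Module.module R M by fact
  show ?thesis
    using mod_homD(2)[OF assms(3)] mod_hom_uminus[OF assms(1-3)] assms(4,5)
    by (simp add: a_minus_def)
qed

lemma submodule_vimage:
  assumes "Module.module R M" "Module.module R P" "h \<in> mod_hom R M P" "submodule L R P"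
  shows "submodule {x \<in> carrier M. h x \<in> L} R M"
proof -
  interpret M: Module.module R M by fact
  interpret P: Module.module R P by fact
  note L = P.submoduleE[OF assms(4)]
  have "\<zero>\<^bsub>P\<^esub> \<in> L"
    using assms(4) subgroup.one_closed submodule.axioms(1) by fastforce
  then show ?thesis
    using L mod_homD[OF assms(3)] mod_hom_zero[OF assms(1-3)] mod_hom_uminus[OF assms(1-3)]
    by (intro M.submoduleI) auto
qed

lemma submodule_mod_span:
  assumes "Module.module R M" "S \<subseteq> carrier M"
  shows "submodule (mod_span R M S) R M"
proof -
  interpret M: Module.module R M by fact
  have zero: "\<zero>\<^bsub>M\<^esub> \<in> H" if "submodule H R M" for H
    using that subgroup.one_closed submodule.axioms(1) by fastforce
  have iff: "x \<in> mod_span R M S \<longleftrightarrow> (\<forall>H. submodule H R M \<longrightarrow> S \<subseteq> H \<longrightarrow> x \<in> H)" for x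
    by (auto simp: mod_span_def hull_def)
  show ?thesis
  proof (rule M.submoduleI)
    show "mod_span R M S \<subseteq> carrier M"
      using M.carrier_is_submodule assms(2) iff by blast
  qed (simp_all add: iff zero M.submoduleE(3-5))
qed

lemma submodule_zero:
  assumes "Module.module R M"
  shows "submodule {\<zero>\<^bsub>M\<^esub>} R M"
proof -
  interpret M: Module.module R M by fact
  show ?thesis by (intro M.submoduleI) auto
qed

lemma free_module_module:
  fixes R :: "('r, 'z) ring_scheme" and S :: "'s set"
  assumes "cring R"
  shows "Module.module R (free_module R S)"
proof -
  interpret R: cring R by fact
  have fin: "finite {s. \<phi> s \<oplus>\<^bsub>R\<^esub> \<psi> s \<noteq> \<zero>\<^bsub>R\<^esub>}"
    if "finite {s. \<phi> s \<noteq> \<zero>\<^bsub>R\<^esub>}" "finite {s. \<psi> s \<noteq> \<zero>\<^bsub>R\<^esub>}" for \<phi> \<psi> :: "'s \<Rightarrow> 'r"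
    by (rule finite_subset[OF _ finite_UnI[OF that]]) auto
  have fin': "finite {s. r \<otimes>\<^bsub>R\<^esub> \<phi> s \<noteq> \<zero>\<^bsub>R\<^esub>}"
    if "finite {s. \<phi> s \<noteq> \<zero>\<^bsub>R\<^esub>}" "r \<in> carrier R" for \<phi> :: "'s \<Rightarrow> 'r" and r
    by (rule finite_subset[OF _ that(1)]) (use that(2) in auto)
  have fin'': "finite {s. \<ominus>\<^bsub>R\<^esub> \<phi> s \<noteq> \<zero>\<^bsub>R\<^esub>}"
    if "finite {s. \<phi> s \<noteq> \<zero>\<^bsub>R\<^esub>}" for \<phi> :: "'s \<Rightarrow> 'r"
    by (rule finite_subset[OF _ that(1)]) auto
  have cl: "\<phi> s \<in> carrier R" if "\<phi> \<in> carrier (free_module R S)" for \<phi> s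
    using that by (cases "s \<in> S") (auto simp: free_module_def)
  show ?thesis
  proof (rule moduleI)
    show "abelian_group (free_module R S)"
    proof (rule abelian_groupI)
      fix \<phi> assume \<phi>: "\<phi> \<in> carrier (free_module R S)"
      have "(\<lambda>s. \<ominus>\<^bsub>R\<^esub> \<phi> s) \<oplus>\<^bsub>free_module R S\<^esub> \<phi> = \<zero>\<^bsub>free_module R S\<^esub>"
        using cl[OF \<phi>] by (auto simp: free_module_def R.l_neg)
      moreover have "(\<lambda>s. \<ominus>\<^bsub>R\<^esub> \<phi> s) \<in> carrier (free_module R S)"
        using \<phi> fin'' by (auto simp: free_module_def)
      ultimately show "\<exists>\<psi>\<in>carrier (free_module R S). \<psi> \<oplus>\<^bsub>free_module R S\<^esub> \<phi> = \<zero>\<^bsub>free_module R S\<^esub>"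
        by blast
    next
      fix \<phi> \<psi> assume \<phi>: "\<phi> \<in> carrier (free_module R S)" "\<psi> \<in> carrier (free_module R S)"
      show "\<phi> \<oplus>\<^bsub>free_module R S\<^esub> \<psi> \<in> carrier (free_module R S)"
        using \<phi> fin by (auto simp: free_module_def)
      show "\<phi> \<oplus>\<^bsub>free_module R S\<^esub> \<psi> = \<psi> \<oplus>\<^bsub>free_module R S\<^esub> \<phi>"
        using \<phi>[THEN cl] by (auto simp: free_module_def R.a_comm)
      fix \<theta> assume "\<theta> \<in> carrier (free_module R S)"
      then show "\<phi> \<oplus>\<^bsub>free_module R S\<^esub> \<psi> \<oplus>\<^bsub>free_module R S\<^esub> \<theta> =
          \<phi> \<oplus>\<^bsub>free_module R S\<^esub> (\<psi> \<oplus>\<^bsub>free_module R S\<^esub> \<theta>)"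
        using \<phi>[THEN cl] cl[of \<theta>] by (simp add: free_module_def R.a_assoc)
    next
      fix \<phi> assume \<phi>: "\<phi> \<in> carrier (free_module R S)"
      show "\<zero>\<^bsub>free_module R S\<^esub> \<oplus>\<^bsub>free_module R S\<^esub> \<phi> = \<phi>"
        using cl[OF \<phi>] by (simp add: free_module_def)
    qed (auto simp: free_module_def)
  next
    fix a \<phi> assume "a \<in> carrier R" "\<phi> \<in> carrier (free_module R S)"
    then show "a \<odot>\<^bsub>free_module R S\<^esub> \<phi> \<in> carrier (free_module R S)"
      using fin' by (auto simp: free_module_def)
  next
    fix a b \<phi> assume ab: "a \<in> carrier R" "b \<in> carrier R" and \<phi>: "\<phi> \<in> carrier (free_module R S)"
    show "(a \<oplus>\<^bsub>R\<^esub> b) \<odot>\<^bsub>free_module R S\<^esub> \<phi> = 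
        a \<odot>\<^bsub>free_module R S\<^esub> \<phi> \<oplus>\<^bsub>free_module R S\<^esub> b \<odot>\<^bsub>free_module R S\<^esub> \<phi>"
      using ab cl[OF \<phi>] by (auto simp: free_module_def R.l_distr)
    show "a \<otimes>\<^bsub>R\<^esub> b \<odot>\<^bsub>free_module R S\<^esub> \<phi> = a \<odot>\<^bsub>free_module R S\<^esub> (b \<odot>\<^bsub>free_module R S\<^esub> \<phi>)"
      using ab cl[OF \<phi>] by (auto simp: free_module_def R.m_assoc)
  next
    fix a \<phi> \<psi>
    assume "a \<in> carrier R" "\<phi> \<in> carrier (free_module R S)" "\<psi> \<in> carrier (free_module R S)"
    then show "a \<odot>\<^bsub>free_module R S\<^esub> (\<phi> \<oplus>\<^bsub>free_module R S\<^esub> \<psi>) =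
        a \<odot>\<^bsub>free_module R S\<^esub> \<phi> \<oplus>\<^bsub>free_module R S\<^esub> a \<odot>\<^bsub>free_module R S\<^esub> \<psi>"
      using cl[of \<phi>] cl[of \<psi>] by (simp add: free_module_def R.r_distr)
  next
    fix \<phi> assume \<phi>: "\<phi> \<in> carrier (free_module R S)"
    show "\<one>\<^bsub>R\<^esub> \<odot>\<^bsub>free_module R S\<^esub> \<phi> = \<phi>"
      using cl[OF \<phi>] by (simp add: free_module_def)
  qed fact
qed

lemma free_module_closed:
  assumes "cring R" "\<phi> \<in> carrier (free_module R S)"
  shows "\<phi> s \<in> carrier R"
  using assms ring.ring_simprules(2)[OF cring.axioms(1)] 
  by (cases "s \<in> S") (auto simp: free_module_def)

lemma free_gen_closed:
  assumes "cring R" "s \<in> S"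
  shows "free_gen R s \<in> carrier (free_module R S)"
proof -
  interpret R: cring R by fact
  have "finite {t. free_gen R s t \<noteq> \<zero>\<^bsub>R\<^esub>}"
    by (rule finite_subset[of _ "{s}"]) (auto simp: free_gen_def)
  then show ?thesis
    using assms(2) by (auto simp: free_module_def free_gen_def)
qed

lemma free_lift_superset:
  assumes "Module.module R P" "f \<in> S \<rightarrow> carrier P" "\<phi> \<in> carrier (free_module R S)"
    and "finite T" "{s. \<phi> s \<noteq> \<zero>\<^bsub>R\<^esub>} \<subseteq> T" "T \<subseteq> S"
  shows "free_lift R P f \<phi> = (\<Oplus>\<^bsub>P\<^esub>s\<in>T. \<phi> s \<odot>\<^bsub>P\<^esub> f s)"
proof -
  interpret P: Module.module R P by fact
  show ?thesis unfolding free_lift_def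
    using assms(2-6) free_module_closed[OF P.R.cring_axioms assms(3)]
    by (intro P.add.finprod_mono_neutral_cong_left) (auto simp: Pi_def)
qed

lemma free_lift_mod_hom:
  assumes "Module.module R P" "f \<in> S \<rightarrow> carrier P"
  shows "free_lift R P f \<in> mod_hom R (free_module R S) P"
proof -
  interpret P: Module.module R P by fact
  note cl = free_module_closed[OF P.R.cring_axioms]
  have supp: "finite {s. \<phi> s \<noteq> \<zero>\<^bsub>R\<^esub>}" "{s. \<phi> s \<noteq> \<zero>\<^bsub>R\<^esub>} \<subseteq> S"
    if "\<phi> \<in> carrier (free_module R S)" for \<phi>
    using that by (auto simp: free_module_def)
  interpret F: Module.module R "free_module R S"
    using free_module_module P.R.cring_axioms .
  show ?thesis unfolding mod_hom_def
  proof (intro CollectI conjI ballI funcsetI)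
    fix \<phi> assume \<phi>: "\<phi> \<in> carrier (free_module R S)"
    then have "(\<lambda>s. \<phi> s \<odot>\<^bsub>P\<^esub> f s) \<in> {s. \<phi> s \<noteq> \<zero>\<^bsub>R\<^esub>} \<rightarrow> carrier P"
      using cl[OF \<phi>] supp(2)[OF \<phi>] assms(2) by auto
    then show "free_lift R P f \<phi> \<in> carrier P"
      unfolding free_lift_def by (rule P.finsum_closed)
  next
    fix \<phi> \<psi> assume \<phi>: "\<phi> \<in> carrier (free_module R S)" and \<psi>: "\<psi> \<in> carrier (free_module R S)"
    let ?T = "{s. \<phi> s \<noteq> \<zero>\<^bsub>R\<^esub>} \<union> {s. \<psi> s \<noteq> \<zero>\<^bsub>R\<^esub>}"
    have T: "finite ?T" "?T \<subseteq> S"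
      using supp[OF \<phi>] supp[OF \<psi>] by auto
    have sum: "\<phi> \<oplus>\<^bsub>free_module R S\<^esub> \<psi> = (\<lambda>s. \<phi> s \<oplus>\<^bsub>R\<^esub> \<psi> s)"
      by (simp add: free_module_def)
    have "free_lift R P f (\<phi> \<oplus>\<^bsub>free_module R S\<^esub> \<psi>) =
        (\<Oplus>\<^bsub>P\<^esub>s\<in>?T. (\<phi> \<oplus>\<^bsub>free_module R S\<^esub> \<psi>) s \<odot>\<^bsub>P\<^esub> f s)"
      using T by (intro free_lift_superset[OF assms F.add.m_closed[OF \<phi> \<psi>]]) (auto simp: sum)
    also have "\<dots> = (\<Oplus>\<^bsub>P\<^esub>s\<in>?T. \<phi> s \<odot>\<^bsub>P\<^esub> f s \<oplus>\<^bsub>P\<^esub> \<psi> s \<odot>\<^bsub>P\<^esub> f s)"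
      using T assms(2) cl[OF \<phi>] cl[OF \<psi>]
      by (intro P.finsum_cong') (auto simp: sum Pi_def P.smult_l_distr)
    also have "\<dots> = (\<Oplus>\<^bsub>P\<^esub>s\<in>?T. \<phi> s \<odot>\<^bsub>P\<^esub> f s) \<oplus>\<^bsub>P\<^esub> (\<Oplus>\<^bsub>P\<^esub>s\<in>?T. \<psi> s \<odot>\<^bsub>P\<^esub> f s)"
      using T assms(2) cl[OF \<phi>] cl[OF \<psi>] by (intro P.finsum_addf) (auto simp: Pi_def)
    also have "\<dots> = free_lift R P f \<phi> \<oplus>\<^bsub>P\<^esub> free_lift R P f \<psi>"
      using free_lift_superset[OF assms \<phi> T(1)] free_lift_superset[OF assms \<psi> T(1)] T(2) by auto
    finally show "free_lift R P f (\<phi> \<oplus>\<^bsub>free_module R S\<^esub> \<psi>) = free_lift R P f \<phi> \<oplus>\<^bsub>P\<^esub> free_lift R P f \<psi>" .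
  next
    fix r \<phi> assume r: "r \<in> carrier R" and \<phi>: "\<phi> \<in> carrier (free_module R S)"
    let ?T = "{s. \<phi> s \<noteq> \<zero>\<^bsub>R\<^esub>}"
    have smult: "r \<odot>\<^bsub>free_module R S\<^esub> \<phi> = (\<lambda>s. r \<otimes>\<^bsub>R\<^esub> \<phi> s)"
      by (simp add: free_module_def)
    have "free_lift R P f (r \<odot>\<^bsub>free_module R S\<^esub> \<phi>) =
        (\<Oplus>\<^bsub>P\<^esub>s\<in>?T. (r \<odot>\<^bsub>free_module R S\<^esub> \<phi>) s \<odot>\<^bsub>P\<^esub> f s)"
      using supp[OF \<phi>] r
      by (intro free_lift_superset[OF assms F.smult_closed[OF r \<phi>]]) (auto simp: smult)
    also have "\<dots> = (\<Oplus>\<^bsub>P\<^esub>s\<in>?T. r \<odot>\<^bsub>P\<^esub> (\<phi> s \<odot>\<^bsub>P\<^esub> f s))"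
      using supp[OF \<phi>] assms(2) cl[OF \<phi>] r
      by (intro P.finsum_cong') (auto simp: smult Pi_def P.smult_assoc1)
    also have "\<dots> = r \<odot>\<^bsub>P\<^esub> free_lift R P f \<phi>"
      unfolding free_lift_def using supp[OF \<phi>] assms(2) cl[OF \<phi>] r
      by (intro P.finsum_smult_ldistr[symmetric]) auto
    finally show "free_lift R P f (r \<odot>\<^bsub>free_module R S\<^esub> \<phi>) = r \<odot>\<^bsub>P\<^esub> free_lift R P f \<phi>" .
  qed
qed

lemma free_lift_gen:
  assumes "Module.module R P" "f \<in> S \<rightarrow> carrier P" "s \<in> S"
  shows "free_lift R P f (free_gen R s) = f s"
proof -
  interpret P: Module.module R P by fact
  have "free_lift R P f (free_gen R s) = (\<Oplus>\<^bsub>P\<^esub>t\<in>{s}. free_gen R s t \<odot>\<^bsub>P\<^esub> f t)"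
    using assms free_gen_closed[OF P.R.cring_axioms assms(3)]
    by (intro free_lift_superset) (auto simp: free_gen_def)
  also have "\<dots> = f s"
    using funcset_mem[OF assms(2,3)] P.finsum_insert[of "{}" s "\<lambda>t. free_gen R s t \<odot>\<^bsub>P\<^esub> f t"]
    by (simp add: free_gen_def)
  finally show ?thesis .
qed


lemma regular_module_module:
  assumes "cring R"
  shows "Module.module R (regular_module R)"
proof -
  interpret R: cring R by fact
  show ?thesis
    by (intro moduleI abelian_groupI)
      (auto simp: regular_module_def R.l_distr R.r_distr R.m_assoc R.a_ac R.cring_axioms
        intro: bexI[of _ "\<ominus>\<^bsub>R\<^esub> x" for x] R.l_neg)
qed

lemma mod_hom_finsum:
  assumes "Module.module R M" "Module.module R P" "h \<in> mod_hom R M P"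
    and "finite T" "f \<in> T \<rightarrow> carrier M"
  shows "h (\<Oplus>\<^bsub>M\<^esub>s\<in>T. f s) = (\<Oplus>\<^bsub>P\<^esub>s\<in>T. h (f s))"
proof -
  interpret M: Module.module R M by fact
  interpret P: Module.module R P by fact
  show ?thesis
    using assms(4,5)
  proof (induction T rule: finite_induct)
    case empty
    then show ?case using mod_hom_zero[OF assms(1-3)] by simp
  next
    case (insert s T)
    then have "f s \<in> carrier M" "f \<in> T \<rightarrow> carrier M" "(\<lambda>s. h (f s)) \<in> T \<rightarrow> carrier P"
      using mod_homD(1)[OF assms(3)] by auto
    then show ?case
      using insert mod_homD(1,2)[OF assms(3)] by simp
  qed
qed

lemma free_lift_comp:
  assumes "Module.module R P" "Module.module R P'" "h \<in> mod_hom R P P'"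
    and "f \<in> S \<rightarrow> carrier P" "\<phi> \<in> carrier (free_module R S)"
  shows "h (free_lift R P f \<phi>) = free_lift R P' (h \<circ> f) \<phi>"
proof -
  interpret P: Module.module R P by fact
  interpret P': Module.module R P' by fact
  let ?T = "{s. \<phi> s \<noteq> \<zero>\<^bsub>R\<^esub>}"
  have T: "finite ?T" "?T \<subseteq> S"
    using assms(5) by (auto simp: free_module_def)
  note cl = free_module_closed[OF P.R.cring_axioms assms(5)]
  have "h (free_lift R P f \<phi>) = (\<Oplus>\<^bsub>P'\<^esub>s\<in>?T. h (\<phi> s \<odot>\<^bsub>P\<^esub> f s))"
    unfolding free_lift_def using T cl assms(4) by (intro mod_hom_finsum[OF assms(1-3)]) auto
  also have "\<dots> = (\<Oplus>\<^bsub>P'\<^esub>s\<in>?T. \<phi> s \<odot>\<^bsub>P'\<^esub> (h \<circ> f) s)"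
  proof (rule P'.finsum_cong')
    fix s assume "s \<in> ?T"
    then have "f s \<in> carrier P"
      using T(2) assms(4) by blast
    then show "h (\<phi> s \<odot>\<^bsub>P\<^esub> f s) = \<phi> s \<odot>\<^bsub>P'\<^esub> (h \<circ> f) s"
      using mod_homD(3)[OF assms(3) cl] by simp
  next
    show "(\<lambda>s. \<phi> s \<odot>\<^bsub>P'\<^esub> (h \<circ> f) s) \<in> ?T \<rightarrow> carrier P'"
      using T(2) assms(4) cl mod_homD(1)[OF assms(3)] by (auto simp: Pi_iff)
  qed simp
  finally show ?thesis
    by (simp add: free_lift_def)
qed

lemma free_lift_cong:
  assumes "Module.module R P" "f' \<in> S \<rightarrow> carrier P" "\<phi> \<in> carrier (free_module R S)"
    and "\<And>s. s \<in> S \<Longrightarrow> f s = f' s"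
  shows "free_lift R P f \<phi> = free_lift R P f' \<phi>"
proof -
  interpret P: Module.module R P by fact
  have S: "s \<in> S" if "\<phi> s \<noteq> \<zero>\<^bsub>R\<^esub>" for s
    using that assms(3) by (auto simp: free_module_def)
  have "f' s \<in> carrier P" if "\<phi> s \<noteq> \<zero>\<^bsub>R\<^esub>" for s
    using S[OF that] assms(2) by blast
  then show ?thesis
    unfolding free_lift_def
    using S assms(4) free_module_closed[OF P.R.cring_axioms assms(3)]
    by (intro P.finsum_cong') auto
qed

lemma free_lift_free_gen:
  assumes "cring R" "\<phi> \<in> carrier (free_module R S)"
  shows "free_lift R (free_module R S) (free_gen R) \<phi> = \<phi>"
proof
  fix t
  interpret R: cring R by fact
  have reg: "Module.module R (regular_module R)" and free: "Module.module R (free_module R S)"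
    using assms(1) by (rule regular_module_module free_module_module)+
  interpret reg: Module.module R "regular_module R" by fact
  note cl = free_module_closed[OF assms(1)]
  have ev: "(\<lambda>\<psi>. \<psi> t) \<in> mod_hom R (free_module R S) (regular_module R)"
    using cl by (auto simp: mod_hom_def regular_module_def) (auto simp: free_module_def)
  let ?T = "{s. \<phi> s \<noteq> \<zero>\<^bsub>R\<^esub>}" and ?e = "\<lambda>s. \<phi> s \<otimes>\<^bsub>R\<^esub> free_gen R s t"
  have T: "finite ?T"
    using assms(2) by (auto simp: free_module_def)
  have "free_lift R (free_module R S) (free_gen R) \<phi> t
      = free_lift R (regular_module R) ((\<lambda>\<psi>. \<psi> t) \<circ> free_gen R) \<phi>"
    by (rule free_lift_comp[OF free reg ev funcsetI[OF free_gen_closed[OF assms(1)]] assms(2)])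
  also have "\<dots> = (\<Oplus>\<^bsub>regular_module R\<^esub>s\<in>?T. ?e s)"
    by (simp add: free_lift_def regular_module_def)
  also have "\<dots> = \<phi> t"
  proof (cases "t \<in> ?T")
    case True
    have "(\<Oplus>\<^bsub>regular_module R\<^esub>s\<in>?T. ?e s) = (\<Oplus>\<^bsub>regular_module R\<^esub>s\<in>{t}. ?e s)"
      using T True cl[OF assms(2)] by (intro reg.add.finprod_mono_neutral_cong_right)
        (auto simp: free_gen_def regular_module_def)
    also have "\<dots> = \<phi> t"
    proof -
      have "?e t \<in> carrier (regular_module R)" "?e t = \<phi> t"
        using cl[OF assms(2)] by (simp_all add: free_gen_def regular_module_def)
      then show ?thesis
        using reg.finsum_insert[of "{}" t ?e] by simp
    qed
    finally show ?thesis .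
  next
    case False
    have "(\<Oplus>\<^bsub>regular_module R\<^esub>s\<in>?T. ?e s) = (\<Oplus>\<^bsub>regular_module R\<^esub>s\<in>?T. \<zero>\<^bsub>regular_module R\<^esub>)"
      using False cl[OF assms(2)] by (intro reg.finsum_cong') (auto simp: free_gen_def regular_module_def)
    also have "\<dots> = \<zero>\<^bsub>regular_module R\<^esub>"
      by simp
    also have "\<dots> = \<phi> t"
      using False by (simp add: regular_module_def)
    finally show ?thesis .
  qed
  finally show "free_lift R (free_module R S) (free_gen R) \<phi> t = \<phi> t" .
qed

lemma tensor_rels_subset:
  assumes "Module.module R M" "Module.module R N"
  shows "tensor_rels R M N \<subseteq> carrier (free_module R (carrier M \<times> carrier N))"
proof -
  interpret M: Module.module R M by fact
  interpret N: Module.module R N by fact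
  interpret F: Module.module R "free_module R (carrier M \<times> carrier N)"
    by (rule free_module_module) (rule M.R.cring_axioms)
  show ?thesis
    by (auto simp: tensor_rels_def Let_def intro!: F.minus_closed free_gen_closed M.R.cring_axioms)
qed

lemma submodule_tensor_kernel:
  assumes "Module.module R M" "Module.module R N"
  shows "submodule (tensor_kernel R M N) R (free_module R (carrier M \<times> carrier N))"
proof -
  interpret M: Module.module R M by fact
  show ?thesis
    unfolding tensor_kernel_def
    using submodule_mod_span free_module_module M.R.cring_axioms tensor_rels_subset[OF assms]
    by blast
qed

lemma tensor_rels_imageI:
  assumes "Module.module R M" "Module.module R N" "Module.module R P"
    and h: "h \<in> mod_hom R (free_module R (carrier M \<times> carrier N)) P"
    and add_l: "\<And>x x' y. \<lbrakk>x \<in> carrier M; x' \<in> carrier M; y \<in> carrier N\<rbrakk> \<Longrightarrow>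
        h (free_gen R (x \<oplus>\<^bsub>M\<^esub> x', y)) \<ominus>\<^bsub>P\<^esub> (h (free_gen R (x, y)) \<oplus>\<^bsub>P\<^esub> h (free_gen R (x', y))) \<in> L"
    and add_r: "\<And>x y y'. \<lbrakk>x \<in> carrier M; y \<in> carrier N; y' \<in> carrier N\<rbrakk> \<Longrightarrow>
        h (free_gen R (x, y \<oplus>\<^bsub>N\<^esub> y')) \<ominus>\<^bsub>P\<^esub> (h (free_gen R (x, y)) \<oplus>\<^bsub>P\<^esub> h (free_gen R (x, y'))) \<in> L"
    and smult_l: "\<And>r x y. \<lbrakk>r \<in> carrier R; x \<in> carrier M; y \<in> carrier N\<rbrakk> \<Longrightarrow>
        h (free_gen R (r \<odot>\<^bsub>M\<^esub> x, y)) \<ominus>\<^bsub>P\<^esub> (r \<odot>\<^bsub>P\<^esub> h (free_gen R (x, y))) \<in> L"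
    and smult_r: "\<And>r x y. \<lbrakk>r \<in> carrier R; x \<in> carrier M; y \<in> carrier N\<rbrakk> \<Longrightarrow>
        h (free_gen R (x, r \<odot>\<^bsub>N\<^esub> y)) \<ominus>\<^bsub>P\<^esub> (r \<odot>\<^bsub>P\<^esub> h (free_gen R (x, y))) \<in> L"
    and L: "submodule L R P"
    and \<phi>: "\<phi> \<in> tensor_kernel R M N"
  shows "h \<phi> \<in> L"
proof -
  interpret M: Module.module R M by fact
  interpret N: Module.module R N by fact
  let ?F = "free_module R (carrier M \<times> carrier N)"
  have F: "Module.module R ?F"
    by (rule free_module_module) (rule M.R.cring_axioms)
  interpret F: Module.module R ?F by (rule F)
  have gen: "free_gen R (x, y) \<in> carrier ?F" if "x \<in> carrier M" "y \<in> carrier N" for x y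
    using that by (intro free_gen_closed M.R.cring_axioms) auto
  note eqs = mod_hom_minus[OF F assms(3) h] mod_homD(2,3)[OF h]
  have "tensor_rels R M N \<subseteq> {\<psi> \<in> carrier ?F. h \<psi> \<in> L}"
    using add_l add_r smult_l smult_r tensor_rels_subset[OF assms(1,2)]
    by (auto simp: tensor_rels_def Let_def eqs gen)
  then have "tensor_kernel R M N \<subseteq> {\<psi> \<in> carrier ?F. h \<psi> \<in> L}"
    unfolding tensor_kernel_def mod_span_def
    by (rule hull_minimal) (rule submodule_vimage[OF F assms(3) h L])
  with \<phi> show ?thesis by blast
qed

lemma tensor_coset_eq_iff:
  assumes "Module.module R M" "Module.module R N"
    and "\<phi> \<in> carrier (free_module R (carrier M \<times> carrier N))"
    and "\<psi> \<in> carrier (free_module R (carrier M \<times> carrier N))"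
  defines "F \<equiv> free_module R (carrier M \<times> carrier N)"
  shows "tensor_kernel R M N +>\<^bsub>F\<^esub> \<phi> = tensor_kernel R M N +>\<^bsub>F\<^esub> \<psi>
    \<longleftrightarrow> \<phi> \<ominus>\<^bsub>F\<^esub> \<psi> \<in> tensor_kernel R M N"
proof -
  interpret M: Module.module R M by fact
  interpret F: Module.module R F
    unfolding F_def by (rule free_module_module) (rule M.R.cring_axioms)
  have "subgroup (tensor_kernel R M N) (add_monoid F)"
    using submodule_tensor_kernel[OF assms(1,2)] by (auto simp: F_def submodule_def)
  then interpret K: abelian_subgroup "tensor_kernel R M N" F
    by (intro abelian_subgroupI3 additive_subgroup.intro F.abelian_group_axioms)
  have \<phi>: "\<phi> \<in> carrier F" and \<psi>: "\<psi> \<in> carrier F"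
    using assms by auto
  show ?thesis
    using K.a_rcos_module[OF \<psi> \<phi>] K.a_repr_independence'[OF _ \<psi>, of \<phi>]
      K.a_repr_independenceD[OF \<phi>, of \<psi>]
    by (auto simp: a_minus_def)
qed

lemma tensor_lift_coset:
  assumes "Module.module R M" "Module.module R N" "Module.module R P"
    and f: "bilinear_map R M N P f"
    and \<phi>: "\<phi> \<in> carrier (free_module R (carrier M \<times> carrier N))"
  shows "tensor_lift R P f (tensor_kernel R M N +>\<^bsub>free_module R (carrier M \<times> carrier N)\<^esub> \<phi>)
    = free_lift R P (case_prod f) \<phi>"
proof -
  interpret M: Module.module R M by fact
  interpret N: Module.module R N by fact
  interpret P: Module.module R P by fact
  let ?F = "free_module R (carrier M \<times> carrier N)" and ?h = "free_lift R P (case_prod f)"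
  have F: "Module.module R ?F"
    by (rule free_module_module) (rule M.R.cring_axioms)
  interpret F: Module.module R ?F by (rule F)
  note K = F.submoduleE[OF submodule_tensor_kernel[OF assms(1,2)]]
  have fr: "f x \<in> mod_hom R N P" if "x \<in> carrier M" for x
    using f that by (simp add: bilinear_map_def)
  have fl: "(\<lambda>x. f x y) \<in> mod_hom R M P" if "y \<in> carrier N" for y
    using f that by (simp add: bilinear_map_def)
  have fcl: "f x y \<in> carrier P" if "x \<in> carrier M" "y \<in> carrier N" for x y
    using mod_homD(1)[OF fr] that by blast
  then have f': "case_prod f \<in> carrier M \<times> carrier N \<rightarrow> carrier P"
    by auto
  have h: "?h \<in> mod_hom R ?F P"
    by (rule free_lift_mod_hom) fact+
  have gen: "?h (free_gen R (x, y)) = f x y" if "x \<in> carrier M" "y \<in> carrier N" for x y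
    using free_lift_gen[OF assms(3) f', of "(x, y)"] that by simp
  have ker: "?h \<psi> = \<zero>\<^bsub>P\<^esub>" if "\<psi> \<in> tensor_kernel R M N" for \<psi>
  proof -
    have "?h \<psi> \<in> {\<zero>\<^bsub>P\<^esub>}"
      using mod_homD(2)[OF fr] mod_homD(2)[OF fl] mod_homD(3)[OF fr] mod_homD(3)[OF fl]
      by (intro tensor_rels_imageI[OF assms(1-3) h _ _ _ _ submodule_zero[OF assms(3)] that])
        (simp_all add: gen fcl P.r_neg a_minus_def)
    then show ?thesis by simp
  qed
  have "?h (\<psi> \<oplus>\<^bsub>?F\<^esub> \<phi>) = ?h \<phi>" if "\<psi> \<in> tensor_kernel R M N" for \<psi>
    using that K(1) \<phi> ker[OF that] mod_homD(1,2)[OF h] by auto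
  moreover have "tensor_kernel R M N +>\<^bsub>?F\<^esub> \<phi> = (\<lambda>\<psi>. \<psi> \<oplus>\<^bsub>?F\<^esub> \<phi>) ` tensor_kernel R M N"
    by (auto simp: a_r_coset_def r_coset_def)
  ultimately have "?h ` (tensor_kernel R M N +>\<^bsub>?F\<^esub> \<phi>) = {?h \<phi>}"
    using K(2) by (auto simp: image_image)
  then show ?thesis
    by (simp add: tensor_lift_def)
qed


lemma transport_module:
  fixes g :: "'x \<Rightarrow> 'y" and X :: "('r, 'x) module"
  assumes "Module.module R X" "inj_on g (carrier X)"
  obtains X' :: "('r, 'y) module" where "Module.module R X'" "carrier X' = g ` carrier X"
    "g \<in> mod_hom R X X'" "inv_into (carrier X) g \<in> mod_hom R X' X"
proof -
  interpret X: Module.module R X by fact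
  let ?h = "inv_into (carrier X) g"
  define X' :: "('r, 'y) module" where "X' = \<lparr>carrier = g ` carrier X, mult = undefined,
    one = undefined, zero = g \<zero>\<^bsub>X\<^esub>, add = (\<lambda>a b. g (?h a \<oplus>\<^bsub>X\<^esub> ?h b)),
    smult = (\<lambda>r a. g (r \<odot>\<^bsub>X\<^esub> ?h a))\<rparr>"
  have h [simp]: "?h (g x) = x" if "x \<in> carrier X" for x
    using that assms(2) by simp
  have ops: "carrier X' = g ` carrier X" "\<zero>\<^bsub>X'\<^esub> = g \<zero>\<^bsub>X\<^esub>"
    "a \<oplus>\<^bsub>X'\<^esub> b = g (?h a \<oplus>\<^bsub>X\<^esub> ?h b)" "r \<odot>\<^bsub>X'\<^esub> a = g (r \<odot>\<^bsub>X\<^esub> ?h a)" for a b r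
    by (simp_all add: X'_def)
  have "abelian_group X'"
  proof (rule abelian_groupI)
    fix a assume "a \<in> carrier X'"
    then obtain x where x: "x \<in> carrier X" "a = g x" by (auto simp: ops)
    then show "\<exists>b\<in>carrier X'. b \<oplus>\<^bsub>X'\<^esub> a = \<zero>\<^bsub>X'\<^esub>"
      by (intro bexI[of _ "g (\<ominus>\<^bsub>X\<^esub> x)"]) (auto simp: ops X.l_neg)
  qed (auto simp: ops X.a_ac)
  then have "Module.module R X'"
    by (intro moduleI X.R.cring_axioms)
      (auto simp: ops X.smult_l_distr X.smult_r_distr X.smult_assoc1)
  moreover have "g \<in> mod_hom R X X'" "?h \<in> mod_hom R X' X"
    by (auto simp: mod_hom_def ops)
  ultimately show thesis
    using that ops(1) by blast
qed

text \<open>The submodule of linear combinations of \<open>x 0, \<dots>, x (n - 1)\<close> in \<open>X\<close>.\<close>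

lemma finite_span_embedding:
  fixes X :: "('r, 'x) module"
  assumes "Module.module R X" "finite S" "S \<subseteq> carrier X"
  obtains Y and g :: "'x \<Rightarrow> (nat \<Rightarrow> 'r) set"
  where "submodule Y R X" "S \<subseteq> Y" "inj_on g Y"
proof -
  interpret X: Module.module R X by fact
  obtain x :: "nat \<Rightarrow> 'x" and n where S: "S = x ` {..<n}"
    using finite_imp_nat_seg_image_inj_on[OF assms(2)] by (auto simp: lessThan_def)
  then have x: "x i \<in> carrier X" if "i < n" for i
    using that assms(3) by auto
  define L where "L c = (\<Oplus>\<^bsub>X\<^esub>i\<in>{..<n}. c i \<odot>\<^bsub>X\<^esub> x i)" for c
  define Y where "Y = L ` (UNIV \<rightarrow> carrier R)"
  define g where "g y = {c \<in> UNIV \<rightarrow> carrier R. L c = y}" for y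
  have L_add: "L (\<lambda>i. c i \<oplus>\<^bsub>R\<^esub> d i) = L c \<oplus>\<^bsub>X\<^esub> L d"
    if "c \<in> UNIV \<rightarrow> carrier R" "d \<in> UNIV \<rightarrow> carrier R" for c d
  proof -
    have "L (\<lambda>i. c i \<oplus>\<^bsub>R\<^esub> d i) = (\<Oplus>\<^bsub>X\<^esub>i\<in>{..<n}. c i \<odot>\<^bsub>X\<^esub> x i \<oplus>\<^bsub>X\<^esub> d i \<odot>\<^bsub>X\<^esub> x i)"
      unfolding L_def using that x by (intro X.finsum_cong') (auto simp: X.smult_l_distr Pi_iff)
    also have "\<dots> = L c \<oplus>\<^bsub>X\<^esub> L d"
      unfolding L_def using that x by (intro X.finsum_addf) (auto simp: Pi_iff)
    finally show ?thesis .
  qed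
  have L_smult: "L (\<lambda>i. r \<otimes>\<^bsub>R\<^esub> c i) = r \<odot>\<^bsub>X\<^esub> L c"
    if "c \<in> UNIV \<rightarrow> carrier R" "r \<in> carrier R" for c r
  proof -
    have "L (\<lambda>i. r \<otimes>\<^bsub>R\<^esub> c i) = (\<Oplus>\<^bsub>X\<^esub>i\<in>{..<n}. r \<odot>\<^bsub>X\<^esub> (c i \<odot>\<^bsub>X\<^esub> x i))"
      unfolding L_def using that x by (intro X.finsum_cong') (auto simp: X.smult_assoc1 Pi_iff)
    also have "\<dots> = r \<odot>\<^bsub>X\<^esub> L c"
      unfolding L_def using that x by (intro X.finsum_smult_ldistr[symmetric]) (auto simp: Pi_iff)
    finally show ?thesis .
  qed
  have L_cl: "L c \<in> carrier X" if "c \<in> UNIV \<rightarrow> carrier R" for c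
    unfolding L_def using that x by (intro X.finsum_closed) (auto simp: Pi_iff)
  have Y_smult: "r \<odot>\<^bsub>X\<^esub> y \<in> Y" if r: "r \<in> carrier R" and y: "y \<in> Y" for r y
  proof -
    obtain c where c: "c \<in> UNIV \<rightarrow> carrier R" "y = L c"
      using y by (auto simp: Y_def)
    then show ?thesis
      unfolding Y_def using r L_smult[OF c(1) r]
      by (intro image_eqI[of _ _ "\<lambda>i. r \<otimes>\<^bsub>R\<^esub> c i"]) auto
  qed
  have Y_cl: "Y \<subseteq> carrier X"
    using L_cl by (auto simp: Y_def)
  have "submodule Y R X"
  proof (rule X.submoduleI[OF Y_cl])
    have "L (\<lambda>_. \<zero>\<^bsub>R\<^esub>) \<in> Y" unfolding Y_def by (rule imageI) auto
    then show "\<zero>\<^bsub>X\<^esub> \<in> Y"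
      using Y_smult[OF X.R.zero_closed] Y_cl X.smult_l_null by fastforce
  next
    fix y assume "y \<in> Y"
    then show "\<ominus>\<^bsub>X\<^esub> y \<in> Y"
      using Y_smult[of "\<ominus>\<^bsub>R\<^esub> \<one>\<^bsub>R\<^esub>" y] Y_cl X.smult_l_minus[of "\<one>\<^bsub>R\<^esub>" y] by auto
  next
    fix y z assume "y \<in> Y" "z \<in> Y"
    then obtain c d where cd: "c \<in> UNIV \<rightarrow> carrier R" "d \<in> UNIV \<rightarrow> carrier R" "y = L c" "z = L d"
      by (auto simp: Y_def)
    have "(\<lambda>i. c i \<oplus>\<^bsub>R\<^esub> d i) \<in> UNIV \<rightarrow> carrier R"
      using cd by auto
    then show "y \<oplus>\<^bsub>X\<^esub> z \<in> Y"
      unfolding Y_def cd(3,4) L_add[OF cd(1,2), symmetric] by (rule imageI)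
  qed (rule Y_smult)
  moreover have "S \<subseteq> Y"
  proof
    fix s assume "s \<in> S"
    then obtain j where j: "j < n" "s = x j"
      by (auto simp: S)
    have "L (\<lambda>i. if i = j then \<one>\<^bsub>R\<^esub> else \<zero>\<^bsub>R\<^esub>) = (\<Oplus>\<^bsub>X\<^esub>i\<in>{..<n}. if j = i then x i else \<zero>\<^bsub>X\<^esub>)"
      unfolding L_def using x by (intro X.finsum_cong') auto
    also have "\<dots> = s"
      using X.finsum_singleton[of j "{..<n}" x] j x by auto
    finally show "s \<in> Y"
      unfolding Y_def by (intro image_eqI[of _ _ "\<lambda>i. if i = j then \<one>\<^bsub>R\<^esub> else \<zero>\<^bsub>R\<^esub>"]) auto
  qed
  moreover have "inj_on g Y"
    by (rule inj_onI) (auto simp: Y_def g_def set_eq_iff)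
  ultimately show thesis by (rule that)
qed

lemma alpha_pairingD:
  fixes X :: "('r, 'x) module"
  assumes "alpha_pairing R V W q" "Module.module R X"
  shows "inj_on (alpha_map R V q X) (carrier (tensor R X W))"
proof (rule inj_onI)
  fix t1 t2 assume t: "t1 \<in> carrier (tensor R X W)" "t2 \<in> carrier (tensor R X W)"
    and eq: "alpha_map R V q X t1 = alpha_map R V q X t2"
  have V: "Module.module R V" and W: "Module.module R W"
    and q: "bilinear_map R V W (regular_module R) q"
    using assms(1) by (auto simp: alpha_pairing_def pairing_def)
  interpret V: Module.module R V by fact
  interpret W: Module.module R W by fact
  interpret X: Module.module R X by fact
  let ?F = "free_module R (carrier X \<times> carrier W)"
  have cring: "cring R" by (rule V.R.cring_axioms)
  have F: "Module.module R ?F" by (rule free_module_module[OF cring])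
  interpret F: Module.module R ?F by (rule F)
  have qW: "q v \<in> mod_hom R W (regular_module R)" if "v \<in> carrier V" for v
    using q that by (auto simp: bilinear_map_def)
  have q_cl: "q v w \<in> carrier R" if "v \<in> carrier V" "w \<in> carrier W" for v w
    using mod_homD(1)[OF qW] that by (auto simp: regular_module_def)
  have q_bil: "bilinear_map R Z W Z (\<lambda>x w. q v w \<odot>\<^bsub>Z\<^esub> x)"
    if "Module.module R Z" "v \<in> carrier V" for Z :: "('r, 'y) module" and v
  proof -
    interpret Z: Module.module R Z by fact
    note eqs = mod_homD(2,3)[OF qW[OF that(2)]]
    have comm: "a \<odot>\<^bsub>Z\<^esub> (b \<odot>\<^bsub>Z\<^esub> x) = b \<odot>\<^bsub>Z\<^esub> (a \<odot>\<^bsub>Z\<^esub> x)"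
      if "a \<in> carrier R" "b \<in> carrier R" "x \<in> carrier Z" for a b x
      using that Z.smult_assoc1[of a b x] Z.smult_assoc1[of b a x] V.R.m_comm[of a b] by simp
    have "(\<lambda>w. q v w \<odot>\<^bsub>Z\<^esub> x) \<in> mod_hom R W Z" if "x \<in> carrier Z" for x
      using that \<open>v \<in> carrier V\<close> q_cl
      by (simp add: mod_hom_def eqs Z.smult_l_distr Z.smult_assoc1 Pi_iff regular_module_def)
    moreover have "(\<lambda>x. q v w \<odot>\<^bsub>Z\<^esub> x) \<in> mod_hom R Z Z" if "w \<in> carrier W" for w
      using q_cl[OF \<open>v \<in> carrier V\<close> that]
      by (simp add: mod_hom_def Z.smult_r_distr Pi_iff comm)
    ultimately show ?thesis
      by (simp add: bilinear_map_def)
  qed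
  obtain \<phi>1 \<phi>2 where \<phi>: "\<phi>1 \<in> carrier ?F" "\<phi>2 \<in> carrier ?F"
    and t1: "t1 = tensor_kernel R X W +>\<^bsub>?F\<^esub> \<phi>1" and t2: "t2 = tensor_kernel R X W +>\<^bsub>?F\<^esub> \<phi>2"
    using t by (auto simp: tensor_def quot_module_def A_RCOSETS_def RCOSETS_def a_r_coset_def )
  define S where "S = fst ` ({s. \<phi>1 s \<noteq> \<zero>\<^bsub>R\<^esub>} \<union> {s. \<phi>2 s \<noteq> \<zero>\<^bsub>R\<^esub>})"
  have supp: "finite {s. \<phi> s \<noteq> \<zero>\<^bsub>R\<^esub>}" "{s. \<phi> s \<noteq> \<zero>\<^bsub>R\<^esub>} \<subseteq> carrier X \<times> carrier W"
    if "\<phi> \<in> carrier ?F" for \<phi>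
    using that by (auto simp: free_module_def)
  have "finite S" "S \<subseteq> carrier X"
    using supp[OF \<phi>(1)] supp[OF \<phi>(2)] by (auto simp: S_def)
  then obtain Y and g :: "'x \<Rightarrow> (nat \<Rightarrow> 'r) set" where
    Y: "submodule Y R X" "S \<subseteq> Y" "inj_on g Y"
    using finite_span_embedding[OF assms(2)] by metis
  have YX: "Y \<subseteq> carrier X"
    using X.submoduleE(1)[OF Y(1)] .
  let ?Y = "X\<lparr>carrier := Y\<rparr>"
  have "Module.module R ?Y"
    using submodule.submodule_is_module[OF Y(1) assms(2)] .
  then obtain X' where X': "Module.module R X'" "carrier X' = g ` Y" "g \<in> mod_hom R ?Y X'"
    "inv_into Y g \<in> mod_hom R X' ?Y"
    using transport_module[of R ?Y g] Y(3) by (metis partial_object.select_convs(1) partial_object.update_convs(1) partial_object.surjective)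
  define j where "j = inv_into Y g"
  have gX': "g y \<in> carrier X'" if "y \<in> Y" for y
    using that X'(2) by simp
  have jg: "j (g y) = y" if "y \<in> Y" for y
    using that Y(3) by (simp add: j_def)
  have j: "j \<in> mod_hom R X' X"
    using X'(4) YX by (auto simp: j_def mod_hom_def)
  have j_inj: "inj_on j (carrier X')"
    unfolding j_def X'(2) by (rule inj_on_inv_into) simp
  let ?F' = "free_module R (carrier X' \<times> carrier W)"
  have F': "Module.module R ?F'" by (rule free_module_module[OF cring])
  interpret X': Module.module R X' by fact
  interpret F': Module.module R ?F' by (rule F')
  define pull where "pull = free_lift R ?F' (\<lambda>(x, w). free_gen R (g x, w))"
  define push where "push = free_lift R ?F (\<lambda>(x, w). free_gen R (j x, w))"
  have push_fun: "(\<lambda>(x, w). free_gen R (j x, w)) \<in> carrier X' \<times> carrier W \<rightarrow> carrier ?F"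
    using mod_homD(1)[OF j] by (auto intro!: free_gen_closed[OF cring])
  have pull_fun: "(\<lambda>(x, w). free_gen R (g x, w)) \<in> Y \<times> carrier W \<rightarrow> carrier ?F'"
    using X'(2) by (auto intro!: free_gen_closed[OF cring])
  have push: "push \<in> mod_hom R ?F' ?F"
    unfolding push_def by (rule free_lift_mod_hom[OF F push_fun])
  have pull: "pull \<in> mod_hom R (free_module R (Y \<times> carrier W)) ?F'"
    unfolding pull_def by (rule free_lift_mod_hom[OF F' pull_fun])
  have push_gen: "push (free_gen R (x, w)) = free_gen R (j x, w)"
    if "x \<in> carrier X'" "w \<in> carrier W" for x w
    using free_lift_gen[OF F push_fun, of "(x, w)"] that by (simp add: push_def)
  have push_pull: "push (pull \<phi>) = \<phi>"
    if Y\<phi>: "\<phi> \<in> carrier (free_module R (Y \<times> carrier W))" and \<phi>: "\<phi> \<in> carrier ?F" for \<phi>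
  proof -
    have "push (pull \<phi>) = free_lift R ?F (push \<circ> (\<lambda>(x, w). free_gen R (g x, w))) \<phi>"
      unfolding pull_def by (rule free_lift_comp[OF F' F push pull_fun Y\<phi>])
    also have "\<dots> = free_lift R ?F (free_gen R) \<phi>"
      using YX X'(2) push_gen jg
      by (intro free_lift_cong[OF F _ Y\<phi>] funcsetI free_gen_closed[OF cring]) auto
    also have "\<dots> = \<phi>"
      by (rule free_lift_free_gen[OF cring \<phi>])
    finally show ?thesis .
  qed
  have Y\<phi>: "\<phi>1 \<in> carrier (free_module R (Y \<times> carrier W))"
      "\<phi>2 \<in> carrier (free_module R (Y \<times> carrier W))"
  proof -
    have "\<phi> \<in> carrier (free_module R (Y \<times> carrier W))"
      if "\<phi> \<in> carrier ?F" "fst ` {s. \<phi> s \<noteq> \<zero>\<^bsub>R\<^esub>} \<subseteq> Y" for \<phi>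
      using that supp[OF that(1)] free_module_closed[OF cring that(1)] 
      by (force simp: free_module_def image_subset_iff)
    then show "\<phi>1 \<in> carrier (free_module R (Y \<times> carrier W))"
      "\<phi>2 \<in> carrier (free_module R (Y \<times> carrier W))"
      using \<phi> Y(2) by (auto simp: S_def)
  qed
  define t' where "t' \<phi> = tensor_kernel R X' W +>\<^bsub>?F'\<^esub> pull \<phi>" for \<phi>
  have alpha: "j (alpha_map R V q X' (t' \<phi>) v) = alpha_map R V q X (tensor_kernel R X W +>\<^bsub>?F\<^esub> \<phi>) v"
    "alpha_map R V q X' (t' \<phi>) v \<in> carrier X'"
    if Y\<phi>: "\<phi> \<in> carrier (free_module R (Y \<times> carrier W))" and \<phi>: "\<phi> \<in> carrier ?F"
      and v: "v \<in> carrier V" for \<phi> v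
  proof -
    let ?f = "\<lambda>(x, w). q v w \<odot>\<^bsub>X\<^esub> x" and ?f' = "\<lambda>(x, w). q v w \<odot>\<^bsub>X'\<^esub> x"
    have p\<phi>: "pull \<phi> \<in> carrier ?F'"
      using mod_homD(1)[OF pull Y\<phi>] .
    have f': "?f' \<in> carrier X' \<times> carrier W \<rightarrow> carrier X'"
      using q_cl v by auto
    have f'_hom: "free_lift R X' ?f' \<in> mod_hom R ?F' X'"
      by (rule free_lift_mod_hom[OF X'(1) f'])
    have f'g: "?f' \<circ> (\<lambda>(x, w). (g x, w)) \<in> Y \<times> carrier W \<rightarrow> carrier X'"
      using q_cl v gX' by auto
    have a: "alpha_map R V q X' (t' \<phi>) v = free_lift R X' ?f' (pull \<phi>)"
      using v tensor_lift_coset[OF X'(1) W X'(1) q_bil[OF X'(1) v] p\<phi>]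
      by (simp add: alpha_map_def t'_def)
    also have "\<dots> = free_lift R X' (free_lift R X' ?f' \<circ> (\<lambda>(x, w). free_gen R (g x, w))) \<phi>"
      unfolding pull_def by (rule free_lift_comp[OF F' X'(1) f'_hom pull_fun Y\<phi>])
    also have "\<dots> = free_lift R X' (?f' \<circ> (\<lambda>(x, w). (g x, w))) \<phi>"
      using free_lift_gen[OF X'(1) f'] X'(2)
      by (intro free_lift_cong[OF X'(1) f'g Y\<phi>]) auto
    finally have "j (alpha_map R V q X' (t' \<phi>) v)
        = free_lift R X (j \<circ> (?f' \<circ> (\<lambda>(x, w). (g x, w)))) \<phi>"
      using free_lift_comp[OF X'(1) assms(2) j f'g Y\<phi>] by simp
    also have "\<dots> = free_lift R X ?f \<phi>"
      using mod_homD(3)[OF j] q_cl v X'(2) YX jg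
      by (intro free_lift_cong[OF assms(2) _ Y\<phi>]) auto
    also have "\<dots> = alpha_map R V q X (tensor_kernel R X W +>\<^bsub>?F\<^esub> \<phi>) v"
      using v tensor_lift_coset[OF assms(2) W assms(2) q_bil[OF assms(2) v] \<phi>]
      by (simp add: alpha_map_def)
    finally show "j (alpha_map R V q X' (t' \<phi>) v)
      = alpha_map R V q X (tensor_kernel R X W +>\<^bsub>?F\<^esub> \<phi>) v" .
    show "alpha_map R V q X' (t' \<phi>) v \<in> carrier X'"
      unfolding a using mod_homD(1)[OF f'_hom p\<phi>] .
  qed
  have "alpha_map R V q X' (t' \<phi>1) = alpha_map R V q X' (t' \<phi>2)"
  proof
    fix v
    show "alpha_map R V q X' (t' \<phi>1) v = alpha_map R V q X' (t' \<phi>2) v"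
    proof (cases "v \<in> carrier V")
      case True
      then show ?thesis
        using alpha[OF Y\<phi>(1) \<phi>(1) True] alpha[OF Y\<phi>(2) \<phi>(2) True] eq inj_onD[OF j_inj]
        by (simp add: t1 t2)
    qed (simp add: alpha_map_def)
  qed
  moreover have "t' \<phi>1 \<in> carrier (tensor R X' W)" "t' \<phi>2 \<in> carrier (tensor R X' W)"
    using mod_homD(1)[OF pull Y\<phi>(1)] mod_homD(1)[OF pull Y\<phi>(2)]
    by (auto simp: t'_def tensor_def quot_module_def A_RCOSETS_def RCOSETS_def a_r_coset_def)
  moreover have "inj_on (alpha_map R V q X') (carrier (tensor R X' W))"
    using assms(1) X'(1) by (simp add: alpha_pairing_def)
  ultimately have "t' \<phi>1 = t' \<phi>2"
    by (simp add: inj_on_eq_iff)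
  then have "pull \<phi>1 \<ominus>\<^bsub>?F'\<^esub> pull \<phi>2 \<in> tensor_kernel R X' W"
    using tensor_coset_eq_iff[OF X'(1) W mod_homD(1)[OF pull Y\<phi>(1)] mod_homD(1)[OF pull Y\<phi>(2)]]
    by (simp add: t'_def)
  moreover have "push \<psi> \<in> tensor_kernel R X W" if "\<psi> \<in> tensor_kernel R X' W" for \<psi>
  proof -
    have rel: "r \<in> tensor_kernel R X W" if "r \<in> tensor_rels R X W" for r
      unfolding tensor_kernel_def mod_span_def using that by (rule hull_inc)
    show ?thesis
    proof (rule tensor_rels_imageI[OF X'(1) W F push _ _ _ _ submodule_tensor_kernel[OF assms(2) W] that])
      fix x x' w assume "x \<in> carrier X'" "x' \<in> carrier X'" "w \<in> carrier W"
      then show "push (free_gen R (x \<oplus>\<^bsub>X'\<^esub> x', w)) \<ominus>\<^bsub>?F\<^esub>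
          (push (free_gen R (x, w)) \<oplus>\<^bsub>?F\<^esub> push (free_gen R (x', w))) \<in> tensor_kernel R X W"
        using mod_homD(1,2)[OF j]
        by (intro rel) (simp add: push_gen tensor_rels_def Let_def, blast)
    next
      fix x w w' assume "x \<in> carrier X'" "w \<in> carrier W" "w' \<in> carrier W"
      then show "push (free_gen R (x, w \<oplus>\<^bsub>W\<^esub> w')) \<ominus>\<^bsub>?F\<^esub>
          (push (free_gen R (x, w)) \<oplus>\<^bsub>?F\<^esub> push (free_gen R (x, w'))) \<in> tensor_kernel R X W"
        using mod_homD(1)[OF j]
        by (intro rel) (simp add: push_gen tensor_rels_def Let_def, blast)
    next
      fix r x w assume "r \<in> carrier R" "x \<in> carrier X'" "w \<in> carrier W"
      then show "push (free_gen R (r \<odot>\<^bsub>X'\<^esub> x, w)) \<ominus>\<^bsub>?F\<^esub>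
          (r \<odot>\<^bsub>?F\<^esub> push (free_gen R (x, w))) \<in> tensor_kernel R X W"
        using mod_homD(1,3)[OF j]
        by (intro rel) (simp add: push_gen tensor_rels_def Let_def, blast)
    next
      fix r x w assume "r \<in> carrier R" "x \<in> carrier X'" "w \<in> carrier W"
      then show "push (free_gen R (x, r \<odot>\<^bsub>W\<^esub> w)) \<ominus>\<^bsub>?F\<^esub>
          (r \<odot>\<^bsub>?F\<^esub> push (free_gen R (x, w))) \<in> tensor_kernel R X W"
        using mod_homD(1)[OF j]
        by (intro rel) (simp add: push_gen tensor_rels_def Let_def, blast)
    qed
  qed
  ultimately have "push (pull \<phi>1 \<ominus>\<^bsub>?F'\<^esub> pull \<phi>2) \<in> tensor_kernel R X W"
    by blast
  then have "\<phi>1 \<ominus>\<^bsub>?F\<^esub> \<phi>2 \<in> tensor_kernel R X W"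
    using mod_hom_minus[OF F' F push] mod_homD(1)[OF pull] Y\<phi> push_pull \<phi> by simp
  then show "t1 = t2"
    using tensor_coset_eq_iff[OF assms(2) W \<phi>] by (simp add: t1 t2)
qed


lemma cogeneratedI:
  fixes X :: "('r, 'x) module" and I :: "'i set"
  assumes j: "j \<in> mod_hom R X (power_module (regular_module R) I)" and inj: "inj_on j (carrier X)"
    and X: "Module.module R X"
  shows "cogenerated R X"
proof -
  interpret X: Module.module R X by fact
  define f where "f i = (\<lambda>x\<in>carrier X. j x i)" for i
  define k where "k x = (\<lambda>\<phi>\<in>f ` I. \<phi> x)" for x
  note power = power_module_def regular_module_def
  have jI: "j x i \<in> carrier R" if "x \<in> carrier X" "i \<in> I" for x i
    using mod_homD(1)[OF j that(1)] that(2) by (auto simp: power)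
  have add: "j (x \<oplus>\<^bsub>X\<^esub> y) i = j x i \<oplus>\<^bsub>R\<^esub> j y i"
    if "x \<in> carrier X" "y \<in> carrier X" "i \<in> I" for x y i
    using mod_homD(2)[OF j that(1,2)] that(3) by (simp add: power)
  have smult: "j (r \<odot>\<^bsub>X\<^esub> x) i = r \<otimes>\<^bsub>R\<^esub> j x i"
    if "r \<in> carrier R" "x \<in> carrier X" "i \<in> I" for r x i
    using mod_homD(3)[OF j that(1,2)] that(3) by (simp add: power)
  have "k \<in> mod_hom R X (power_module (regular_module R) (f ` I))"
    unfolding mod_hom_def
  proof (intro CollectI conjI ballI funcsetI)
    fix x assume "x \<in> carrier X"
    then show "k x \<in> carrier (power_module (regular_module R) (f ` I))"
      by (auto simp: power k_def f_def jI)
  next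
    fix x y assume "x \<in> carrier X" "y \<in> carrier X"
    then show "k (x \<oplus>\<^bsub>X\<^esub> y) = k x \<oplus>\<^bsub>power_module (regular_module R) (f ` I)\<^esub> k y"
      by (auto simp: power k_def f_def add fun_eq_iff)
  next
    fix r x assume "r \<in> carrier R" "x \<in> carrier X"
    then show "k (r \<odot>\<^bsub>X\<^esub> x) = r \<odot>\<^bsub>power_module (regular_module R) (f ` I)\<^esub> k x"
      by (auto simp: power k_def f_def smult fun_eq_iff)
  qed
  moreover have "inj_on k (carrier X)"
  proof (rule inj_onI)
    fix x y assume xy: "x \<in> carrier X" "y \<in> carrier X" "k x = k y"
    have "j x i = j y i" if "i \<in> I" for i
      using fun_cong[OF xy(3), of "f i"] xy(1,2) that by (simp add: k_def f_def)
    moreover have "j x \<in> extensional I" "j y \<in> extensional I"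
      using mod_homD(1)[OF j xy(1)] mod_homD(1)[OF j xy(2)] by (auto simp: power PiE_def)
    ultimately have "j x = j y"
      by (intro extensionalityI)
    then show "x = y"
      using inj_onD[OF inj] xy(1,2) by blast
  qed
  ultimately show ?thesis
    unfolding cogenerated_def by blast
qed

lemma openin_linear_topology:
  assumes M: "abelian_group M"
    and sub: "\<And>B. B \<in> \<BB> \<Longrightarrow> additive_subgroup B M"
    and dir: "\<And>B B'. \<lbrakk>B \<in> \<BB>; B' \<in> \<BB>\<rbrakk> \<Longrightarrow> \<exists>B''\<in>\<BB>. B'' \<subseteq> B \<inter> B'"
  shows "openin (linear_topology M \<BB>) U
    \<longleftrightarrow> U \<subseteq> carrier M \<and> (\<forall>x\<in>U. \<exists>B\<in>\<BB>. B +>\<^bsub>M\<^esub> x \<subseteq> U)"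
    (is "_ \<longleftrightarrow> ?open U")
proof -
  interpret M: abelian_group M by fact
  have sub': "abelian_subgroup B M" if "B \<in> \<BB>" for B
    using sub[OF that] M by (rule abelian_subgroupI3)
  let ?G = "{B +>\<^bsub>M\<^esub> x | B x. B \<in> \<BB> \<and> x \<in> carrier M}"
  have "?open U" if "generate_topology_on ?G U"
    using that
  proof induction
    case (Int U V)
    show ?case
    proof (intro conjI ballI)
      fix x assume "x \<in> U \<inter> V"
      then obtain B B' where B: "B \<in> \<BB>" "B' \<in> \<BB>" "B +>\<^bsub>M\<^esub> x \<subseteq> U" "B' +>\<^bsub>M\<^esub> x \<subseteq> V"
        using Int by blast
      then obtain B'' where B'': "B'' \<in> \<BB>" "B'' \<subseteq> B \<inter> B'"
        using dir by blast
      then have "B'' +>\<^bsub>M\<^esub> x \<subseteq> B +>\<^bsub>M\<^esub> x" "B'' +>\<^bsub>M\<^esub> x \<subseteq> B' +>\<^bsub>M\<^esub> x"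
        by (auto simp: a_r_coset_def r_coset_def)
      then show "\<exists>B\<in>\<BB>. B +>\<^bsub>M\<^esub> x \<subseteq> U \<inter> V"
        using B(3,4) B''(1) by blast
    qed (use Int in blast)
  next
    case (Basis U)
    then obtain B y where B: "B \<in> \<BB>" "y \<in> carrier M" and U: "U = B +>\<^bsub>M\<^esub> y"
      by blast
    interpret B: abelian_subgroup B M by (rule sub'[OF B(1)])
    have "U \<subseteq> carrier M"
      unfolding U using B(2) by (intro M.a_r_coset_subset_G B.a_subset)
    moreover have "B +>\<^bsub>M\<^esub> x = U" if "x \<in> U" for x
      using B.a_repr_independence'[OF _ B(2)] that unfolding U by blast
    ultimately show ?case
      using B(1) by blast
  qed blast+
  moreover have "openin (linear_topology M \<BB>) U" if U: "?open U"
  proof (subst openin_subopen, intro ballI)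
    fix x assume x: "x \<in> U"
    then obtain B where B: "B \<in> \<BB>" "B +>\<^bsub>M\<^esub> x \<subseteq> U"
      using U by blast
    have xM: "x \<in> carrier M"
      using x U by blast
    have "openin (linear_topology M \<BB>) (B +>\<^bsub>M\<^esub> x)"
      unfolding linear_topology_def using B(1) xM by (intro topology_generated_by_Basis) blast
    moreover have "x \<in> B +>\<^bsub>M\<^esub> x"
      using abelian_subgroup.a_rcos_self[OF sub'[OF B(1)] xM] .
    ultimately show "\<exists>T. openin (linear_topology M \<BB>) T \<and> x \<in> T \<and> T \<subseteq> U"
      using B(2) by blast
  qed
  moreover have "openin (linear_topology M \<BB>) U \<longleftrightarrow> generate_topology_on ?G U"
    by (simp only: linear_topology_def openin_topology_generated_by_iff)
  ultimately show ?thesis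
    by argo
qed

end

theory Submission
  imports Defs
begin

text \<open>
  Two submodules of functionals on \<open>M\<close> are compared: the rational ones, \<open>M\<^sup>r\<close>, and those that vanish
  on a cofinite submodule, \<open>M\<^sup>\<circ>\<close>. Three observations carry the proof.

  Rational implies continuous for the cofinite topology. If \<open>f\<close> is rational, then all functionals
  \<open>a f\<close> are combinations of finitely many \<open>g\<^sub>1, \<dots>, g\<^sub>k\<close>, so the \<open>A\<close>-submodule of all \<open>m\<close> with
  \<open>f (m A) = 0\<close> contains the common kernel of the \<open>g\<^sub>i\<close>. Over a noetherian ring a common kernel of
  finitely many functionals has a finitely generated quotient (\<open>noetherian_functionals\<close>). Hence
  \<open>M\<^sup>r \<subseteq> M\<^sup>\<circ>\<close>; as the functionals \<open>\<chi>\<^sub>Q n\<close> are rational, moreover every \<open>K\<^sup>\<bottom>\<close> with \<open>K\<close> finitely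
  generated contains a cofinite submodule, so the linear weak topology is always coarser than the cofinite one
  (\<open>rational_annihilated_by_cofinite\<close>).

  Functionals that vanish on a cofinite \<open>L \<supseteq> K\<^sup>\<bottom>\<close>, with \<open>K\<close> finitely generated, are rational
  (\<open>rational_of_annihilator\<close>). This is where the \<open>\<alpha>\<close>-condition enters. Call a map \<open>A \<rightarrow> X\<close> of finite rank if it has the form
  \<open>a \<mapsto> \<Sum> \<langle>a, c\<^sub>i\<rangle> x\<^sub>i\<close>; a functional \<open>f\<close> is rational iff \<open>a \<mapsto> a f\<close> has finite rank. The
  \<open>\<alpha>\<close>-condition makes finite rank a property that descends to submodules (\<open>finite_rank_lift\<close>),
  and therefore one that finitely many functionals detect (\<open>finite_rank_detect\<close>). It is
  detected twice: on \<open>M\<close> by generators of \<open>K\<close>, which shows that each \<open>a \<mapsto> f (m a)\<close> is given by an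
  element of \<open>C\<close>, and then on the functionals that vanish on \<open>L\<close>, which are determined by their
  values on finitely many \<open>m\<close> because \<open>M / L\<close> is finitely generated.

  Finally, let \<open>N \<simeq> M\<^sup>\<circ>\<close> and let \<open>M / L\<close> be finitely generated and cogenerated by \<open>R\<close>. The functionals
  that vanish on \<open>L\<close> correspond to a submodule \<open>K\<close> of \<open>N\<close>, which embeds in a power \<open>R\<^sup>k\<close> by evaluation
  at generators of \<open>M / L\<close> and so is finitely generated; cogeneration says that \<open>K\<^sup>\<bottom> \<subseteq> L\<close>
  (\<open>cofinite_contains_annihilator\<close>). So the cofinite topology is also the coarser one.
\<close>

section \<open>Submodules, quotients and powers\<close>

lemma submodule_zero_mem:
  "submodule H R M \<Longrightarrow> \<zero>\<^bsub>M\<^esub> \<in> H"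
  using subgroup.one_closed submodule.axioms(1) by fastforce

lemma submodule_minus_closed:
  assumes "Module.module R M" "submodule H R M" "x \<in> H" "y \<in> H"
  shows "x \<ominus>\<^bsub>M\<^esub> y \<in> H"
proof -
  interpret M: Module.module R M by fact
  show ?thesis
    using M.submoduleE(3,5)[OF assms(2)] assms(3,4) by (simp add: a_minus_def)
qed

lemma mod_span_inc: "x \<in> S \<Longrightarrow> x \<in> mod_span R M S"
  unfolding mod_span_def by (rule hull_inc)

lemma mod_span_minimal: "\<lbrakk>S \<subseteq> H; submodule H R M\<rbrakk> \<Longrightarrow> mod_span R M S \<subseteq> H"
  unfolding mod_span_def by (rule hull_minimal)

lemma mod_span_subset_carrier:
  assumes "Module.module R M" "S \<subseteq> carrier M"
  shows "mod_span R M S \<subseteq> carrier M"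
  using mod_span_minimal[OF assms(2) Module.module.carrier_is_submodule[OF assms(1)]] .

lemma mod_hom_restrict:
  "\<lbrakk>h \<in> mod_hom R M P; H \<subseteq> carrier M\<rbrakk> \<Longrightarrow> h \<in> mod_hom R (M\<lparr>carrier := H\<rparr>) P"
  by (simp add: mod_hom_def Pi_iff subset_iff)

lemma mod_hom_compose:
  "\<lbrakk>h \<in> mod_hom R M P; k \<in> mod_hom R P P'\<rbrakk> \<Longrightarrow> (\<lambda>x. k (h x)) \<in> mod_hom R M P'"
  by (simp add: mod_hom_def Pi_iff)

lemma submodule_image:
  assumes "Module.module R M" "Module.module R P" "h \<in> mod_hom R M P" "submodule H R M"
  shows "submodule (h ` H) R P"
proof -
  interpret M: Module.module R M by fact
  interpret P: Module.module R P by fact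
  note H = M.submoduleE[OF assms(4)]
  have sub: "x \<in> carrier M" if "x \<in> H" for x using H(1) that by blast
  show ?thesis
  proof (rule P.submoduleI)
    show "h ` H \<subseteq> carrier P"
      using sub mod_homD(1)[OF assms(3)] by blast
    show "\<zero>\<^bsub>P\<^esub> \<in> h ` H"
      using mod_hom_zero[OF assms(1-3)] submodule_zero_mem[OF assms(4)] by force
  next
    fix a assume "a \<in> h ` H"
    then obtain x where x: "x \<in> H" "a = h x" by blast
    then show "\<ominus>\<^bsub>P\<^esub> a \<in> h ` H"
      using mod_hom_uminus[OF assms(1-3) sub[OF x(1)]] H(3)[OF x(1)] by (metis imageI)
  next
    fix a b assume "a \<in> h ` H" "b \<in> h ` H"
    then obtain x y where x: "x \<in> H" "a = h x" "y \<in> H" "b = h y" by blast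
    then show "a \<oplus>\<^bsub>P\<^esub> b \<in> h ` H"
      using mod_homD(2)[OF assms(3) sub[OF x(1)] sub[OF x(3)]] H(5)[OF x(1,3)] by (metis imageI)
  next
    fix r a assume r: "r \<in> carrier R" and "a \<in> h ` H"
    then obtain x where x: "x \<in> H" "a = h x" by blast
    then show "r \<odot>\<^bsub>P\<^esub> a \<in> h ` H"
      using mod_homD(3)[OF assms(3) r sub[OF x(1)]] H(4)[OF r x(1)] by (metis imageI)
  qed
qed

text \<open>
  Closure under additive inverses comes for free, since \<open>- x = (- 1) x\<close>.
\<close>

lemma submodule_iff:
  assumes "Module.module R M"
  shows "submodule H R M \<longleftrightarrow> H \<subseteq> carrier M \<and> \<zero>\<^bsub>M\<^esub> \<in> H \<and>
    (\<forall>x\<in>H. \<forall>y\<in>H. x \<oplus>\<^bsub>M\<^esub> y \<in> H) \<and> (\<forall>r\<in>carrier R. \<forall>x\<in>H. r \<odot>\<^bsub>M\<^esub> x \<in> H)" (is "_ \<longleftrightarrow> ?rhs")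
proof -
  interpret M: Module.module R M by fact
  have "\<ominus>\<^bsub>M\<^esub> x \<in> H" if ?rhs "x \<in> H" for x
  proof -
    have "(\<ominus>\<^bsub>R\<^esub> \<one>\<^bsub>R\<^esub>) \<odot>\<^bsub>M\<^esub> x \<in> H" using that by blast
    moreover have "x \<in> carrier M" using that by blast
    ultimately show ?thesis by (simp add: M.smult_l_minus)
  qed
  then show ?thesis
    using M.submoduleE(1,4,5)[of H] submodule_zero_mem[of H R M] M.submoduleI[of H]
    by blast
qed

lemma mod_hom_zero_on_span:
  assumes "Module.module R M" "Module.module R P" "f \<in> mod_hom R M P" "S \<subseteq> carrier M"
    "\<And>x. x \<in> S \<Longrightarrow> f x = \<zero>\<^bsub>P\<^esub>" "x \<in> mod_span R M S"
  shows "f x = \<zero>\<^bsub>P\<^esub>"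
proof -
  have "mod_span R M S \<subseteq> {x \<in> carrier M. f x \<in> {\<zero>\<^bsub>P\<^esub>}}"
    using assms(4,5)
    by (intro mod_span_minimal submodule_vimage[OF assms(1-3) submodule_zero[OF assms(2)]]) auto
  then show ?thesis using assms(6) by blast
qed

lemma functional_zero_on_span:
  assumes "Module.module R M" "f \<in> mod_hom R M (regular_module R)" "S \<subseteq> carrier M"
    "\<And>x. x \<in> S \<Longrightarrow> f x = \<zero>\<^bsub>R\<^esub>" "x \<in> mod_span R M S"
  shows "f x = \<zero>\<^bsub>R\<^esub>"
proof -
  interpret M: Module.module R M by fact
  show ?thesis
    using mod_hom_zero_on_span[OF assms(1) regular_module_module[OF M.R.cring_axioms] assms(2,3)] assms(4,5)
    by (simp add: regular_module_def)
qed

lemma mod_span_restrict: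
  assumes "Module.module R M" "submodule K R M" "S \<subseteq> K"
  shows "mod_span R (M\<lparr>carrier := K\<rparr>) S = mod_span R M S"
proof -
  interpret M: Module.module R M by fact
  have K': "Module.module R (M\<lparr>carrier := K\<rparr>)"
    by (rule submodule.submodule_is_module[OF assms(2,1)])
  have K: "K \<subseteq> carrier M" using M.submoduleE(1)[OF assms(2)] .
  have sub: "submodule H R (M\<lparr>carrier := K\<rparr>) \<longleftrightarrow> H \<subseteq> K \<and> submodule H R M" for H
    unfolding submodule_iff[OF K'] submodule_iff[OF assms(1)] using K by auto
  have "mod_span R M S \<subseteq> K" by (rule mod_span_minimal[OF assms(3,2)])
  moreover have "submodule (mod_span R M S) R M"
    using submodule_mod_span[OF assms(1)] assms(3) K by blast
  ultimately have "mod_span R (M\<lparr>carrier := K\<rparr>) S \<subseteq> mod_span R M S"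
    using mod_span_inc by (intro mod_span_minimal) (auto simp: sub)
  moreover have "submodule (mod_span R (M\<lparr>carrier := K\<rparr>) S) R M"
    using submodule_mod_span[OF K'] assms(3) sub by auto
  then have "mod_span R M S \<subseteq> mod_span R (M\<lparr>carrier := K\<rparr>) S"
    using mod_span_inc by (intro mod_span_minimal) auto
  ultimately show ?thesis by blast
qed

lemma finsum_submodule:
  assumes "Module.module R M" "submodule H R M" "finite T" "f \<in> T \<rightarrow> H"
  shows "(\<Oplus>\<^bsub>M\<^esub>s\<in>T. f s) \<in> H"
proof -
  interpret M: Module.module R M by fact
  note H = M.submoduleE[OF assms(2)]
  show ?thesis
    using assms(3,4)
  proof (induction T rule: finite_induct)
    case empty
    then show ?case using submodule_zero_mem[OF assms(2)] by simp
  next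
    case (insert s T)
    then have "f s \<in> carrier M" "f \<in> T \<rightarrow> carrier M" "f s \<in> H" "f \<in> T \<rightarrow> H"
      using H(1) by auto
    then show ?case
      using insert H(5) by simp
  qed
qed

lemma free_module_support:
  assumes "\<phi> \<in> carrier (free_module R S)"
  shows "finite {s. \<phi> s \<noteq> \<zero>\<^bsub>R\<^esub>}" "{s. \<phi> s \<noteq> \<zero>\<^bsub>R\<^esub>} \<subseteq> S"
  using assms by (auto simp: free_module_def)

lemma free_lift_submodule:
  assumes "Module.module R M" "submodule H R M" "f \<in> S \<rightarrow> carrier M"
    "\<phi> \<in> carrier (free_module R S)" "\<And>s. \<phi> s \<noteq> \<zero>\<^bsub>R\<^esub> \<Longrightarrow> f s \<in> H"
  shows "free_lift R M f \<phi> \<in> H"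
proof -
  interpret M: Module.module R M by fact
  show ?thesis
    unfolding free_lift_def
    using assms(4,5) M.submoduleE(4)[OF assms(2)] free_module_closed[OF M.R.cring_axioms assms(4)]
    by (intro finsum_submodule[OF assms(1,2)]) (auto simp: free_module_def)
qed

text \<open>
  Relabelling the generators of a free module along \<open>u\<close> and then evaluating by \<open>f\<close> is an evaluation
  on the original free module. It serves to move a representative of a tensor along a map of one factor.
\<close>

lemma free_lift_push:
  assumes P: "Module.module R P" and f: "f \<in> S' \<rightarrow> carrier P"
    and P': "Module.module R P'" and k: "k \<in> mod_hom R P' P"
    and e: "e \<in> S \<rightarrow> carrier P'" and \<phi>: "\<phi> \<in> carrier (free_module R S)"
    and u: "\<And>s. s \<in> S \<Longrightarrow> u s \<in> S'" and eq: "\<And>s. s \<in> S \<Longrightarrow> f (u s) = k (e s)"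
  shows "free_lift R P f (free_lift R (free_module R S') (\<lambda>s. free_gen R (u s)) \<phi>) = k (free_lift R P' e \<phi>)"
proof -
  interpret P: Module.module R P by fact
  note F' = free_module_module[OF P.R.cring_axioms, of S']
  have gen: "(\<lambda>s. free_gen R (u s)) \<in> S \<rightarrow> carrier (free_module R S')"
    using u by (auto intro!: free_gen_closed[OF P.R.cring_axioms])
  have "free_lift R P f (free_lift R (free_module R S') (\<lambda>s. free_gen R (u s)) \<phi>)
      = free_lift R P (free_lift R P f \<circ> (\<lambda>s. free_gen R (u s))) \<phi>"
    by (rule free_lift_comp[OF F' P free_lift_mod_hom[OF P f] gen \<phi>])
  also have "\<dots> = free_lift R P (k \<circ> e) \<phi>"
  proof (rule free_lift_cong[OF P _ \<phi>])
    show "k \<circ> e \<in> S \<rightarrow> carrier P"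
      using mod_homD(1)[OF k] e by (auto simp: Pi_iff)
    fix s assume s: "s \<in> S"
    then show "(free_lift R P f \<circ> (\<lambda>s. free_gen R (u s))) s = (k \<circ> e) s"
      using free_lift_gen[OF P f u[OF s]] eq[OF s] by simp
  qed
  also have "\<dots> = k (free_lift R P' e \<phi>)"
    by (rule free_lift_comp[OF P' P k e \<phi>, symmetric])
  finally show ?thesis .
qed

lemma mod_span_image:
  assumes "Module.module R M" "f \<in> S \<rightarrow> carrier M"
  shows "mod_span R M (f ` S) = free_lift R M f ` carrier (free_module R S)"
proof
  interpret M: Module.module R M by fact
  note F = free_module_module[OF M.R.cring_axioms, of S]
  show "mod_span R M (f ` S) \<subseteq> free_lift R M f ` carrier (free_module R S)"
  proof (rule mod_span_minimal)
    show "f ` S \<subseteq> free_lift R M f ` carrier (free_module R S)"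
    proof (safe, rule image_eqI)
      fix s assume s: "s \<in> S"
      show "f s = free_lift R M f (free_gen R s)" by (rule free_lift_gen[OF assms s, symmetric])
      show "free_gen R s \<in> carrier (free_module R S)"
        by (rule free_gen_closed[OF M.R.cring_axioms s])
    qed
    show "submodule (free_lift R M f ` carrier (free_module R S)) R M"
      by (rule submodule_image[OF F assms(1) free_lift_mod_hom[OF assms]
          Module.module.carrier_is_submodule[OF F]])
  qed
  show "free_lift R M f ` carrier (free_module R S) \<subseteq> mod_span R M (f ` S)"
  proof safe
    fix \<phi> assume \<phi>: "\<phi> \<in> carrier (free_module R S)"
    show "free_lift R M f \<phi> \<in> mod_span R M (f ` S)"
    proof (rule free_lift_submodule[OF assms(1) _ assms(2) \<phi>])
      show "submodule (mod_span R M (f ` S)) R M"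
        using assms by (intro submodule_mod_span) auto
      fix s assume "\<phi> s \<noteq> \<zero>\<^bsub>R\<^esub>"
      then show "f s \<in> mod_span R M (f ` S)"
        using \<phi> by (intro mod_span_inc) (auto simp: free_module_def)
    qed
  qed
qed

lemma power_module_module:
  assumes "Module.module R M"
  shows "Module.module R (power_module M I)"
proof -
  interpret M: Module.module R M by fact
  show ?thesis
  proof (intro moduleI abelian_groupI M.R.cring_axioms)
    fix f assume f: "f \<in> carrier (power_module M I)"
    have "(\<lambda>i\<in>I. \<ominus>\<^bsub>M\<^esub> f i) \<oplus>\<^bsub>power_module M I\<^esub> f = \<zero>\<^bsub>power_module M I\<^esub>"
      using f by (auto simp: power_module_def M.l_neg fun_eq_iff PiE_iff)
    moreover have "(\<lambda>i\<in>I. \<ominus>\<^bsub>M\<^esub> f i) \<in> carrier (power_module M I)"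
      using f by (auto simp: power_module_def)
    ultimately show "\<exists>g\<in>carrier (power_module M I). g \<oplus>\<^bsub>power_module M I\<^esub> f = \<zero>\<^bsub>power_module M I\<^esub>"
      by blast
  qed (auto simp: power_module_def fun_eq_iff M.a_ac M.smult_l_distr M.smult_r_distr
      M.smult_assoc1 PiE_iff extensional_def)
qed

lemma power_module_eval:
  assumes "i \<in> I"
  shows "(\<lambda>f. f i) \<in> mod_hom R (power_module M I) M"
  using assms by (auto simp: mod_hom_def power_module_def)

lemma power_module_map:
  assumes "h \<in> mod_hom R M P"
  shows "(\<lambda>f. \<lambda>i\<in>I. h (f i)) \<in> mod_hom R (power_module M I) (power_module P I)"
  using assms by (auto simp: mod_hom_def power_module_def fun_eq_iff PiE_iff)

lemma submodule_mod_hom: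
  assumes "Module.module R M" "Module.module R N"
  shows "submodule (mod_hom R M N \<inter> extensional (carrier M)) R (power_module N (carrier M))"
proof -
  interpret M: Module.module R M by fact
  interpret N: Module.module R N by fact
  have comm: "a \<odot>\<^bsub>N\<^esub> (b \<odot>\<^bsub>N\<^esub> x) = b \<odot>\<^bsub>N\<^esub> (a \<odot>\<^bsub>N\<^esub> x)"
    if "a \<in> carrier R" "b \<in> carrier R" "x \<in> carrier N" for a b x
    using that N.smult_assoc1[of a b x] N.smult_assoc1[of b a x] M.R.m_comm[of a b] by simp
  show ?thesis
    unfolding submodule_iff[OF power_module_module[OF assms(2)]]
  proof (intro conjI ballI)
    show "mod_hom R M N \<inter> extensional (carrier M) \<subseteq> carrier (power_module N (carrier M))"
      by (auto simp: power_module_def mod_hom_def PiE_def)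
    show "\<zero>\<^bsub>power_module N (carrier M)\<^esub> \<in> mod_hom R M N \<inter> extensional (carrier M)"
      by (auto simp: power_module_def mod_hom_def)
    fix f assume f: "f \<in> mod_hom R M N \<inter> extensional (carrier M)"
    {
      fix g assume g: "g \<in> mod_hom R M N \<inter> extensional (carrier M)"
      have cl: "f x \<in> carrier N" "g x \<in> carrier N" if "x \<in> carrier M" for x
        using f g mod_homD(1) that by auto
      have "f (x \<oplus>\<^bsub>M\<^esub> y) \<oplus>\<^bsub>N\<^esub> g (x \<oplus>\<^bsub>M\<^esub> y) = (f x \<oplus>\<^bsub>N\<^esub> g x) \<oplus>\<^bsub>N\<^esub> (f y \<oplus>\<^bsub>N\<^esub> g y)"
        if "x \<in> carrier M" "y \<in> carrier M" for x y
        using f g that cl[OF that(1)] cl[OF that(2)] mod_homD(2)[of f R M N] mod_homD(2)[of g R M N]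
        by (simp add: N.a_ac)
      then show "f \<oplus>\<^bsub>power_module N (carrier M)\<^esub> g \<in> mod_hom R M N \<inter> extensional (carrier M)"
        using f g cl mod_homD(3)[of f R M N] mod_homD(3)[of g R M N]
        by (simp add: power_module_def mod_hom_def N.smult_r_distr Pi_iff)
    next
      fix r assume r: "r \<in> carrier R"
      have cl: "f x \<in> carrier N" if "x \<in> carrier M" for x
        using f mod_homD(1) that by auto
      then show "r \<odot>\<^bsub>power_module N (carrier M)\<^esub> f \<in> mod_hom R M N \<inter> extensional (carrier M)"
        using f r mod_homD(2,3)[of f R M N]
        by (simp add: power_module_def mod_hom_def N.smult_r_distr Pi_iff comm)
    }
  qed
qed

lemma dual_module_module:
  assumes "Module.module R M"
  shows "Module.module R (dual_module R M)"
proof -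
  interpret M: Module.module R M by fact
  have R: "Module.module R (regular_module R)"
    by (rule regular_module_module) (rule M.R.cring_axioms)
  show ?thesis
    unfolding dual_module_def hom_module_def
    by (rule submodule.submodule_is_module[OF submodule_mod_hom[OF assms R]
        power_module_module[OF R]])
qed

lemma carrier_dual_module:
  "carrier (dual_module R M) = mod_hom R M (regular_module R) \<inter> extensional (carrier M)"
  by (simp add: dual_module_def hom_module_def)

lemma dual_module_eval:
  assumes "m \<in> carrier M"
  shows "(\<lambda>f. f m) \<in> mod_hom R (dual_module R M) (regular_module R)"
  using assms mod_homD(1)
  by (auto simp: mod_hom_def dual_module_def hom_module_def power_module_def)

lemma dual_module_ops:
  assumes "m \<in> carrier M"
  shows "\<zero>\<^bsub>dual_module R M\<^esub> m = \<zero>\<^bsub>R\<^esub>"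
    "(f \<oplus>\<^bsub>dual_module R M\<^esub> g) m = f m \<oplus>\<^bsub>R\<^esub> g m"
    "(r \<odot>\<^bsub>dual_module R M\<^esub> f) m = r \<otimes>\<^bsub>R\<^esub> f m"
  using assms by (simp_all add: dual_module_def hom_module_def power_module_def regular_module_def)

lemma additive_subgroup_submodule: "submodule H R M \<Longrightarrow> additive_subgroup H M"
  by (simp add: additive_subgroup_def submodule_def)

lemma abelian_subgroup_submodule:
  assumes "Module.module R M" "submodule L R M"
  shows "abelian_subgroup L M"
proof -
  interpret M: Module.module R M by fact
  show ?thesis
    using assms(2) by (intro abelian_subgroupI3 additive_subgroup.intro M.abelian_group_axioms)
      (simp add: submodule_def)
qed

lemma coset_eq_iff:
  assumes "Module.module R M" "submodule L R M" "x \<in> carrier M" "y \<in> carrier M"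
  shows "L +>\<^bsub>M\<^esub> x = L +>\<^bsub>M\<^esub> y \<longleftrightarrow> x \<ominus>\<^bsub>M\<^esub> y \<in> L"
proof -
  interpret M: Module.module R M by fact
  interpret L: abelian_subgroup L M by (rule abelian_subgroup_submodule[OF assms(1,2)])
  show ?thesis
    using L.a_rcos_module[OF assms(4,3)] L.a_repr_independence'[OF _ assms(4), of x]
      L.a_repr_independenceD[OF assms(3), of y]
    by (auto simp: a_minus_def)
qed

lemma quot_module_smult:
  assumes "Module.module R M" "submodule L R M" "r \<in> carrier R" "x \<in> carrier M"
  shows "r \<odot>\<^bsub>quot_module M L\<^esub> (L +>\<^bsub>M\<^esub> x) = L +>\<^bsub>M\<^esub> (r \<odot>\<^bsub>M\<^esub> x)"
proof -
  interpret M: Module.module R M by fact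
  interpret L: abelian_subgroup L M by (rule abelian_subgroup_submodule[OF assms(1,2)])
  have "L +>\<^bsub>M\<^esub> (r \<odot>\<^bsub>M\<^esub> y) = L +>\<^bsub>M\<^esub> (r \<odot>\<^bsub>M\<^esub> x)" if "y \<in> L +>\<^bsub>M\<^esub> x" for y
  proof -
    obtain l where l: "l \<in> L" "y = l \<oplus>\<^bsub>M\<^esub> x"
      using \<open>y \<in> L +>\<^bsub>M\<^esub> x\<close> by (auto simp: a_r_coset_def r_coset_def)
    have lM: "l \<in> carrier M" "r \<odot>\<^bsub>M\<^esub> l \<in> L"
      using l(1) L.a_subset M.submoduleE(4)[OF assms(2,3)] by auto
    then have "r \<odot>\<^bsub>M\<^esub> y \<ominus>\<^bsub>M\<^esub> r \<odot>\<^bsub>M\<^esub> x = r \<odot>\<^bsub>M\<^esub> l"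
      using assms(3,4) l by (simp add: M.smult_r_distr a_minus_def M.a_assoc M.r_neg)
    then show ?thesis
      using coset_eq_iff[OF assms(1,2)] lM l assms(3,4) by simp
  qed
  moreover have "x \<in> L +>\<^bsub>M\<^esub> x"
    using L.a_rcos_self[OF assms(4)] .
  ultimately have "(\<Union>y\<in>L +>\<^bsub>M\<^esub> x. L +>\<^bsub>M\<^esub> (r \<odot>\<^bsub>M\<^esub> y)) = L +>\<^bsub>M\<^esub> (r \<odot>\<^bsub>M\<^esub> x)"
    by blast
  then show ?thesis
    by (simp add: quot_module_def)
qed

lemma quot_module_ops:
  assumes "Module.module R M" "submodule L R M"
  shows "carrier (quot_module M L) = (\<lambda>x. L +>\<^bsub>M\<^esub> x) ` carrier M"
    and "\<zero>\<^bsub>quot_module M L\<^esub> = L +>\<^bsub>M\<^esub> \<zero>\<^bsub>M\<^esub>"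
    and "\<lbrakk>x \<in> carrier M; y \<in> carrier M\<rbrakk>
      \<Longrightarrow> (L +>\<^bsub>M\<^esub> x) \<oplus>\<^bsub>quot_module M L\<^esub> (L +>\<^bsub>M\<^esub> y) = L +>\<^bsub>M\<^esub> (x \<oplus>\<^bsub>M\<^esub> y)"
proof -
  interpret M: Module.module R M by fact
  interpret L: abelian_subgroup L M by (rule abelian_subgroup_submodule[OF assms(1,2)])
  show "carrier (quot_module M L) = (\<lambda>x. L +>\<^bsub>M\<^esub> x) ` carrier M"
    by (auto simp: quot_module_def A_RCOSETS_def RCOSETS_def a_r_coset_def)
  show "\<zero>\<^bsub>quot_module M L\<^esub> = L +>\<^bsub>M\<^esub> \<zero>\<^bsub>M\<^esub>"
    using L.a_subset by (simp add: quot_module_def M.a_coset_add_zero)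
  show "(L +>\<^bsub>M\<^esub> x) \<oplus>\<^bsub>quot_module M L\<^esub> (L +>\<^bsub>M\<^esub> y) = L +>\<^bsub>M\<^esub> (x \<oplus>\<^bsub>M\<^esub> y)"
    if "x \<in> carrier M" "y \<in> carrier M"
    using L.a_rcos_sum[OF that] by (simp add: quot_module_def)
qed

lemma quot_module_module:
  assumes "Module.module R M" "submodule L R M"
  shows "Module.module R (quot_module M L)"
proof -
  interpret M: Module.module R M by fact
  note ops = quot_module_ops[OF assms] quot_module_smult[OF assms]
  have "\<exists>Y\<in>carrier (quot_module M L). Y \<oplus>\<^bsub>quot_module M L\<^esub> X = \<zero>\<^bsub>quot_module M L\<^esub>"
    if "X \<in> carrier (quot_module M L)" for X
  proof -
    obtain x where x: "x \<in> carrier M" "X = L +>\<^bsub>M\<^esub> x" using \<open>X \<in> _\<close> by (auto simp: ops(1))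
    show ?thesis
      by (rule bexI[of _ "L +>\<^bsub>M\<^esub> (\<ominus>\<^bsub>M\<^esub> x)"]) (use x in \<open>simp_all add: ops M.l_neg\<close>)
  qed
  then show ?thesis
    by (intro moduleI abelian_groupI M.R.cring_axioms)
      (auto simp: ops M.a_ac M.smult_l_distr M.smult_r_distr M.smult_assoc1)
qed

lemma quot_module_proj:
  assumes "Module.module R M" "submodule L R M"
  shows "(\<lambda>x. L +>\<^bsub>M\<^esub> x) \<in> mod_hom R M (quot_module M L)"
  using quot_module_ops[OF assms] quot_module_smult[OF assms] by (auto simp: mod_hom_def)

lemma coset_eq_zero_iff:
  assumes "Module.module R M" "submodule L R M" "x \<in> carrier M"
  shows "L +>\<^bsub>M\<^esub> x = \<zero>\<^bsub>quot_module M L\<^esub> \<longleftrightarrow> x \<in> L"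
proof -
  interpret M: Module.module R M by fact
  show ?thesis
    using coset_eq_iff[OF assms M.zero_closed] assms(3) quot_module_ops(2)[OF assms(1,2)]
      M.minus_equality[of "\<zero>\<^bsub>M\<^esub>" "\<zero>\<^bsub>M\<^esub>"]
    by (simp add: a_minus_def)
qed

text \<open>
  Representatives of generators of \<open>M / L\<close>, together with \<open>L\<close>, span \<open>M\<close>. In this form cofiniteness is used
  without cosets.
\<close>

lemma fin_gen_quot_iff:
  assumes "Module.module R M" "submodule L R M"
  shows "fin_gen_module R (quot_module M L)
    \<longleftrightarrow> (\<exists>T. finite T \<and> T \<subseteq> carrier M \<and> mod_span R M (T \<union> L) = carrier M)"
proof
  interpret M: Module.module R M by fact
  note Q = quot_module_module[OF assms] and \<pi> = quot_module_proj[OF assms]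
  let ?\<pi> = "\<lambda>x. L +>\<^bsub>M\<^esub> x"
  have L: "L \<subseteq> carrier M" using M.submoduleE(1)[OF assms(2)] .
  {
    assume "fin_gen_module R (quot_module M L)"
    then obtain S where S: "S \<subseteq> ?\<pi> ` carrier M" "finite S"
      "mod_span R (quot_module M L) S = ?\<pi> ` carrier M"
      unfolding fin_gen_module_def quot_module_ops(1)[OF assms] by blast
    then obtain T where T: "T \<subseteq> carrier M" "finite T" "S = ?\<pi> ` T"
      by (meson finite_subset_image)
    let ?H = "mod_span R M (T \<union> L)"
    have H: "submodule ?H R M" "?H \<subseteq> carrier M"
      using submodule_mod_span[OF assms(1)] mod_span_subset_carrier[OF assms(1)] T(1) L by simp_all
    have "?\<pi> ` carrier M \<subseteq> ?\<pi> ` ?H"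
      unfolding S(3)[symmetric]
      by (rule mod_span_minimal[OF _ submodule_image[OF assms(1) Q \<pi> H(1)]])
        (auto simp: T(3) intro: mod_span_inc)
    have "x \<in> ?H" if x: "x \<in> carrier M" for x
    proof -
      obtain y where y: "y \<in> ?H" "?\<pi> x = ?\<pi> y"
        using \<open>?\<pi> ` carrier M \<subseteq> ?\<pi> ` ?H\<close> x by blast
      then have yM: "y \<in> carrier M" using H(2) by blast
      then have "x \<ominus>\<^bsub>M\<^esub> y \<in> ?H"
        using y x coset_eq_iff[OF assms x yM] by (intro mod_span_inc) simp
      then have "(x \<ominus>\<^bsub>M\<^esub> y) \<oplus>\<^bsub>M\<^esub> y \<in> ?H"
        using y M.submoduleE(5)[OF H(1)] by blast
      then show ?thesis
        using x yM by (simp add: a_minus_def M.a_assoc M.l_neg)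
    qed
    then show "\<exists>T. finite T \<and> T \<subseteq> carrier M \<and> mod_span R M (T \<union> L) = carrier M"
      using T H(2) by blast
  next
    assume "\<exists>T. finite T \<and> T \<subseteq> carrier M \<and> mod_span R M (T \<union> L) = carrier M"
    then obtain T where T: "finite T" "T \<subseteq> carrier M" "mod_span R M (T \<union> L) = carrier M"
      by blast
    let ?H = "mod_span R (quot_module M L) (?\<pi> ` T)"
    have T': "?\<pi> ` T \<subseteq> carrier (quot_module M L)"
      using T(2) quot_module_ops(1)[OF assms] by blast
    have H: "submodule ?H R (quot_module M L)"
      by (rule submodule_mod_span[OF Q T'])
    have "\<zero>\<^bsub>quot_module M L\<^esub> \<in> ?H" by (rule submodule_zero_mem[OF H])
    moreover have "?\<pi> x = \<zero>\<^bsub>quot_module M L\<^esub>" if "x \<in> L" for x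
      using coset_eq_zero_iff[OF assms] that L by blast
    ultimately have "T \<union> L \<subseteq> {x \<in> carrier M. ?\<pi> x \<in> ?H}"
      using T(2) L mod_span_inc[of _ "?\<pi> ` T" R "quot_module M L"] by auto
    then have "mod_span R M (T \<union> L) \<subseteq> {x \<in> carrier M. ?\<pi> x \<in> ?H}"
      by (rule mod_span_minimal[OF _ submodule_vimage[OF assms(1) Q \<pi> H]])
    then have "?H = carrier (quot_module M L)"
      using mod_span_subset_carrier[OF Q T'] quot_module_ops(1)[OF assms] by (auto simp: T(3))
    then show "fin_gen_module R (quot_module M L)"
      unfolding fin_gen_module_def using T(1) T' by blast
  }
qed

section \<open>Cofinite submodules over a noetherian ring\<close>

lemma submodule_regular_ideal:
  assumes "cring R" "submodule I R (regular_module R)"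
  shows "ideal I R"
proof -
  interpret R: cring R by fact
  note reg = regular_module_module[OF assms(1)]
  interpret reg: Module.module R "regular_module R" by (rule reg)
  have I: "I \<subseteq> carrier R" "\<zero>\<^bsub>R\<^esub> \<in> I" "\<And>x y. \<lbrakk>x \<in> I; y \<in> I\<rbrakk> \<Longrightarrow> x \<oplus>\<^bsub>R\<^esub> y \<in> I"
    "\<And>r x. \<lbrakk>r \<in> carrier R; x \<in> I\<rbrakk> \<Longrightarrow> r \<otimes>\<^bsub>R\<^esub> x \<in> I"
    using assms(2) unfolding submodule_iff[OF reg] by (auto simp: regular_module_def)
  have "\<ominus>\<^bsub>R\<^esub> x \<in> I" if "x \<in> I" for x
  proof -
    have "(\<ominus>\<^bsub>R\<^esub> \<one>\<^bsub>R\<^esub>) \<otimes>\<^bsub>R\<^esub> x \<in> I" using I(4)[OF _ that] by blast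
    then show ?thesis using that I(1) R.l_minus[of "\<one>\<^bsub>R\<^esub>" x] by auto
  qed
  then have "subgroup I (add_monoid R)"
    using I by (intro subgroup.intro) (auto simp: a_inv_def[symmetric])
  then show ?thesis
  proof (rule idealI[OF R.ring_axioms])
    fix a x assume ax: "a \<in> I" "x \<in> carrier R"
    then show "x \<otimes>\<^bsub>R\<^esub> a \<in> I" using I(4) by blast
    then show "a \<otimes>\<^bsub>R\<^esub> x \<in> I" using R.m_comm[of a x] ax I(1) by auto
  qed
qed

text \<open>
  Over a noetherian ring submodules of \<open>R\<^sup>k\<close> are finitely generated, in particular the image of \<open>L\<close>
  under \<open>k\<close> functionals; here this is expressed inside \<open>L\<close>. In the induction one more functional
  cuts down the common kernel \<open>L0\<close>, and preimages of generators of the ideal \<open>f ` L0\<close> are added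
  to \<open>T\<close>.
\<close>

lemma noetherian_functionals:
  assumes "noetherian_ring R" "Module.module R M" "submodule L R M"
    and "finite F" "F \<subseteq> mod_hom R M (regular_module R)"
  shows "\<exists>T\<subseteq>L. finite T \<and> L \<subseteq> mod_span R M (T \<union> {x \<in> L. \<forall>f\<in>F. f x = \<zero>\<^bsub>R\<^esub>})"
  using assms(4,5)
proof (induction F rule: finite_induct)
  case empty
  then show ?case by (intro exI[of _ "{}"]) (auto intro: mod_span_inc)
next
  case (insert f F)
  interpret noetherian_ring R by fact
  interpret M: Module.module R M by fact
  have L: "L \<subseteq> carrier M" using M.submoduleE(1)[OF assms(3)] .
  note reg = regular_module_module[OF M.R.cring_axioms]
  have f: "f \<in> mod_hom R M (regular_module R)" using insert.prems by simp
  obtain T where T: "T \<subseteq> L" "finite T" "L \<subseteq> mod_span R M (T \<union> {x \<in> L. \<forall>f\<in>F. f x = \<zero>\<^bsub>R\<^esub>})"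
    using insert by auto
  define L0 where "L0 = {x \<in> L. \<forall>f\<in>F. f x = \<zero>\<^bsub>R\<^esub>}"
  have kernel: "g \<zero>\<^bsub>M\<^esub> = \<zero>\<^bsub>R\<^esub>" if "g \<in> mod_hom R M (regular_module R)" for g
    using mod_hom_zero[OF assms(2) reg that] by (simp add: regular_module_def)
  have zero: "g x = \<zero>\<^bsub>R\<^esub>" if "x \<in> L0" "g \<in> F" for g x
    using that unfolding L0_def by blast
  have L0: "submodule L0 R M"
    unfolding submodule_iff[OF assms(2)]
  proof (intro conjI ballI)
    fix x y assume x: "x \<in> L0" and y: "y \<in> L0"
    have "g (x \<oplus>\<^bsub>M\<^esub> y) = \<zero>\<^bsub>R\<^esub>" if "g \<in> F" for g
    proof -
      have "g \<in> mod_hom R M (regular_module R)" "x \<in> carrier M" "y \<in> carrier M"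
        using that x y L insert.prems by (auto simp: L0_def)
      then show ?thesis
        using mod_homD(2)[of g R M "regular_module R" x y] zero[OF x that] zero[OF y that]
        by (simp add: regular_module_def)
    qed
    then show "x \<oplus>\<^bsub>M\<^esub> y \<in> L0"
      using x y M.submoduleE(5)[OF assms(3)] by (simp add: L0_def)
  next
    fix r x assume r: "r \<in> carrier R" and x: "x \<in> L0"
    have "g (r \<odot>\<^bsub>M\<^esub> x) = \<zero>\<^bsub>R\<^esub>" if "g \<in> F" for g
    proof -
      have "g \<in> mod_hom R M (regular_module R)" "x \<in> carrier M"
        using that x L insert.prems by (auto simp: L0_def)
      then show ?thesis
        using mod_homD(3)[of g R M "regular_module R" r x] r zero[OF x that]
        by (simp add: regular_module_def)
    qed
    then show "r \<odot>\<^bsub>M\<^esub> x \<in> L0"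
      using r x M.submoduleE(4)[OF assms(3)] by (simp add: L0_def)
  qed (use L insert.prems kernel submodule_zero_mem[OF assms(3)] in \<open>auto simp: L0_def\<close>)
  have L0M: "L0 \<subseteq> carrier M" using L by (auto simp: L0_def)
  have "ideal (f ` L0) R"
    by (rule submodule_regular_ideal[OF M.R.cring_axioms submodule_image[OF assms(2) reg f L0]])
  then obtain A where A: "A \<subseteq> carrier R" "finite A" "f ` L0 = Idl\<^bsub>R\<^esub> A"
    using finetely_gen by meson
  then have "A \<subseteq> f ` L0" using genideal_self[OF A(1)] by simp
  then obtain T' where T': "T' \<subseteq> L0" "finite T'" "A = f ` T'"
    using A(2) by (meson finite_subset_image)
  have T'M: "T' \<subseteq> carrier M" using T'(1) L0M by blast
  let ?E = "{x \<in> L. \<forall>g\<in>insert f F. g x = \<zero>\<^bsub>R\<^esub>}"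
  let ?S = "mod_span R M (T \<union> T' \<union> ?E)"
  have S: "submodule ?S R M"
    using L T(1) T'M by (intro submodule_mod_span[OF assms(2)]) auto
  have "x \<in> ?S" if x: "x \<in> L0" for x
  proof -
    have "f ` L0 \<subseteq> f ` mod_span R M T'"
      unfolding A(3)
    proof (rule genideal_minimal)
      show "ideal (f ` mod_span R M T') R"
        by (rule submodule_regular_ideal[OF M.R.cring_axioms
              submodule_image[OF assms(2) reg f submodule_mod_span[OF assms(2) T'M]]])
      show "A \<subseteq> f ` mod_span R M T'"
        unfolding T'(3) by (auto intro: mod_span_inc)
    qed
    then obtain y where y: "y \<in> mod_span R M T'" "f x = f y" using x by blast
    have yL0: "y \<in> L0" using mod_span_minimal[OF T'(1) L0] y(1) by blast
    have yM: "y \<in> carrier M" and xM: "x \<in> carrier M" using yL0 x L0M by auto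
    have "f (x \<ominus>\<^bsub>M\<^esub> y) = \<zero>\<^bsub>R\<^esub>"
      using mod_homD[OF f] mod_hom_minus[OF assms(2) reg f xM yM] y(2) yM
        Module.module.axioms(2)[OF reg] abelian_group.r_neg[of "regular_module R" "f y"]
      by (simp add: a_minus_def) (simp add: regular_module_def)
    then have "x \<ominus>\<^bsub>M\<^esub> y \<in> ?S"
      using submodule_minus_closed[OF assms(2) L0 x yL0] by (intro mod_span_inc) (auto simp: L0_def)
    moreover have "y \<in> ?S"
      using mod_span_minimal[OF _ S, of T'] y(1) mod_span_inc[of _ "T \<union> T' \<union> ?E"] by blast
    ultimately have "(x \<ominus>\<^bsub>M\<^esub> y) \<oplus>\<^bsub>M\<^esub> y \<in> ?S"
      using M.submoduleE(5)[OF S] by blast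
    then show ?thesis
      using xM yM by (simp add: a_minus_def M.a_assoc M.l_neg)
  qed
  then have "mod_span R M (T \<union> L0) \<subseteq> ?S"
    by (intro mod_span_minimal[OF _ S]) (auto intro: mod_span_inc)
  then have "L \<subseteq> ?S" using T(3) by (auto simp: L0_def)
  moreover have "T \<union> T' \<subseteq> L" using T(1) T'(1) by (auto simp: L0_def)
  ultimately show ?case
    using T(2) T'(2) by (intro exI[of _ "T \<union> T'"]) auto
qed

lemma cofinite_submoduleI:
  assumes "noetherian_ring R" "Module.module R M" "submodule L R M"
    and "\<And>x a. \<lbrakk>x \<in> L; a \<in> carrier A\<rbrakk> \<Longrightarrow> ract x a \<in> L"
    and F: "finite F" "F \<subseteq> mod_hom R M (regular_module R)"
    and ker: "{x \<in> carrier M. \<forall>f\<in>F. f x = \<zero>\<^bsub>R\<^esub>} \<subseteq> L"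
  shows "cofinite_submodule R A M ract L"
proof -
  interpret M: Module.module R M by fact
  obtain T where T: "T \<subseteq> carrier M" "finite T"
    "carrier M \<subseteq> mod_span R M (T \<union> {x \<in> carrier M. \<forall>f\<in>F. f x = \<zero>\<^bsub>R\<^esub>})"
    using noetherian_functionals[OF assms(1,2) M.carrier_is_submodule F] by blast
  have TL: "T \<union> L \<subseteq> carrier M"
    using T(1) M.submoduleE(1)[OF assms(3)] by blast
  have "mod_span R M (T \<union> {x \<in> carrier M. \<forall>f\<in>F. f x = \<zero>\<^bsub>R\<^esub>}) \<subseteq> mod_span R M (T \<union> L)"
    using ker mod_span_inc[of _ "T \<union> L" R M]
    by (intro mod_span_minimal submodule_mod_span[OF assms(2) TL]) blast
  then have "mod_span R M (T \<union> L) = carrier M"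
    using T(3) mod_span_subset_carrier[OF assms(2) TL] by blast
  then show ?thesis
    unfolding cofinite_submodule_def fin_gen_quot_iff[OF assms(2,3)]
    using T(1,2) assms(3,4) by blast
qed

section \<open>Maps of finite rank along a pairing\<close>

definition rank_one ::
    "('r, 'v) module \<Rightarrow> ('v \<Rightarrow> 'w \<Rightarrow> 'r) \<Rightarrow> ('r, 'x) module \<Rightarrow> 'x \<times> 'w \<Rightarrow> 'v \<Rightarrow> 'x" where
  "rank_one V q X = (\<lambda>(x, w). \<lambda>v\<in>carrier V. q v w \<odot>\<^bsub>X\<^esub> x)"

text \<open>
  The image of \<open>X \<otimes> W\<close> in \<open>X\<^sup>V\<close>. The description as a span lets closure properties be checked on maps
  of rank one only.
\<close>

definition finite_rank_maps ::
    "('r, 'z) ring_scheme \<Rightarrow> ('r, 'v) module \<Rightarrow> ('r, 'w) module \<Rightarrow> ('v \<Rightarrow> 'w \<Rightarrow> 'r)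
      \<Rightarrow> ('r, 'x) module \<Rightarrow> ('v \<Rightarrow> 'x) set" where
  "finite_rank_maps R V W q X =
     mod_span R (power_module X (carrier V)) (rank_one V q X ` (carrier X \<times> carrier W))"

lemma pairing_closed:
  assumes "pairing R V W q" "v \<in> carrier V" "w \<in> carrier W"
  shows "q v w \<in> carrier R"
  using assms mod_homD(1)[of "q v" R W "regular_module R" w]
  by (auto simp: pairing_def bilinear_map_def regular_module_def)

lemma pairing_linear:
  assumes "pairing R V W q"
  shows "v \<in> carrier V \<Longrightarrow> q v \<in> mod_hom R W (regular_module R)"
    and "w \<in> carrier W \<Longrightarrow> (\<lambda>v. q v w) \<in> mod_hom R V (regular_module R)"
  using assms by (auto simp: pairing_def bilinear_map_def)

lemma pairing_smult_bilinear:
  assumes "pairing R V W q" "Module.module R X" "v \<in> carrier V"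
  shows "bilinear_map R X W X (\<lambda>x w. q v w \<odot>\<^bsub>X\<^esub> x)"
proof -
  interpret X: Module.module R X by fact
  note eqs = mod_homD(2,3)[OF pairing_linear(1)[OF assms(1,3)]]
  note cl = pairing_closed[OF assms(1,3)]
  have comm: "a \<odot>\<^bsub>X\<^esub> (b \<odot>\<^bsub>X\<^esub> x) = b \<odot>\<^bsub>X\<^esub> (a \<odot>\<^bsub>X\<^esub> x)"
    if "a \<in> carrier R" "b \<in> carrier R" "x \<in> carrier X" for a b x
    using that X.smult_assoc1[of a b x] X.smult_assoc1[of b a x] X.R.m_comm[of a b] by simp
  have "(\<lambda>w. q v w \<odot>\<^bsub>X\<^esub> x) \<in> mod_hom R W X" if "x \<in> carrier X" for x
    using that cl by (simp add: mod_hom_def eqs X.smult_l_distr X.smult_assoc1 Pi_iff regular_module_def)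
  moreover have "(\<lambda>x. q v w \<odot>\<^bsub>X\<^esub> x) \<in> mod_hom R X X" if "w \<in> carrier W" for w
    using cl[OF that] by (simp add: mod_hom_def X.smult_r_distr Pi_iff comm)
  ultimately show ?thesis
    by (simp add: bilinear_map_def)
qed

lemma rank_one_closed:
  assumes "pairing R V W q" "Module.module R X"
  shows "rank_one V q X \<in> carrier X \<times> carrier W \<rightarrow> carrier (power_module X (carrier V))"
  using Module.module.smult_closed[OF assms(2) pairing_closed[OF assms(1)]]
  by (auto simp: rank_one_def power_module_def)

lemma submodule_finite_rank_maps:
  assumes "pairing R V W q" "Module.module R X"
  shows "submodule (finite_rank_maps R V W q X) R (power_module X (carrier V))"
  unfolding finite_rank_maps_def
  using rank_one_closed[OF assms]
  by (intro submodule_mod_span power_module_module[OF assms(2)]) blast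

lemma finite_rank_maps_closed:
  assumes "pairing R V W q" "Module.module R X" "g \<in> finite_rank_maps R V W q X" "v \<in> carrier V"
  shows "g v \<in> carrier X"
proof -
  interpret P: Module.module R "power_module X (carrier V)" by (rule power_module_module[OF assms(2)])
  have "g \<in> carrier (power_module X (carrier V))"
    using P.submoduleE(1)[OF submodule_finite_rank_maps[OF assms(1,2)]] assms(3) by blast
  then show ?thesis
    using mod_homD(1)[OF power_module_eval[OF assms(4)]] by blast
qed

lemma rank_one_in_finite_rank_maps:
  "\<lbrakk>x \<in> carrier X; w \<in> carrier W\<rbrakk>
    \<Longrightarrow> (\<lambda>v\<in>carrier V. q v w \<odot>\<^bsub>X\<^esub> x) \<in> finite_rank_maps R V W q X"
  unfolding finite_rank_maps_def by (rule mod_span_inc) (force simp: rank_one_def)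

text \<open>
  A representative of a tensor is a finite formal combination of pairs; the \<open>\<alpha>\<close>-map replaces each
  pair by the corresponding map of rank one. The two sides are compared by evaluation at \<open>v\<close>.
\<close>

lemma alpha_map_coset:
  assumes "pairing R V W q" "Module.module R X" "\<phi> \<in> carrier (free_module R (carrier X \<times> carrier W))"
  shows "alpha_map R V q X (tensor_kernel R X W +>\<^bsub>free_module R (carrier X \<times> carrier W)\<^esub> \<phi>)
    = free_lift R (power_module X (carrier V)) (rank_one V q X) \<phi>" (is "?l = ?r")
proof
  fix v
  have W: "Module.module R W" using assms(1) by (simp add: pairing_def)
  note power = power_module_module[OF assms(2), of "carrier V"]
  note closed = rank_one_closed[OF assms(1,2)]
  show "?l v = ?r v"
  proof (cases "v \<in> carrier V")
    case True
    have "(\<lambda>(x, w). q v w \<odot>\<^bsub>X\<^esub> x) \<in> carrier X \<times> carrier W \<rightarrow> carrier X"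
      using Module.module.smult_closed[OF assms(2) pairing_closed[OF assms(1) True]] by auto
    then have "?r v = free_lift R X (\<lambda>(x, w). q v w \<odot>\<^bsub>X\<^esub> x) \<phi>"
      unfolding free_lift_comp[OF power assms(2) power_module_eval[OF True] closed assms(3)]
      using True by (intro free_lift_cong[OF assms(2) _ assms(3)]) (auto simp: rank_one_def)
    then show ?thesis
      using True tensor_lift_coset[OF assms(2) W assms(2) pairing_smult_bilinear[OF assms(1,2) True] assms(3)]
      by (simp add: alpha_map_def)
  next
    case False
    have "?r \<in> carrier (power_module X (carrier V))"
      using mod_homD(1)[OF free_lift_mod_hom[OF power closed] assms(3)] .
    then show ?thesis
      using False by (auto simp: alpha_map_def power_module_def)
  qed
qed

lemma carrier_tensor:
  assumes "Module.module R X" "Module.module R W"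
  shows "carrier (tensor R X W) = (\<lambda>\<phi>. tensor_kernel R X W +>\<^bsub>free_module R (carrier X \<times> carrier W)\<^esub> \<phi>)
    ` carrier (free_module R (carrier X \<times> carrier W))"
proof -
  interpret X: Module.module R X by fact
  show ?thesis
    unfolding tensor_def
    by (rule quot_module_ops(1)[OF free_module_module[OF X.R.cring_axioms]
          submodule_tensor_kernel[OF assms]])
qed

lemma finite_rank_maps_eq_alpha_map_image:
  assumes "pairing R V W q" "Module.module R X"
  shows "finite_rank_maps R V W q X = alpha_map R V q X ` carrier (tensor R X W)"
proof -
  have W: "Module.module R W" using assms(1) by (simp add: pairing_def)
  show ?thesis
    unfolding finite_rank_maps_def carrier_tensor[OF assms(2) W] image_image
      mod_span_image[OF power_module_module[OF assms(2)] rank_one_closed[OF assms]]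
    by (rule image_cong[OF refl]) (rule alpha_map_coset[OF assms, symmetric])
qed

lemma finite_rank_maps_compose:
  assumes "pairing R V W q" "Module.module R X" "Module.module R Y" "h \<in> mod_hom R X Y"
    "g \<in> finite_rank_maps R V W q X"
  shows "(\<lambda>v\<in>carrier V. h (g v)) \<in> finite_rank_maps R V W q Y"
proof -
  let ?h = "\<lambda>g. \<lambda>v\<in>carrier V. h (g v)"
  have "(\<lambda>v\<in>carrier V. h ((\<lambda>v\<in>carrier V. q v w \<odot>\<^bsub>X\<^esub> x) v)) = (\<lambda>v\<in>carrier V. q v w \<odot>\<^bsub>Y\<^esub> h x)"
    if "x \<in> carrier X" "w \<in> carrier W" for x w
    using mod_homD(3)[OF assms(4) pairing_closed[OF assms(1)]] that by (auto simp: fun_eq_iff)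
  then have "?h (rank_one V q X s) \<in> finite_rank_maps R V W q Y"
    if "s \<in> carrier X \<times> carrier W" for s
    using that rank_one_in_finite_rank_maps[where R = R and V = V and W = W and q = q and X = Y] mod_homD(1)[OF assms(4)]
    by (auto simp: rank_one_def)
  then have "finite_rank_maps R V W q X
    \<subseteq> {g \<in> carrier (power_module X (carrier V)). ?h g \<in> finite_rank_maps R V W q Y}"
    unfolding finite_rank_maps_def[of R V W q X]
    using rank_one_closed[OF assms(1,2)]
    by (intro mod_span_minimal submodule_vimage[OF power_module_module[OF assms(2)]
          power_module_module[OF assms(3)] power_module_map[OF assms(4)]
          submodule_finite_rank_maps[OF assms(1,3)]]) auto
  then show ?thesis using assms(5) by blast
qed

lemma chi_mod_hom:
  assumes "pairing R V W q"
  shows "chi V q \<in> mod_hom R W (dual_module R V)"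
  unfolding mod_hom_def
proof (intro CollectI conjI ballI funcsetI)
  interpret V: Module.module R V using assms by (simp add: pairing_def)
  fix w assume w: "w \<in> carrier W"
  note q = mod_homD[OF pairing_linear(2)[OF assms w]]
  have "(\<lambda>v\<in>carrier V. q v w) \<in> mod_hom R V (regular_module R)"
    using q by (auto simp: mod_hom_def)
  then show "chi V q w \<in> carrier (dual_module R V)"
    by (simp add: carrier_dual_module chi_def)
next
  fix w w' assume "w \<in> carrier W" "w' \<in> carrier W"
  then show "chi V q (w \<oplus>\<^bsub>W\<^esub> w') = chi V q w \<oplus>\<^bsub>dual_module R V\<^esub> chi V q w'"
    using mod_homD(2)[OF pairing_linear(1)[OF assms]]
    by (auto simp: chi_def dual_module_def hom_module_def power_module_def regular_module_def fun_eq_iff)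
next
  fix r w assume "r \<in> carrier R" "w \<in> carrier W"
  then show "chi V q (r \<odot>\<^bsub>W\<^esub> w) = r \<odot>\<^bsub>dual_module R V\<^esub> chi V q w"
    using mod_homD(3)[OF pairing_linear(1)[OF assms]]
    by (auto simp: chi_def dual_module_def hom_module_def power_module_def regular_module_def fun_eq_iff)
qed

text \<open>
  Scalars can be moved to the second factor, as in \<open>R \<otimes> W \<simeq> W\<close>.
\<close>

lemma finite_rank_maps_regular:
  assumes "pairing R V W q"
  shows "finite_rank_maps R V W q (regular_module R) = chi V q ` carrier W"
proof
  interpret W: Module.module R W using assms by (simp add: pairing_def)
  note reg = regular_module_module[OF W.R.cring_axioms]
  have chi: "chi V q \<in> mod_hom R W (power_module (regular_module R) (carrier V))"
    using chi_mod_hom[OF assms]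
    by (simp add: mod_hom_def dual_module_def hom_module_def power_module_def Pi_iff PiE_def)
  have rank_one: "rank_one V q (regular_module R) (r, w) = chi V q (r \<odot>\<^bsub>W\<^esub> w)"
    if "r \<in> carrier R" "w \<in> carrier W" for r w
    using mod_homD(3)[OF pairing_linear(1)[OF assms] that(1,2)] pairing_closed[OF assms _ that(2)]
      W.R.m_comm that
    by (auto simp: rank_one_def chi_def fun_eq_iff regular_module_def)
  show "finite_rank_maps R V W q (regular_module R) \<subseteq> chi V q ` carrier W"
    unfolding finite_rank_maps_def
  proof (rule mod_span_minimal)
    show "submodule (chi V q ` carrier W) R (power_module (regular_module R) (carrier V))"
      by (rule submodule_image[OF W.module_axioms power_module_module[OF reg] chi W.carrier_is_submodule])
    show "rank_one V q (regular_module R) ` (carrier (regular_module R) \<times> carrier W) \<subseteq> chi V q ` carrier W"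
      using rank_one by (auto simp: regular_module_def)
  qed
  show "chi V q ` carrier W \<subseteq> finite_rank_maps R V W q (regular_module R)"
  proof safe
    fix w assume w: "w \<in> carrier W"
    have "rank_one V q (regular_module R) (\<one>\<^bsub>R\<^esub>, w) \<in> finite_rank_maps R V W q (regular_module R)"
      unfolding finite_rank_maps_def using w by (intro mod_span_inc) (auto simp: regular_module_def)
    then show "chi V q w \<in> finite_rank_maps R V W q (regular_module R)"
      using rank_one[of "\<one>\<^bsub>R\<^esub>" w] w by simp
  qed
qed

lemma finite_rank_maps_bounded:
  assumes "pairing R V W q" "Module.module R X" "g \<in> finite_rank_maps R V W q X"
  shows "\<exists>F\<subseteq>carrier X. finite F \<and> (\<forall>v\<in>carrier V. g v \<in> mod_span R X F)"
proof -
  note power = power_module_module[OF assms(2), of "carrier V"]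
  note closed = rank_one_closed[OF assms(1,2)]
  interpret X: Module.module R X by fact
  obtain \<phi> where \<phi>: "\<phi> \<in> carrier (free_module R (carrier X \<times> carrier W))"
    "g = free_lift R (power_module X (carrier V)) (rank_one V q X) \<phi>"
    using assms(3) unfolding finite_rank_maps_def mod_span_image[OF power closed] by blast
  define F where "F = fst ` {s. \<phi> s \<noteq> \<zero>\<^bsub>R\<^esub>}"
  have F: "finite F" "F \<subseteq> carrier X"
    using free_module_support[OF \<phi>(1)] by (auto simp: F_def)
  note span = submodule_mod_span[OF assms(2) F(2)]
  have "g v \<in> mod_span R X F" if v: "v \<in> carrier V" for v
  proof -
    have "g v = free_lift R X ((\<lambda>g. g v) \<circ> rank_one V q X) \<phi>"
      unfolding \<phi>(2) by (rule free_lift_comp[OF power assms(2) power_module_eval[OF v] closed \<phi>(1)])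
    also have "\<dots> \<in> mod_span R X F"
    proof (rule free_lift_submodule[OF assms(2) span _ \<phi>(1)])
      show "(\<lambda>g. g v) \<circ> rank_one V q X \<in> carrier X \<times> carrier W \<rightarrow> carrier X"
        using closed mod_homD(1)[OF power_module_eval[OF v]] by fastforce
      fix s assume s: "\<phi> s \<noteq> \<zero>\<^bsub>R\<^esub>"
      then have "fst s \<in> F" "snd s \<in> carrier W"
        using free_module_support(2)[OF \<phi>(1)] by (auto simp: F_def)
      then show "((\<lambda>g. g v) \<circ> rank_one V q X) s \<in> mod_span R X F"
        using X.submoduleE(4)[OF span] v pairing_closed[OF assms(1) v] mod_span_inc[of "fst s" F R X]
        by (simp add: rank_one_def case_prod_unfold)
    qed
    finally show ?thesis .
  qed
  then show ?thesis using F by blast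
qed

section \<open>Consequences of the alpha condition\<close>

text \<open>
  The \<open>\<alpha>\<close>-condition as a purity statement: a map that takes values in the image of \<open>h\<close> and has finite
  rank as a map to \<open>Y\<close> comes from a tensor in \<open>M \<otimes> W\<close>. Let \<open>Z = Y / h(M)\<close> be the cokernel of \<open>h\<close>. A tensor
  \<open>\<psi>\<close> in \<open>Y \<otimes> W\<close> that represents \<open>h \<circ> g\<close> induces the zero map \<open>V \<rightarrow> Z\<close>, so its image in \<open>Z \<otimes> W\<close>
  is zero by injectivity of the \<open>\<alpha>\<close>-map. It remains to use right exactness of \<open>\<otimes> W\<close>. Only its
  effect on maps \<open>V \<rightarrow> Y\<close> is needed: with \<open>L\<close> the set of maps \<open>h \<circ> g'\<close>, \<open>g'\<close> of finite rank, the
  bilinear map \<open>B\<close> from \<open>Z \<times> W\<close> to \<open>Q = Y\<^sup>V / L\<close> sends \<open>(y + h(M), w)\<close> to the class of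
  \<open>v \<mapsto> \<langle>v, w\<rangle> y\<close>. The induced map on \<open>Z \<otimes> W\<close> sends the image of \<open>\<psi>\<close> to the class of \<open>h \<circ> g\<close>,
  which is therefore zero.
\<close>

lemma finite_rank_lift:
  assumes \<alpha>: "alpha_pairing R V W q" and M: "Module.module R M" and Y: "Module.module R Y"
    and h: "h \<in> mod_hom R M Y" and g: "g \<in> carrier V \<rightarrow> carrier M"
    and hg: "(\<lambda>v\<in>carrier V. h (g v)) \<in> finite_rank_maps R V W q Y"
  shows "\<exists>g'\<in>finite_rank_maps R V W q M. \<forall>v\<in>carrier V. h (g' v) = h (g v)"
proof -
  have p: "pairing R V W q" and W: "Module.module R W"
    using \<alpha> by (auto simp: alpha_pairing_def pairing_def)
  interpret M: Module.module R M by fact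
  interpret Y: Module.module R Y by fact
  have cring: "cring R" by (rule M.R.cring_axioms)
  define I where "I = h ` carrier M"
  have I: "submodule I R Y"
    unfolding I_def by (rule submodule_image[OF M Y h M.carrier_is_submodule])
  define Z where "Z = quot_module Y I"
  define \<pi> where "\<pi> y = I +>\<^bsub>Y\<^esub> y" for y
  have Z: "Module.module R Z" and \<pi>: "\<pi> \<in> mod_hom R Y Z" and Z_carrier: "carrier Z = \<pi> ` carrier Y"
    unfolding Z_def \<pi>_def
    using quot_module_module[OF Y I] quot_module_proj[OF Y I] quot_module_ops(1)[OF Y I] by auto
  interpret Z: Module.module R Z by fact
  let ?YV = "power_module Y (carrier V)"
  have YV: "Module.module R ?YV" by (rule power_module_module[OF Y])
  interpret YV: Module.module R ?YV by (rule YV)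
  define L where "L = (\<lambda>g. \<lambda>v\<in>carrier V. h (g v)) ` finite_rank_maps R V W q M"
  have L: "submodule L R ?YV"
    unfolding L_def
    by (rule submodule_image[OF power_module_module[OF M] YV power_module_map[OF h]
          submodule_finite_rank_maps[OF p M]])
  define Q where "Q = quot_module ?YV L"
  define \<theta> where "\<theta> f = L +>\<^bsub>?YV\<^esub> f" for f
  have Q: "Module.module R Q" and \<theta>: "\<theta> \<in> mod_hom R ?YV Q"
    unfolding Q_def \<theta>_def using quot_module_module[OF YV L] quot_module_proj[OF YV L] by auto
  interpret Q: Module.module R Q by (rule Q)
  let ?\<nu> = "rank_one V q Y"
  note closed = rank_one_closed[OF p Y]
  have \<nu>: "?\<nu> (y, w) \<in> carrier ?YV" if "y \<in> carrier Y" "w \<in> carrier W" for y w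
    using closed that by blast
  have \<nu>_add: "?\<nu> (y \<oplus>\<^bsub>Y\<^esub> y', w) = ?\<nu> (y, w) \<oplus>\<^bsub>?YV\<^esub> ?\<nu> (y', w)"
    if "y \<in> carrier Y" "y' \<in> carrier Y" "w \<in> carrier W" for y y' w
    using that pairing_closed[OF p] by (auto simp: rank_one_def power_module_def fun_eq_iff Y.smult_r_distr)
  have \<nu>_add': "?\<nu> (y, w \<oplus>\<^bsub>W\<^esub> w') = ?\<nu> (y, w) \<oplus>\<^bsub>?YV\<^esub> ?\<nu> (y, w')"
    if "y \<in> carrier Y" "w \<in> carrier W" "w' \<in> carrier W" for y w w'
    using that mod_homD(2)[OF bspec[OF conjunct1[OF pairing_smult_bilinear[OF p Y, unfolded bilinear_map_def]]]]
    by (auto simp: rank_one_def power_module_def fun_eq_iff)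
  have \<nu>_smult: "?\<nu> (r \<odot>\<^bsub>Y\<^esub> y, w) = r \<odot>\<^bsub>?YV\<^esub> ?\<nu> (y, w)"
    if "r \<in> carrier R" "y \<in> carrier Y" "w \<in> carrier W" for r y w
    using that mod_homD(3)[OF bspec[OF conjunct2[OF pairing_smult_bilinear[OF p Y, unfolded bilinear_map_def]]]]
    by (auto simp: rank_one_def power_module_def fun_eq_iff)
  have \<nu>_smult': "?\<nu> (y, r \<odot>\<^bsub>W\<^esub> w) = r \<odot>\<^bsub>?YV\<^esub> ?\<nu> (y, w)"
    if "r \<in> carrier R" "y \<in> carrier Y" "w \<in> carrier W" for r y w
    using that mod_homD(3)[OF bspec[OF conjunct1[OF pairing_smult_bilinear[OF p Y, unfolded bilinear_map_def]]]]
    by (auto simp: rank_one_def power_module_def fun_eq_iff)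
  have \<theta>\<nu>_I: "\<theta> (?\<nu> (y, w)) = \<zero>\<^bsub>Q\<^esub>" if y: "y \<in> I" and w: "w \<in> carrier W" for y w
  proof -
    obtain m where m: "m \<in> carrier M" "y = h m" using y by (auto simp: I_def)
    have "?\<nu> (y, w) = (\<lambda>v\<in>carrier V. h ((\<lambda>v\<in>carrier V. q v w \<odot>\<^bsub>M\<^esub> m) v))"
      using mod_homD(3)[OF h pairing_closed[OF p _ w] m(1)] m(2)
      by (auto simp: rank_one_def fun_eq_iff)
    then have "?\<nu> (y, w) \<in> L"
      unfolding L_def using rank_one_in_finite_rank_maps[OF m(1) w] by blast
    then show ?thesis
      using coset_eq_zero_iff[OF YV L] M.submoduleE(1) YV.submoduleE(1)[OF L] unfolding \<theta>_def Q_def by blast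
  qed
  have \<theta>\<nu>: "\<theta> (?\<nu> (y, w)) = \<theta> (?\<nu> (y', w))"
    if y: "y \<in> carrier Y" "y' \<in> carrier Y" "\<pi> y = \<pi> y'" and w: "w \<in> carrier W" for y y' w
  proof -
    have "y \<ominus>\<^bsub>Y\<^esub> y' \<in> I"
      using coset_eq_iff[OF Y I y(1,2)] y(3) by (simp add: \<pi>_def)
    then have "\<theta> (?\<nu> (y \<ominus>\<^bsub>Y\<^esub> y', w)) = \<zero>\<^bsub>Q\<^esub>"
      by (rule \<theta>\<nu>_I[OF _ w])
    moreover have "y = (y \<ominus>\<^bsub>Y\<^esub> y') \<oplus>\<^bsub>Y\<^esub> y'"
      using y by (simp add: a_minus_def Y.a_assoc Y.l_neg)
    then have "?\<nu> (y, w) = ?\<nu> (y \<ominus>\<^bsub>Y\<^esub> y', w) \<oplus>\<^bsub>?YV\<^esub> ?\<nu> (y', w)"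
      using \<nu>_add[of "y \<ominus>\<^bsub>Y\<^esub> y'" y' w] y w by simp
    ultimately show ?thesis
      using mod_homD(1,2)[OF \<theta>] \<nu> y w by simp
  qed
  \<comment> \<open>A set-theoretic section of \<open>\<pi>\<close>; the choice does not matter by the preceding fact.\<close>
  define \<sigma> where "\<sigma> z = (SOME y. y \<in> carrier Y \<and> \<pi> y = z)" for z
  have \<sigma>: "\<sigma> z \<in> carrier Y" "\<pi> (\<sigma> z) = z" if "z \<in> carrier Z" for z
  proof -
    have "z \<in> \<pi> ` carrier Y" using that Z_carrier by simp
    then have "\<exists>y. y \<in> carrier Y \<and> \<pi> y = z" by auto
    then have "\<sigma> z \<in> carrier Y \<and> \<pi> (\<sigma> z) = z" unfolding \<sigma>_def by (rule someI_ex)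
    then show "\<sigma> z \<in> carrier Y" "\<pi> (\<sigma> z) = z" by auto
  qed
  define B where "B z w = \<theta> (?\<nu> (\<sigma> z, w))" for z w
  have B\<pi>: "B (\<pi> y) w = \<theta> (?\<nu> (y, w))" if "y \<in> carrier Y" "w \<in> carrier W" for y w
  proof -
    have "\<pi> y \<in> carrier Z" using mod_homD(1)[OF \<pi> that(1)] .
    then show ?thesis unfolding B_def using \<sigma> that by (intro \<theta>\<nu>) auto
  qed
  have B: "bilinear_map R Z W Q B"
    unfolding bilinear_map_def
  proof (intro conjI ballI)
    fix z assume z: "z \<in> carrier Z"
    show "B z \<in> mod_hom R W Q"
      using \<sigma>(1)[OF z] \<nu> \<nu>_add' \<nu>_smult' mod_homD[OF \<theta>] by (auto simp: mod_hom_def B_def)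
  next
    fix w assume w: "w \<in> carrier W"
    show "(\<lambda>z. B z w) \<in> mod_hom R Z Q"
      unfolding mod_hom_def
    proof (intro CollectI conjI ballI funcsetI)
      fix z assume z: "z \<in> carrier Z"
      then show "B z w \<in> carrier Q"
        using \<sigma>(1) \<nu> w mod_homD(1)[OF \<theta>] by (simp add: B_def)
    next
      fix z z' assume "z \<in> carrier Z" "z' \<in> carrier Z"
      then obtain y y' where y: "y \<in> carrier Y" "y' \<in> carrier Y" "z = \<pi> y" "z' = \<pi> y'"
        using Z_carrier by auto
      then show "B (z \<oplus>\<^bsub>Z\<^esub> z') w = B z w \<oplus>\<^bsub>Q\<^esub> B z' w"
        using mod_homD(2)[OF \<pi> y(1,2)] B\<pi>[of "y \<oplus>\<^bsub>Y\<^esub> y'" w] B\<pi>[OF y(1) w] B\<pi>[OF y(2) w]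
          \<nu>_add[OF y(1,2) w] mod_homD(2)[OF \<theta>] \<nu> w
        by simp
    next
      fix r z assume r: "r \<in> carrier R" and "z \<in> carrier Z"
      then obtain y where y: "y \<in> carrier Y" "z = \<pi> y"
        using Z_carrier by auto
      then show "B (r \<odot>\<^bsub>Z\<^esub> z) w = r \<odot>\<^bsub>Q\<^esub> B z w"
        using mod_homD(3)[OF \<pi> r y(1)] B\<pi>[of "r \<odot>\<^bsub>Y\<^esub> y" w] B\<pi>[OF y(1) w] r
          \<nu>_smult[OF r y(1) w] mod_homD(3)[OF \<theta>] \<nu> w
        by simp
    qed
  qed
  have B_fun: "case_prod B \<in> carrier Z \<times> carrier W \<rightarrow> carrier Q"
    using \<sigma>(1) \<nu> mod_homD(1)[OF \<theta>] by (auto simp: B_def)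
  let ?FY = "free_module R (carrier Y \<times> carrier W)" and ?FZ = "free_module R (carrier Z \<times> carrier W)"
  have FY: "Module.module R ?FY" and FZ: "Module.module R ?FZ"
    by (rule free_module_module[OF cring])+
  interpret FZ: Module.module R ?FZ by (rule FZ)
  define push where "push = free_lift R ?FZ (\<lambda>s. free_gen R (case s of (y, w) \<Rightarrow> (\<pi> y, w)))"
  have push_fun: "(\<lambda>s. free_gen R (case s of (y, w) \<Rightarrow> (\<pi> y, w))) \<in> carrier Y \<times> carrier W \<rightarrow> carrier ?FZ"
    using mod_homD(1)[OF \<pi>] by (auto intro!: free_gen_closed[OF cring])
  have push: "push \<in> mod_hom R ?FY ?FZ"
    unfolding push_def by (rule free_lift_mod_hom[OF FZ push_fun])
  obtain \<psi> where \<psi>: "\<psi> \<in> carrier ?FY" "(\<lambda>v\<in>carrier V. h (g v)) = free_lift R ?YV ?\<nu> \<psi>"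
    using hg unfolding finite_rank_maps_def mod_span_image[OF YV closed] by blast
  note p\<psi> = mod_homD(1)[OF push \<psi>(1)]
  have "\<theta> (\<lambda>v\<in>carrier V. h (g v)) = free_lift R Q (case_prod B) (push \<psi>)"
    unfolding push_def \<psi>(2) using B\<pi> mod_homD(1)[OF \<pi>]
    by (intro free_lift_push[OF Q B_fun YV \<theta> closed \<psi>(1), symmetric]) auto
  also have "\<dots> = tensor_lift R Q B (tensor_kernel R Z W +>\<^bsub>?FZ\<^esub> push \<psi>)"
    by (rule tensor_lift_coset[OF Z W Q B p\<psi>, symmetric])
  also have "tensor_kernel R Z W +>\<^bsub>?FZ\<^esub> push \<psi> = tensor_kernel R Z W +>\<^bsub>?FZ\<^esub> \<zero>\<^bsub>?FZ\<^esub>"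
  proof (rule inj_onD[OF alpha_pairingD[OF \<alpha> Z]])
    let ?ZV = "power_module Z (carrier V)"
    note ZV = power_module_module[OF Z, of "carrier V"]
    note closed' = rank_one_closed[OF p Z]
    have "alpha_map R V q Z (tensor_kernel R Z W +>\<^bsub>?FZ\<^esub> push \<psi>)
        = free_lift R ?ZV (rank_one V q Z) (push \<psi>)"
      by (rule alpha_map_coset[OF p Z p\<psi>])
    also have "\<dots> = (\<lambda>v\<in>carrier V. \<pi> ((\<lambda>v\<in>carrier V. h (g v)) v))"
      unfolding push_def \<psi>(2)
    proof (rule free_lift_push[OF ZV closed' YV power_module_map[OF \<pi>] closed \<psi>(1)])
      fix s assume s: "s \<in> carrier Y \<times> carrier W"
      then show "(case s of (y, w) \<Rightarrow> (\<pi> y, w)) \<in> carrier Z \<times> carrier W"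
        using mod_homD(1)[OF \<pi>] by auto
      show "rank_one V q Z (case s of (y, w) \<Rightarrow> (\<pi> y, w)) = (\<lambda>v\<in>carrier V. \<pi> (?\<nu> s v))"
        using s mod_homD(3)[OF \<pi> pairing_closed[OF p]] by (auto simp: rank_one_def fun_eq_iff)
    qed
    also have "\<dots> = \<zero>\<^bsub>?ZV\<^esub>"
    proof -
      have "\<pi> (h (g v)) = \<zero>\<^bsub>Z\<^esub>" if "v \<in> carrier V" for v
        using coset_eq_zero_iff[OF Y I mod_homD(1)[OF h]] funcset_mem[OF g that]
        by (auto simp: \<pi>_def Z_def I_def)
      then show ?thesis by (auto simp: power_module_def fun_eq_iff)
    qed
    also have "\<dots> = alpha_map R V q Z (tensor_kernel R Z W +>\<^bsub>?FZ\<^esub> \<zero>\<^bsub>?FZ\<^esub>)"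
      unfolding alpha_map_coset[OF p Z FZ.zero_closed]
      by (rule mod_hom_zero[OF FZ ZV free_lift_mod_hom[OF ZV closed'], symmetric])
    finally show "alpha_map R V q Z (tensor_kernel R Z W +>\<^bsub>?FZ\<^esub> push \<psi>)
        = alpha_map R V q Z (tensor_kernel R Z W +>\<^bsub>?FZ\<^esub> \<zero>\<^bsub>?FZ\<^esub>)" .
  qed (use p\<psi> in \<open>simp_all add: carrier_tensor[OF Z W]\<close>)
  also have "tensor_lift R Q B (tensor_kernel R Z W +>\<^bsub>?FZ\<^esub> \<zero>\<^bsub>?FZ\<^esub>) = free_lift R Q (case_prod B) \<zero>\<^bsub>?FZ\<^esub>"
    by (rule tensor_lift_coset[OF Z W Q B FZ.zero_closed])
  also have "\<dots> = \<zero>\<^bsub>Q\<^esub>"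
    by (rule mod_hom_zero[OF FZ Q free_lift_mod_hom[OF Q B_fun]])
  finally have "\<theta> (\<lambda>v\<in>carrier V. h (g v)) = \<zero>\<^bsub>Q\<^esub>" .
  moreover have "(\<lambda>v\<in>carrier V. h (g v)) \<in> carrier ?YV"
    using mod_homD(1)[OF free_lift_mod_hom[OF YV closed] \<psi>(1)] \<psi>(2) by simp
  ultimately have "(\<lambda>v\<in>carrier V. h (g v)) \<in> L"
    using coset_eq_zero_iff[OF YV L] by (simp add: \<theta>_def Q_def)
  then obtain g' where g': "g' \<in> finite_rank_maps R V W q M"
    "(\<lambda>v\<in>carrier V. h (g v)) = (\<lambda>v\<in>carrier V. h (g' v))"
    unfolding L_def by blast
  have "h (g' v) = h (g v)" if "v \<in> carrier V" for v
    using fun_cong[OF g'(2), of v] that by simp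
  then show ?thesis using g'(1) by blast
qed

text \<open>
  A map to \<open>R\<^sup>J\<close> is the sum over \<open>j \<in> J\<close> of its components placed in the coordinate \<open>j\<close>, and each
  summand has rank one. The coordinates are switched on one after the other.
\<close>

lemma finite_rank_componentwise:
  assumes p: "pairing R V W q" and "finite J"
    and g: "g \<in> carrier V \<rightarrow> carrier (power_module (regular_module R) J)"
    and J: "\<And>j. j \<in> J \<Longrightarrow> (\<lambda>v\<in>carrier V. g v j) \<in> chi V q ` carrier W"
  shows "(\<lambda>v\<in>carrier V. g v) \<in> finite_rank_maps R V W q (power_module (regular_module R) J)"
proof -
  interpret W: Module.module R W using p by (simp add: pairing_def)
  let ?Y = "power_module (regular_module R) J"
  have Y: "Module.module R ?Y"
    by (rule power_module_module[OF regular_module_module[OF W.R.cring_axioms]])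
  interpret YV: Module.module R "power_module ?Y (carrier V)" by (rule power_module_module[OF Y])
  note FR = submodule_finite_rank_maps[OF p Y]
  have gR: "g v j \<in> carrier R" if "v \<in> carrier V" "j \<in> J" for v j
    using g that by (force simp: power_module_def regular_module_def)
  define cut where "cut T = (\<lambda>v\<in>carrier V. \<lambda>j\<in>J. if j \<in> T then g v j else \<zero>\<^bsub>R\<^esub>)" for T
  have "cut T \<in> finite_rank_maps R V W q ?Y" if "T \<subseteq> J" for T
    using finite_subset[OF that assms(2)] that
  proof (induction T rule: finite_induct)
    case empty
    have "cut {} = \<zero>\<^bsub>power_module ?Y (carrier V)\<^esub>"
      by (auto simp: cut_def power_module_def regular_module_def fun_eq_iff)
    then show ?case using submodule_zero_mem[OF FR] by simp
  next
    case (insert i T)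
    obtain w where w: "w \<in> carrier W" "(\<lambda>v\<in>carrier V. g v i) = chi V q w"
      using J[of i] insert.prems by auto
    have gw: "g v i = q v w" if "v \<in> carrier V" for v
      using fun_cong[OF w(2), of v] that by (simp add: chi_def)
    let ?u = "\<lambda>j\<in>J. if j = i then \<one>\<^bsub>R\<^esub> else \<zero>\<^bsub>R\<^esub>"
    have u: "?u \<in> carrier ?Y"
      by (auto simp: power_module_def regular_module_def)
    have "cut (insert i T) v = (cut T \<oplus>\<^bsub>power_module ?Y (carrier V)\<^esub> (\<lambda>v\<in>carrier V. q v w \<odot>\<^bsub>?Y\<^esub> ?u)) v" for v
    proof (cases "v \<in> carrier V")
      case True
      then show ?thesis
        using gR[OF True] gw[OF True] pairing_closed[OF p True w(1)] insert.hyps insert.prems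
        by (auto simp: cut_def power_module_def regular_module_def fun_eq_iff)
    qed (simp add: cut_def power_module_def)
    then have "cut (insert i T) = cut T \<oplus>\<^bsub>power_module ?Y (carrier V)\<^esub> (\<lambda>v\<in>carrier V. q v w \<odot>\<^bsub>?Y\<^esub> ?u)"
      by blast
    moreover have "cut T \<in> finite_rank_maps R V W q ?Y"
      using insert.IH insert.prems by blast
    ultimately show ?case
      using YV.submoduleE(5)[OF FR _ rank_one_in_finite_rank_maps[OF u w(1)]] by metis
  qed
  then have "cut J \<in> finite_rank_maps R V W q ?Y" by blast
  moreover have "cut J = (\<lambda>v\<in>carrier V. g v)"
  proof
    fix v
    show "cut J v = (\<lambda>v\<in>carrier V. g v) v"
    proof (cases "v \<in> carrier V")
      case True
      then have "g v \<in> extensional J"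
        using g by (force simp: power_module_def PiE_def)
      then show ?thesis using True by (auto simp: cut_def fun_eq_iff extensional_def)
    qed (simp add: cut_def)
  qed
  ultimately show ?thesis by simp
qed

text \<open>
  The functionals \<open>e j\<close> combine to a map \<open>h\<close> from \<open>M\<close> to \<open>R\<^sup>J\<close>. The composition \<open>h \<circ> g\<close> has finite rank
  and is lifted to a map \<open>g'\<close> of finite rank to \<open>M\<close>. Now \<open>g'\<close> need not be \<open>g\<close>, but they differ only by
  elements of the kernel of \<open>h\<close>, which \<open>f\<close> does not see.
\<close>

lemma finite_rank_detect:
  assumes \<alpha>: "alpha_pairing R V W q" and M: "Module.module R M" and P: "Module.module R P"
    and "finite J" and e: "\<And>j. j \<in> J \<Longrightarrow> e j \<in> mod_hom R M (regular_module R)"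
    and f: "f \<in> mod_hom R M P"
    and ker: "\<And>m. \<lbrakk>m \<in> carrier M; \<And>j. j \<in> J \<Longrightarrow> e j m = \<zero>\<^bsub>R\<^esub>\<rbrakk> \<Longrightarrow> f m = \<zero>\<^bsub>P\<^esub>"
    and g: "g \<in> carrier V \<rightarrow> carrier M"
    and eg: "\<And>j. j \<in> J \<Longrightarrow> (\<lambda>v\<in>carrier V. e j (g v)) \<in> chi V q ` carrier W"
  shows "(\<lambda>v\<in>carrier V. f (g v)) \<in> finite_rank_maps R V W q P"
proof -
  have p: "pairing R V W q" using \<alpha> by (simp add: alpha_pairing_def)
  interpret M: Module.module R M by fact
  interpret P: Module.module R P by fact
  note reg = regular_module_module[OF M.R.cring_axioms]
  interpret reg: Module.module R "regular_module R" by (rule reg)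
  let ?Y = "power_module (regular_module R) J"
  note Y = power_module_module[OF reg, of J]
  define h where "h m = (\<lambda>j\<in>J. e j m)" for m
  have h: "h \<in> mod_hom R M ?Y"
    using mod_homD[OF e] by (auto simp: mod_hom_def h_def power_module_def fun_eq_iff)
  have hg: "(\<lambda>v\<in>carrier V. h (g v)) \<in> finite_rank_maps R V W q ?Y"
  proof (rule finite_rank_componentwise[OF p assms(4)])
    show "(\<lambda>v. h (g v)) \<in> carrier V \<rightarrow> carrier ?Y"
      using mod_homD(1)[OF h] g by auto
    fix j assume "j \<in> J"
    then show "(\<lambda>v\<in>carrier V. h (g v) j) \<in> chi V q ` carrier W"
      using eg by (simp add: h_def)
  qed
  obtain g' where g': "g' \<in> finite_rank_maps R V W q M" "\<And>v. v \<in> carrier V \<Longrightarrow> h (g' v) = h (g v)"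
    using finite_rank_lift[OF \<alpha> M Y h g hg] by blast
  have "f (g' v) = f (g v)" if v: "v \<in> carrier V" for v
  proof -
    have cl: "g' v \<in> carrier M" "g v \<in> carrier M"
      using finite_rank_maps_closed[OF p M g'(1) v] g v by auto
    have "e j (g' v \<ominus>\<^bsub>M\<^esub> g v) = \<zero>\<^bsub>R\<^esub>" if j: "j \<in> J" for j
    proof -
      have "e j (g' v) = e j (g v)"
        using fun_cong[OF g'(2)[OF v], of j] j by (simp add: h_def)
      then have "e j (g' v \<ominus>\<^bsub>M\<^esub> g v) = \<zero>\<^bsub>regular_module R\<^esub>"
        using mod_hom_minus[OF M reg e[OF j] cl] mod_homD(1)[OF e[OF j] cl(2)]
        by (simp add: a_minus_def reg.r_neg)
      then show ?thesis by (simp add: regular_module_def)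
    qed
    then have "f (g' v \<ominus>\<^bsub>M\<^esub> g v) = \<zero>\<^bsub>P\<^esub>"
      using cl by (intro ker) auto
    then have "f (g' v) \<ominus>\<^bsub>P\<^esub> f (g v) = \<zero>\<^bsub>P\<^esub>"
      using mod_hom_minus[OF M P f cl] by simp
    moreover have "f (g' v) = (f (g' v) \<ominus>\<^bsub>P\<^esub> f (g v)) \<oplus>\<^bsub>P\<^esub> f (g v)"
      using mod_homD(1)[OF f] cl by (simp add: a_minus_def P.a_assoc P.l_neg)
    ultimately show ?thesis
      using mod_homD(1)[OF f] cl by simp
  qed
  then have "(\<lambda>v\<in>carrier V. f (g v)) = (\<lambda>v\<in>carrier V. f (g' v))"
    by (auto simp: fun_eq_iff)
  then show ?thesis
    using finite_rank_maps_compose[OF p M P f g'(1)] by simp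
qed

section \<open>Rational functionals and the finite dual\<close>

lemma right_moduleD:
  assumes "right_module R A M ract"
  shows "Module.module R M"
    and "\<lbrakk>m \<in> carrier M; a \<in> carrier A\<rbrakk> \<Longrightarrow> ract m a \<in> carrier M"
    and "a \<in> carrier A \<Longrightarrow> (\<lambda>m. ract m a) \<in> mod_hom R M M"
    and "m \<in> carrier M \<Longrightarrow> ract m \<one>\<^bsub>A\<^esub> = m"
    and "\<lbrakk>m \<in> carrier M; a \<in> carrier A; b \<in> carrier A\<rbrakk> \<Longrightarrow> ract m (a \<otimes>\<^bsub>A\<^esub> b) = ract (ract m a) b"
  using assms mod_homD(1)[of "ract m" R A M a] by (auto simp: right_module_def bilinear_map_def)

lemma dual_left_act_closed:
  assumes "right_module R A M ract" "f \<in> carrier (dual_module R M)" "a \<in> carrier A"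
  shows "dual_left_act M ract a f \<in> carrier (dual_module R M)"
proof -
  interpret M: Module.module R M by (rule right_moduleD(1)[OF assms(1)])
  have "f \<in> mod_hom R M (regular_module R)" using assms(2) by (simp add: carrier_dual_module)
  then show ?thesis
    using mod_homD[OF right_moduleD(3)[OF assms(1,3)]]
    by (simp add: carrier_dual_module dual_left_act_def mod_hom_def Pi_iff)
qed

text \<open>
  Rationality of \<open>f\<close> concerns only the orbit map \<open>a \<mapsto> a f\<close>.
\<close>

lemma rat_dual_iff:
  assumes "pairing R A C p" "right_module R A M ract"
  shows "f \<in> rat_dual R A C p M ract \<longleftrightarrow> f \<in> carrier (dual_module R M) \<and>
    (\<lambda>a\<in>carrier A. dual_left_act M ract a f) \<in> finite_rank_maps R A C p (dual_module R M)"
proof -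
  have eq: "(\<lambda>a\<in>carrier A. dual_left_act M ract a f) = alpha_map R A p (dual_module R M) t
    \<longleftrightarrow> (\<forall>a\<in>carrier A. dual_left_act M ract a f
        = tensor_lift R (dual_module R M) (\<lambda>y c. p a c \<odot>\<^bsub>dual_module R M\<^esub> y) t)" for t
    unfolding alpha_map_def by (auto simp: fun_eq_iff restrict_def)
  show ?thesis
    unfolding rat_dual_def Rat_def
      finite_rank_maps_eq_alpha_map_image[OF assms(1) dual_module_module[OF right_moduleD(1)[OF assms(2)]]]
    by (auto simp only: image_iff eq mem_Collect_eq)
qed

lemma comodule_act_finite_rank:
  assumes "pairing R A C p" "right_comodule R C \<Delta> \<epsilon> N \<rho>" "n \<in> carrier N"
  shows "(\<lambda>a\<in>carrier A. comodule_act R p N \<rho> a n) \<in> finite_rank_maps R A C p N"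
proof -
  have N: "Module.module R N" and \<rho>: "\<rho> n \<in> carrier (tensor R N C)"
    using assms(2,3) mod_homD(1) by (auto simp: right_comodule_def)
  have "(\<lambda>a\<in>carrier A. comodule_act R p N \<rho> a n) = alpha_map R A p N (\<rho> n)"
    by (simp add: comodule_act_def alpha_map_def)
  then show ?thesis
    unfolding finite_rank_maps_eq_alpha_map_image[OF assms(1) N] using \<rho> by blast
qed

lemma comodule_act_closed:
  assumes "pairing R A C p" "right_comodule R C \<Delta> \<epsilon> N \<rho>" "n \<in> carrier N" "a \<in> carrier A"
  shows "comodule_act R p N \<rho> a n \<in> carrier N"
  using finite_rank_maps_closed[OF assms(1) _ comodule_act_finite_rank[OF assms(1-3)] assms(4)] assms(2,4)
  by (simp add: right_comodule_def)

lemma right_P_pairingD: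
  assumes "right_P_pairing R A C \<Delta> \<epsilon> p M ract N \<rho> q"
  shows "pairing R M N q" "right_module R A M ract" "right_comodule R C \<Delta> \<epsilon> N \<rho>"
    "Module.module R M" "Module.module R N"
  using assms by (auto simp: right_P_pairing_def pairing_def)

lemma right_P_pairing_adjoint:
  assumes "pairing R A C p" "right_P_pairing R A C \<Delta> \<epsilon> p M ract N \<rho> q"
    "m \<in> carrier M" "a \<in> carrier A" "n \<in> carrier N"
  shows "q (ract m a) n = q m (comodule_act R p N \<rho> a n)"
proof -
  have "kappa N q (ract m a) n = dual_right_act N (comodule_act R p N \<rho>) (kappa N q m) a n"
    using assms(2-4) by (simp add: right_P_pairing_def)
  then show ?thesis
    using assms(5) comodule_act_closed[OF assms(1) right_P_pairingD(3)[OF assms(2)] assms(5,4)]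
    by (simp add: kappa_def dual_right_act_def)
qed

text \<open>
  The map \<open>\<chi>\<^sub>Q\<close> is linear over \<open>A\<close>, so the coaction of \<open>N\<close> describes the orbit of \<open>\<chi>\<^sub>Q n\<close>.
\<close>

lemma chi_rational:
  assumes p: "pairing R A C p" and Q: "right_P_pairing R A C \<Delta> \<epsilon> p M ract N \<rho> q"
    and n: "n \<in> carrier N"
  shows "chi M q n \<in> rat_dual R A C p M ract"
proof -
  note q = right_P_pairingD[OF Q]
  have "dual_left_act M ract a (chi M q n) = chi M q (comodule_act R p N \<rho> a n)" if "a \<in> carrier A" for a
    using right_P_pairing_adjoint[OF p Q _ that n] right_moduleD(2)[OF q(2) _ that]
    by (auto simp: dual_left_act_def chi_def fun_eq_iff)
  then have "(\<lambda>a\<in>carrier A. dual_left_act M ract a (chi M q n))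
      = (\<lambda>a\<in>carrier A. chi M q ((\<lambda>a\<in>carrier A. comodule_act R p N \<rho> a n) a))"
    by (auto simp: fun_eq_iff)
  then show ?thesis
    unfolding rat_dual_iff[OF p q(2)]
    using finite_rank_maps_compose[OF p q(5) dual_module_module[OF q(4)] chi_mod_hom[OF q(1)]
        comodule_act_finite_rank[OF p q(3) n]] mod_homD(1)[OF chi_mod_hom[OF q(1)] n]
    by simp
qed

text \<open>
  The submodule \<open>L\<close> of all \<open>m\<close> with \<open>f (m A) = 0\<close> for \<open>f \<in> F\<close> is stable under \<open>A\<close>. It is cofinite since
  the functionals \<open>a f\<close> lie in a finitely generated submodule of the dual, and a generating set of that
  submodule has its common kernel inside \<open>L\<close>. A finite set \<open>F\<close> is treated at once because
  \<open>K\<^sup>\<bottom>\<close> is the common kernel of finitely many functionals.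
\<close>

lemma rational_annihilated_by_cofinite:
  assumes noeth: "noetherian_ring R" and A: "r_algebra R A" and p: "pairing R A C p"
    and M: "right_module R A M ract" and F: "finite F" "F \<subseteq> rat_dual R A C p M ract"
  shows "\<exists>L. cofinite_submodule R A M ract L \<and> (\<forall>f\<in>F. \<forall>x\<in>L. f x = \<zero>\<^bsub>R\<^esub>)"
proof -
  interpret A: r_algebra R A by fact
  note act = right_moduleD[OF M]
  interpret M: Module.module R M by (rule act(1))
  note reg = regular_module_module[OF Module.module.axioms(1)[OF act(1)]]
  let ?D = "dual_module R M"
  have D: "Module.module R ?D" by (rule dual_module_module[OF act(1)])
  have fD: "f \<in> carrier ?D" if "f \<in> F" for f
    using F(2) that rat_dual_iff[OF p M] by blast
  have f_hom: "f \<in> mod_hom R M (regular_module R)" if "f \<in> F" for f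
    using fD[OF that] by (simp add: carrier_dual_module)
  have "\<exists>G\<subseteq>carrier ?D. finite G \<and> (\<forall>a\<in>carrier A. dual_left_act M ract a f \<in> mod_span R ?D G)"
    if "f \<in> F" for f
    using finite_rank_maps_bounded[OF p D, of "\<lambda>a\<in>carrier A. dual_left_act M ract a f"]
      rat_dual_iff[OF p M] F(2) that by auto
  then obtain G where G: "\<And>f. f \<in> F \<Longrightarrow> G f \<subseteq> carrier ?D" "\<And>f. f \<in> F \<Longrightarrow> finite (G f)"
    "\<And>f a. \<lbrakk>f \<in> F; a \<in> carrier A\<rbrakk> \<Longrightarrow> dual_left_act M ract a f \<in> mod_span R ?D (G f)"
    by metis
  define L where "L = {m \<in> carrier M. \<forall>f\<in>F. \<forall>a\<in>carrier A. f (ract m a) = \<zero>\<^bsub>R\<^esub>}"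
  have L_iff: "m \<in> L \<longleftrightarrow> m \<in> carrier M \<and> (\<forall>f\<in>F. \<forall>a\<in>carrier A. f (ract m a) = \<zero>\<^bsub>R\<^esub>)" for m
    by (simp add: L_def)
  have "submodule L R M"
    unfolding submodule_iff[OF act(1)]
  proof (intro conjI ballI)
    show "L \<subseteq> carrier M" by (auto simp: L_def)
    show "\<zero>\<^bsub>M\<^esub> \<in> L"
      using mod_hom_zero[OF act(1) act(1) act(3)] mod_hom_zero[OF act(1) reg f_hom]
        Module.module.carrier_is_submodule[OF act(1), THEN submodule_zero_mem]
      by (simp add: L_def regular_module_def)
  next
    fix x y assume x: "x \<in> L" and y: "y \<in> L"
    have "f (ract (x \<oplus>\<^bsub>M\<^esub> y) a) = \<zero>\<^bsub>R\<^esub>" if "f \<in> F" "a \<in> carrier A" for f a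
    proof -
      have "x \<in> carrier M" "y \<in> carrier M" "f (ract x a) = \<zero>\<^bsub>R\<^esub>" "f (ract y a) = \<zero>\<^bsub>R\<^esub>"
        using x y that unfolding L_iff by blast+
      then show ?thesis
        using mod_homD(2)[OF act(3)[OF that(2)]] mod_homD(2)[OF f_hom[OF that(1)]] act(2) that(2)
        by (simp add: regular_module_def)
    qed
    then show "x \<oplus>\<^bsub>M\<^esub> y \<in> L" using x y M.a_closed unfolding L_iff by blast
  next
    fix r x assume r: "r \<in> carrier R" and x: "x \<in> L"
    have "f (ract (r \<odot>\<^bsub>M\<^esub> x) a) = \<zero>\<^bsub>R\<^esub>" if "f \<in> F" "a \<in> carrier A" for f a
    proof -
      have "x \<in> carrier M" "f (ract x a) = \<zero>\<^bsub>R\<^esub>"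
        using x that unfolding L_iff by blast+
      then show ?thesis
        using mod_homD(3)[OF act(3)[OF that(2)] r] mod_homD(3)[OF f_hom[OF that(1)] r] act(2) that(2) r
        by (simp add: regular_module_def)
    qed
    then show "r \<odot>\<^bsub>M\<^esub> x \<in> L" using r x M.smult_closed unfolding L_iff by blast
  qed
  moreover have "ract x a \<in> L" if "x \<in> L" "a \<in> carrier A" for x a
  proof -
    have x: "x \<in> carrier M" "\<And>f b. \<lbrakk>f \<in> F; b \<in> carrier A\<rbrakk> \<Longrightarrow> f (ract x b) = \<zero>\<^bsub>R\<^esub>"
      using that(1) unfolding L_iff by blast+
    have "f (ract (ract x a) b) = \<zero>\<^bsub>R\<^esub>" if "f \<in> F" "b \<in> carrier A" for f b
      using x(2)[OF that(1) A.m_closed[OF \<open>a \<in> carrier A\<close> that(2)]]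
      by (simp only: act(5)[OF x(1) \<open>a \<in> carrier A\<close> that(2)])
    then show ?thesis using act(2)[OF x(1) that(2)] unfolding L_iff by blast
  qed
  moreover have "finite (\<Union>f\<in>F. G f)" "(\<Union>f\<in>F. G f) \<subseteq> mod_hom R M (regular_module R)"
    using F(1) G(1,2) by (auto simp: carrier_dual_module)
  moreover have "{x \<in> carrier M. \<forall>g\<in>\<Union>f\<in>F. G f. g x = \<zero>\<^bsub>R\<^esub>} \<subseteq> L"
  proof safe
    fix x assume x: "x \<in> carrier M" and 0: "\<forall>g\<in>\<Union>f\<in>F. G f. g x = \<zero>\<^bsub>R\<^esub>"
    have "f (ract x a) = \<zero>\<^bsub>R\<^esub>" if "f \<in> F" "a \<in> carrier A" for f a
    proof -
      have "dual_left_act M ract a f x = \<zero>\<^bsub>R\<^esub>"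
        by (rule functional_zero_on_span[OF D dual_module_eval[OF x] G(1)[OF that(1)] _ G(3)[OF that]])
          (use 0 that in blast)
      then show ?thesis using x by (simp add: dual_left_act_def)
    qed
    then show "x \<in> L" using x by (simp add: L_iff)
  qed
  ultimately have "cofinite_submodule R A M ract L"
    by (rule cofinite_submoduleI[OF noeth act(1)])
  moreover have "f x = \<zero>\<^bsub>R\<^esub>" if "f \<in> F" "x \<in> L" for f x
  proof -
    have "x \<in> carrier M" "f (ract x \<one>\<^bsub>A\<^esub>) = \<zero>\<^bsub>R\<^esub>"
      using that A.one_closed unfolding L_iff by blast+
    then show ?thesis using act(4) by simp
  qed
  ultimately show ?thesis by blast
qed

text \<open>
  The finite rank of \<open>a \<mapsto> a f\<close> is detected in two stages. The functionals \<open>\<langle>-, n\<rangle>\<close>, \<open>n \<in> S\<close>,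
  control \<open>f\<close>, as \<open>S\<^sup>\<bottom> \<subseteq> L \<subseteq> ker f\<close>; so each coefficient \<open>a \<mapsto> f (m a)\<close> is given by an element of \<open>C\<close>. The
  orbit of \<open>f\<close> lies in the module \<open>E\<close> of functionals that vanish on \<open>L\<close>, where evaluation at
  generators of \<open>M\<close> modulo \<open>L\<close> is injective; so these coefficients determine the whole orbit map.
\<close>

lemma rational_of_annihilator:
  assumes \<alpha>: "alpha_pairing R A C p" and Q: "right_P_pairing R A C \<Delta> \<epsilon> p M ract N \<rho> q"
    and f: "f \<in> carrier (dual_module R M)"
    and L: "cofinite_submodule R A M ract L" "\<And>x. x \<in> L \<Longrightarrow> f x = \<zero>\<^bsub>R\<^esub>"
    and S: "finite S" "S \<subseteq> carrier N" "annihilator R M q S \<subseteq> L"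
  shows "f \<in> rat_dual R A C p M ract"
proof -
  have p: "pairing R A C p" using \<alpha> by (simp add: alpha_pairing_def)
  note q = right_P_pairingD[OF Q] and act = right_moduleD[OF right_P_pairingD(2)[OF Q]]
  interpret M: Module.module R M by (rule q(4))
  interpret N: Module.module R N by (rule q(5))
  note reg = regular_module_module[OF M.R.cring_axioms]
  let ?D = "dual_module R M"
  have D: "Module.module R ?D" by (rule dual_module_module[OF q(4)])
  interpret D: Module.module R ?D by (rule D)
  have f_hom: "f \<in> mod_hom R M (regular_module R)" using f by (simp add: carrier_dual_module)
  have coeff: "(\<lambda>a\<in>carrier A. f (ract m a)) \<in> chi A p ` carrier C" if m: "m \<in> carrier M" for m
    unfolding finite_rank_maps_regular[OF p, symmetric]
  proof (rule finite_rank_detect[OF \<alpha> q(4) reg S(1), where e = "\<lambda>n m. q m n"])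
    show "(\<lambda>m. q m n) \<in> mod_hom R M (regular_module R)" if "n \<in> S" for n
      using pairing_linear(2)[OF q(1)] that S(2) by blast
    show "f m = \<zero>\<^bsub>regular_module R\<^esub>" if "m \<in> carrier M" "\<And>n. n \<in> S \<Longrightarrow> q m n = \<zero>\<^bsub>R\<^esub>" for m
      using that S(3) L(2)[of m] by (auto simp: annihilator_def regular_module_def)
    show "ract m \<in> carrier A \<rightarrow> carrier M" using act(2)[OF m] by blast
    fix n assume "n \<in> S"
    then have n: "n \<in> carrier N" using S(2) by blast
    have "(\<lambda>a\<in>carrier A. q (ract m a) n)
        = (\<lambda>a\<in>carrier A. q m ((\<lambda>a\<in>carrier A. comodule_act R p N \<rho> a n) a))"
      using right_P_pairing_adjoint[OF p Q m _ n] by (auto simp: fun_eq_iff)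
    then show "(\<lambda>a\<in>carrier A. q (ract m a) n) \<in> chi A p ` carrier C"
      unfolding finite_rank_maps_regular[OF p, symmetric]
      using finite_rank_maps_compose[OF p q(5) reg pairing_linear(1)[OF q(1) m]
          comodule_act_finite_rank[OF p q(3) n]] by simp
  qed (rule f_hom)
  have L_sub: "submodule L R M" "\<And>x a. \<lbrakk>x \<in> L; a \<in> carrier A\<rbrakk> \<Longrightarrow> ract x a \<in> L"
    using L(1) by (auto simp: cofinite_submodule_def)
  have LM: "L \<subseteq> carrier M" by (rule M.submoduleE(1)[OF L_sub(1)])
  obtain T where T: "finite T" "T \<subseteq> carrier M" "mod_span R M (T \<union> L) = carrier M"
    using L(1) fin_gen_quot_iff[OF q(4) L_sub(1)] by (auto simp: cofinite_submodule_def)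
  define E where "E = {g \<in> carrier ?D. \<forall>x\<in>L. g x = \<zero>\<^bsub>R\<^esub>}"
  have E: "submodule E R ?D"
    unfolding submodule_iff[OF D] using LM by (auto simp: E_def subset_iff dual_module_ops)
  let ?E = "?D\<lparr>carrier := E\<rparr>"
  have "(\<lambda>a\<in>carrier A. id (dual_left_act M ract a f)) \<in> finite_rank_maps R A C p ?D"
  proof (rule finite_rank_detect[OF \<alpha> submodule.submodule_is_module[OF E D] D T(1),
        where e = "\<lambda>m g. g m" and f = id and g = "\<lambda>a. dual_left_act M ract a f"])
    show "(\<lambda>g. g m) \<in> mod_hom R ?E (regular_module R)" if "m \<in> T" for m
      using dual_module_eval[of m M R] that T(2) D.submoduleE(1)[OF E] by (intro mod_hom_restrict) auto
    show "id \<in> mod_hom R ?E ?D"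
      using D.submoduleE(1)[OF E] by (intro mod_hom_restrict) (auto simp: mod_hom_def)
    show "id g = \<zero>\<^bsub>?D\<^esub>" if g: "g \<in> carrier ?E" "\<And>m. m \<in> T \<Longrightarrow> g m = \<zero>\<^bsub>R\<^esub>" for g
    proof -
      have gD: "g \<in> carrier ?D" and gL: "\<And>x. x \<in> L \<Longrightarrow> g x = \<zero>\<^bsub>R\<^esub>"
        using g(1) by (auto simp: E_def)
      then have "g \<in> mod_hom R M (regular_module R)" by (simp add: carrier_dual_module)
      moreover have "g x = \<zero>\<^bsub>R\<^esub>" if "x \<in> T \<union> L" for x
        using that gL g(2) by blast
      ultimately have "g x = \<zero>\<^bsub>R\<^esub>" if "x \<in> carrier M" for x
        using functional_zero_on_span[OF q(4), of g "T \<union> L" x] T(2,3) LM that by simp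
      then have "g x = \<zero>\<^bsub>?D\<^esub> x" for x
        using gD D.zero_closed dual_module_ops(1)[of x M R]
        by (cases "x \<in> carrier M") (auto simp: carrier_dual_module extensional_def)
      then show ?thesis by auto
    qed
    show "(\<lambda>a. dual_left_act M ract a f) \<in> carrier A \<rightarrow> carrier ?E"
      using dual_left_act_closed[OF q(2) f] L(2) L_sub(2) LM
      by (auto simp: E_def dual_left_act_def)
    show "(\<lambda>a\<in>carrier A. dual_left_act M ract a f m) \<in> chi A p ` carrier C" if "m \<in> T" for m
      using coeff[of m] that T(2) by (auto simp: dual_left_act_def)
  qed
  then show ?thesis
    unfolding rat_dual_iff[OF p q(2)] using f by simp
qed

section \<open>Comparison of the two topologies\<close>

lemma annihilator_span:
  assumes "pairing R M N q" "S \<subseteq> carrier N"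
  shows "annihilator R M q (mod_span R N S) = annihilator R M q S"
proof -
  have N: "Module.module R N" using assms(1) by (simp add: pairing_def)
  have "q m n = \<zero>\<^bsub>R\<^esub>" if "m \<in> annihilator R M q S" "n \<in> mod_span R N S" for m n
    using functional_zero_on_span[OF N pairing_linear(1)[OF assms(1)] assms(2) _ that(2), of m] that(1)
    by (auto simp: annihilator_def)
  then show ?thesis
    using mod_span_inc[of _ S R N] by (auto simp: annihilator_def)
qed

text \<open>
  Annihilators of finite subsets are easier to handle than those of finitely generated submodules:
  intersections become unions of sets.
\<close>

lemma weak_topology_basis:
  assumes "pairing R M N q"
  shows "{annihilator R M q K | K. submodule K R N \<and> fin_gen_module R (N\<lparr>carrier := K\<rparr>)}
    = {annihilator R M q S | S. finite S \<and> S \<subseteq> carrier N}"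
proof -
  have N: "Module.module R N" using assms by (simp add: pairing_def)
  interpret N: Module.module R N by (rule N)
  have fg: "submodule K R N \<and> fin_gen_module R (N\<lparr>carrier := K\<rparr>)
      \<longleftrightarrow> (\<exists>S. finite S \<and> S \<subseteq> carrier N \<and> K = mod_span R N S)" for K
  proof safe
    assume K: "submodule K R N" "fin_gen_module R (N\<lparr>carrier := K\<rparr>)"
    then obtain S where S: "finite S" "S \<subseteq> K" "mod_span R (N\<lparr>carrier := K\<rparr>) S = K"
      by (auto simp: fin_gen_module_def)
    then have "S \<subseteq> carrier N" "K = mod_span R N S"
      using mod_span_restrict[OF N K(1) S(2)] N.submoduleE(1)[OF K(1)] by auto
    then show "\<exists>S. finite S \<and> S \<subseteq> carrier N \<and> K = mod_span R N S"
      using S(1) by (intro exI[of _ S] conjI)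
  next
    fix S assume S: "finite S" "S \<subseteq> carrier N"
    show span: "submodule (mod_span R N S) R N" by (rule submodule_mod_span[OF N S(2)])
    have "S \<subseteq> mod_span R N S" using mod_span_inc[of _ S R N] by blast
    then show "fin_gen_module R (N\<lparr>carrier := mod_span R N S\<rparr>)"
      unfolding fin_gen_module_def using S(1) mod_span_restrict[OF N span] by auto
  qed
  have "{annihilator R M q K | K. submodule K R N \<and> fin_gen_module R (N\<lparr>carrier := K\<rparr>)}
      = (\<lambda>S. annihilator R M q (mod_span R N S)) ` {S. finite S \<and> S \<subseteq> carrier N}"
    unfolding fg by blast
  also have "\<dots> = annihilator R M q ` {S. finite S \<and> S \<subseteq> carrier N}"
    using annihilator_span[OF assms] by (intro image_cong) auto
  finally show ?thesis by (simp only: setcompr_eq_image)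
qed

lemma submodule_annihilator:
  assumes "pairing R M N q" "S \<subseteq> carrier N"
  shows "submodule (annihilator R M q S) R M"
proof -
  have M: "Module.module R M" using assms(1) by (simp add: pairing_def)
  interpret M: Module.module R M by (rule M)
  have 0: "q \<zero>\<^bsub>M\<^esub> n = \<zero>\<^bsub>R\<^esub>" if "n \<in> carrier N" for n
    using mod_hom_zero[OF M regular_module_module[OF M.R.cring_axioms] pairing_linear(2)[OF assms(1) that]]
    by (simp add: regular_module_def)
  show ?thesis
    unfolding submodule_iff[OF M]
    using 0 mod_homD(2,3)[OF pairing_linear(2)[OF assms(1)]] assms(2)
    by (auto simp: annihilator_def subset_iff regular_module_def)
qed

text \<open>
  Refining a neighbourhood basis of \<open>0\<close> refines the topology: a coset of \<open>B\<close> is the union of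
  the cosets of any smaller \<open>B'\<close> that it contains.
\<close>

lemma linear_topology_mono:
  assumes M: "abelian_group M" and sub: "\<And>B. B \<in> \<BB> \<Longrightarrow> additive_subgroup B M"
    "\<And>B. B \<in> \<BB>' \<Longrightarrow> additive_subgroup B M"
    and le: "\<And>B. B \<in> \<BB> \<Longrightarrow> \<exists>B'\<in>\<BB>'. B' \<subseteq> B"
    and U: "openin (linear_topology M \<BB>) U"
  shows "openin (linear_topology M \<BB>') U"
proof -
  have basis: "openin (linear_topology M \<BB>') (B +>\<^bsub>M\<^esub> x)" if B: "B \<in> \<BB>" and x: "x \<in> carrier M" for B x
  proof (subst openin_subopen, intro ballI)
    interpret B: abelian_subgroup B M using sub(1)[OF B] M by (rule abelian_subgroupI3)
    fix y assume y: "y \<in> B +>\<^bsub>M\<^esub> x"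
    obtain B' where B': "B' \<in> \<BB>'" "B' \<subseteq> B" using le[OF B] by blast
    interpret B': abelian_subgroup B' M using sub(2)[OF B'(1)] M by (rule abelian_subgroupI3)
    have yM: "y \<in> carrier M" using B.a_elemrcos_carrier[OF x y] .
    have "B' +>\<^bsub>M\<^esub> y \<subseteq> B +>\<^bsub>M\<^esub> y" using B'(2) by (auto simp: a_r_coset_def r_coset_def)
    also have "B +>\<^bsub>M\<^esub> y = B +>\<^bsub>M\<^esub> x" using B.a_repr_independence'[OF y x] by simp
    finally have "B' +>\<^bsub>M\<^esub> y \<subseteq> B +>\<^bsub>M\<^esub> x" .
    moreover have "openin (linear_topology M \<BB>') (B' +>\<^bsub>M\<^esub> y)"
      unfolding linear_topology_def using B'(1) yM by (intro topology_generated_by_Basis) blast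
    ultimately show "\<exists>T. openin (linear_topology M \<BB>') T \<and> y \<in> T \<and> T \<subseteq> B +>\<^bsub>M\<^esub> x"
      using B'.a_rcos_self[OF yM] by blast
  qed
  have "generate_topology_on {B +>\<^bsub>M\<^esub> x | B x. B \<in> \<BB> \<and> x \<in> carrier M} U"
    using U by (simp only: linear_topology_def openin_topology_generated_by_iff)
  then show ?thesis
  proof induction
    case (UN K)
    then show ?case by (intro openin_Union) blast
  qed (use basis in auto)
qed

lemma coreflexiveD:
  assumes q: "pairing R M N q" and "coreflexive R A M ract N q" and L: "cofinite_submodule R A M ract L"
  shows "\<exists>S. finite S \<and> S \<subseteq> carrier N \<and> annihilator R M q S \<subseteq> L"
proof -
  have M: "Module.module R M" using q by (simp add: pairing_def)
  interpret M: Module.module R M by (rule M)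
  define \<BB> where "\<BB> = {annihilator R M q S | S. finite S \<and> S \<subseteq> carrier N}"
  have L': "submodule L R M" using L by (simp add: cofinite_submodule_def)
  have LM: "L \<subseteq> carrier M" by (rule M.submoduleE(1)[OF L'])
  have "openin (cofinite_topology R A M ract) (L +>\<^bsub>M\<^esub> \<zero>\<^bsub>M\<^esub>)"
    unfolding cofinite_topology_def linear_topology_def
    using L by (intro topology_generated_by_Basis) blast
  then have L_open: "openin (linear_topology M \<BB>) L"
    using assms(2) LM
    by (simp add: coreflexive_def linear_weak_topology_def weak_topology_basis[OF q] \<BB>_def[symmetric] M.a_coset_add_zero)
  have \<BB>_sub: "submodule B R M" if "B \<in> \<BB>" for B
    using that submodule_annihilator[OF q] by (auto simp: \<BB>_def)
  have dir: "\<exists>B''\<in>\<BB>. B'' \<subseteq> B \<inter> B'" if BB: "B \<in> \<BB>" "B' \<in> \<BB>" for B B'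
  proof -
    obtain S S' where "finite S" "S \<subseteq> carrier N" "B = annihilator R M q S"
      "finite S'" "S' \<subseteq> carrier N" "B' = annihilator R M q S'"
      using BB by (auto simp: \<BB>_def)
    then show ?thesis
      by (intro bexI[of _ "annihilator R M q (S \<union> S')"]) (auto simp: annihilator_def \<BB>_def)
  qed
  have "\<forall>x\<in>L. \<exists>B\<in>\<BB>. B +>\<^bsub>M\<^esub> x \<subseteq> L"
    using openin_linear_topology[OF M.abelian_group_axioms additive_subgroup_submodule[OF \<BB>_sub] dir]
      L_open by blast
  then obtain B where B: "B \<in> \<BB>" "B +>\<^bsub>M\<^esub> \<zero>\<^bsub>M\<^esub> \<subseteq> L"
    using bspec[OF _ submodule_zero_mem[OF L']] by blast
  then have "B \<subseteq> L"
    using M.a_coset_add_zero[OF M.submoduleE(1)[OF \<BB>_sub[OF B(1)]]] by simp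
  then show ?thesis using B(1) by (auto simp: \<BB>_def)
qed

lemma coreflexiveI:
  assumes q: "pairing R M N q"
    and le: "\<And>L. cofinite_submodule R A M ract L
      \<Longrightarrow> \<exists>S. finite S \<and> S \<subseteq> carrier N \<and> annihilator R M q S \<subseteq> L"
    and ge: "\<And>S. \<lbrakk>finite S; S \<subseteq> carrier N\<rbrakk>
      \<Longrightarrow> \<exists>L. cofinite_submodule R A M ract L \<and> L \<subseteq> annihilator R M q S"
  shows "coreflexive R A M ract N q"
proof -
  interpret M: Module.module R M using q by (simp add: pairing_def)
  let ?\<BB> = "{annihilator R M q S | S. finite S \<and> S \<subseteq> carrier N}"
  let ?\<LL> = "{L. cofinite_submodule R A M ract L}"
  have \<BB>: "additive_subgroup B M" if "B \<in> ?\<BB>" for B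
    using that submodule_annihilator[OF q] additive_subgroup_submodule by blast
  have \<LL>: "additive_subgroup L M" if "L \<in> ?\<LL>" for L
    using that additive_subgroup_submodule[of L R M] by (simp add: cofinite_submodule_def)
  have le': "\<exists>B\<in>?\<BB>. B \<subseteq> L" if "L \<in> ?\<LL>" for L
    using le[of L] that by blast
  have ge': "\<exists>L\<in>?\<LL>. L \<subseteq> B" if "B \<in> ?\<BB>" for B
    using ge that by blast
  have "openin (linear_topology M ?\<BB>) U \<longleftrightarrow> openin (linear_topology M ?\<LL>) U" for U
    using linear_topology_mono[OF M.abelian_group_axioms \<BB> \<LL> ge']
      linear_topology_mono[OF M.abelian_group_axioms \<LL> \<BB> le'] by (rule iffI)
  then show ?thesis
    by (simp add: coreflexive_def linear_weak_topology_def cofinite_topology_def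
        weak_topology_basis[OF q] topology_eq)
qed

section \<open>Cogenerated quotients and coreflexivity\<close>

text \<open>
  The coordinates of an embedding of \<open>M / L\<close> into a power of \<open>R\<close> are functionals on \<open>M\<close> that vanish on \<open>L\<close>.
\<close>

lemma cogenerated_quotient_separates:
  fixes R :: "('r, 'z) ring_scheme" and M :: "('r, 'm) module"
  assumes M: "Module.module R M" and L: "submodule L R M" and "cogenerated R (quot_module M L)"
    and m: "m \<in> carrier M"
    and 0: "\<And>g. \<lbrakk>g \<in> carrier (dual_module R M); \<And>x. x \<in> L \<Longrightarrow> g x = \<zero>\<^bsub>R\<^esub>\<rbrakk> \<Longrightarrow> g m = \<zero>\<^bsub>R\<^esub>"
  shows "m \<in> L"
proof -
  interpret M: Module.module R M by fact
  note reg = regular_module_module[OF M.R.cring_axioms]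
  let ?Q = "quot_module M L" and ?\<pi> = "\<lambda>x. L +>\<^bsub>M\<^esub> x"
  note Q = quot_module_module[OF M L] and \<pi> = quot_module_proj[OF M L]
  interpret Q: Module.module R ?Q by (rule Q)
  obtain I :: "('m set \<Rightarrow> 'r) set" and j
    where j: "j \<in> mod_hom R ?Q (power_module (regular_module R) I)" "inj_on j (carrier ?Q)"
    using assms(3) unfolding cogenerated_def by blast
  note pow = power_module_module[OF reg, of I]
  have j0: "j \<zero>\<^bsub>?Q\<^esub> = (\<lambda>i\<in>I. \<zero>\<^bsub>R\<^esub>)"
    using mod_hom_zero[OF Q pow j(1)] by (simp add: power_module_def regular_module_def)
  have j\<pi>: "j (?\<pi> m) \<in> extensional I"
    using mod_homD(1)[OF j(1) mod_homD(1)[OF \<pi> m]] by (auto simp: power_module_def PiE_def)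
  have "j (?\<pi> m) i = \<zero>\<^bsub>R\<^esub>" if i: "i \<in> I" for i
  proof -
    let ?g = "\<lambda>x\<in>carrier M. j (?\<pi> x) i"
    have "(\<lambda>x. j (?\<pi> x) i) \<in> mod_hom R M (regular_module R)"
      by (rule mod_hom_compose[OF mod_hom_compose[OF \<pi> j(1)] power_module_eval[OF i]])
    then have "?g \<in> carrier (dual_module R M)"
      by (auto simp: carrier_dual_module mod_hom_def)
    moreover have "?g x = \<zero>\<^bsub>R\<^esub>" if "x \<in> L" for x
      using coset_eq_zero_iff[OF M L, of x] that M.submoduleE(1)[OF L] j0 i by auto
    ultimately have "?g m = \<zero>\<^bsub>R\<^esub>" by (rule 0)
    then show ?thesis using m by simp
  qed
  then have "j (?\<pi> m) = j \<zero>\<^bsub>?Q\<^esub>"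
    unfolding j0 using j\<pi> by (intro extensionalityI[of _ I]) auto
  then have "?\<pi> m = \<zero>\<^bsub>?Q\<^esub>"
    using inj_onD[OF j(2)] mod_homD(1)[OF \<pi> m] Q.zero_closed by blast
  then show ?thesis using coset_eq_zero_iff[OF M L m] by simp
qed

text \<open>
  Let \<open>K\<close> consist of the \<open>n\<close> that annihilate \<open>L\<close>. An element of \<open>K\<close> is determined by its pairings with
  the finite set \<open>T\<close> that generates \<open>M\<close> modulo \<open>L\<close>, so \<open>K\<close> is generated by a finite set \<open>S\<close>. Every
  functional that vanishes on \<open>L\<close> lies in \<open>M\<^sup>\<circ>\<close>, hence is \<open>\<chi>\<^sub>Q n\<close> for some \<open>n \<in> K\<close>, and vanishes
  on \<open>S\<^sup>\<bottom>\<close>. Since \<open>M / L\<close> is cogenerated by \<open>R\<close>, such functionals separate \<open>L\<close> from all other elements.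
\<close>

lemma cofinite_contains_annihilator:
  assumes noeth: "noetherian_ring R" and q: "pairing R M N q"
    and bij: "bij_betw (chi M q) (carrier N) (finite_dual R A M ract)"
    and L: "cofinite_submodule R A M ract L" and cogen: "cogenerated R (quot_module M L)"
  shows "\<exists>S. finite S \<and> S \<subseteq> carrier N \<and> annihilator R M q S \<subseteq> L"
proof -
  have M: "Module.module R M" and N: "Module.module R N" using q by (auto simp: pairing_def)
  interpret M: Module.module R M by (rule M)
  interpret N: Module.module R N by (rule N)
  note reg = regular_module_module[OF M.R.cring_axioms]
  have L_sub: "submodule L R M" using L by (simp add: cofinite_submodule_def)
  have LM: "L \<subseteq> carrier M" by (rule M.submoduleE(1)[OF L_sub])
  obtain T where T: "finite T" "T \<subseteq> carrier M" "mod_span R M (T \<union> L) = carrier M"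
    using L fin_gen_quot_iff[OF M L_sub] by (auto simp: cofinite_submodule_def)
  define K where "K = {n \<in> carrier N. \<forall>m\<in>L. q m n = \<zero>\<^bsub>R\<^esub>}"
  have KN: "K \<subseteq> carrier N" by (auto simp: K_def)
  have q0: "q m \<zero>\<^bsub>N\<^esub> = \<zero>\<^bsub>R\<^esub>" if "m \<in> carrier M" for m
    using mod_hom_zero[OF N reg pairing_linear(1)[OF q that]] by (simp add: regular_module_def)
  have K: "submodule K R N"
    unfolding submodule_iff[OF N] using LM q0 mod_homD(2,3)[OF pairing_linear(1)[OF q]]
    by (auto simp: K_def subset_iff regular_module_def)
  have F: "finite (q ` T)" "q ` T \<subseteq> mod_hom R N (regular_module R)"
    using T(1,2) pairing_linear(1)[OF q] by auto
  obtain S where S: "S \<subseteq> K" "finite S"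
    "K \<subseteq> mod_span R N (S \<union> {n \<in> K. \<forall>f\<in>q ` T. f n = \<zero>\<^bsub>R\<^esub>})"
    using noetherian_functionals[OF noeth N K F] by blast
  \<comment> \<open>The common kernel of these functionals on \<open>K\<close> is zero because \<open>\<chi>\<^sub>Q\<close> is injective.\<close>
  have "n = \<zero>\<^bsub>N\<^esub>" if n: "n \<in> K" "\<forall>m\<in>T. q m n = \<zero>\<^bsub>R\<^esub>" for n
  proof -
    have nN: "n \<in> carrier N" using n(1) KN by blast
    have TL: "q x n = \<zero>\<^bsub>R\<^esub>" if "x \<in> T \<union> L" for x
      using n that by (auto simp: K_def)
    have "q m n = \<zero>\<^bsub>R\<^esub>" if "m \<in> carrier M" for m
      by (rule functional_zero_on_span[OF M pairing_linear(2)[OF q nN] _ TL, of "T \<union> L"])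
        (use T(2,3) LM that in auto)
    then have "chi M q n = chi M q \<zero>\<^bsub>N\<^esub>"
      using q0 by (auto simp: chi_def fun_eq_iff)
    then show ?thesis
      using inj_onD[OF bij_betw_imp_inj_on[OF bij]] nN by simp
  qed
  then have "S \<union> {n \<in> K. \<forall>f\<in>q ` T. f n = \<zero>\<^bsub>R\<^esub>} \<subseteq> insert \<zero>\<^bsub>N\<^esub> S" by auto
  moreover have SN: "S \<subseteq> carrier N" using S(1) KN by blast
  then have "insert \<zero>\<^bsub>N\<^esub> S \<subseteq> mod_span R N S"
    using mod_span_inc[of _ S R N] submodule_zero_mem[OF submodule_mod_span[OF N SN]] by blast
  ultimately have "mod_span R N (S \<union> {n \<in> K. \<forall>f\<in>q ` T. f n = \<zero>\<^bsub>R\<^esub>}) \<subseteq> mod_span R N S"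
    by (intro mod_span_minimal submodule_mod_span[OF N SN]) blast
  then have K_span: "K \<subseteq> mod_span R N S" using S(3) by blast
  have "m \<in> L" if m: "m \<in> annihilator R M q S" for m
  proof (rule cogenerated_quotient_separates[OF M L_sub cogen])
    show mM: "m \<in> carrier M" using m by (simp add: annihilator_def)
    fix g assume g: "g \<in> carrier (dual_module R M)" "\<And>x. x \<in> L \<Longrightarrow> g x = \<zero>\<^bsub>R\<^esub>"
    then have "g \<in> finite_dual R A M ract"
      using L by (auto simp: finite_dual_def)
    then obtain n where n: "n \<in> carrier N" "g = chi M q n"
      using bij_betw_imp_surj_on[OF bij] by blast
    then have "n \<in> K" using g(2) LM by (force simp: K_def chi_def)
    then have "m \<in> annihilator R M q (mod_span R N S)" "n \<in> mod_span R N S"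
      using K_span m annihilator_span[OF q SN] by auto
    then show "g m = \<zero>\<^bsub>R\<^esub>" using n(2) mM by (auto simp: annihilator_def chi_def)
  qed
  then show ?thesis using S(2) SN by blast
qed

theorem theorem5p15:
  fixes R :: "('r, 'z) ring_scheme"
    and A :: "('r, 'a) module" and C :: "('r, 'c) module"
    and \<Delta> :: "'c \<Rightarrow> ('c \<times> 'c \<Rightarrow> 'r) set" and \<epsilon> :: "'c \<Rightarrow> 'r"
    and p :: "'a \<Rightarrow> 'c \<Rightarrow> 'r"
    and M :: "('r, 'm) module" and ract :: "'m \<Rightarrow> 'a \<Rightarrow> 'm"
    and N :: "('r, 'n) module" and \<rho> :: "'n \<Rightarrow> ('n \<times> 'c \<Rightarrow> 'r) set"
    and q :: "'m \<Rightarrow> 'n \<Rightarrow> 'r"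
  assumes "cring R" and "\<one>\<^bsub>R\<^esub> \<noteq> \<zero>\<^bsub>R\<^esub>" and "noetherian_ring R"
    and "measuring_alpha_pairing R A C \<Delta> \<epsilon> p"
    and "right_P_pairing R A C \<Delta> \<epsilon> p M ract N \<rho> q"
  shows
    "(coreflexive R A M ract N q \<longrightarrow> rat_dual R A C p M ract = finite_dual R A M ract) \<and>
     (cofinitely_cogenerated R A M ract \<longrightarrow>
        (bij_betw (chi M q) (carrier N) (finite_dual R A M ract) \<longrightarrow> coreflexive R A M ract N q) \<and>
        (weakly_coreflexive R A C p M ract N q \<longrightarrow>
           (coreflexive R A M ract N q \<longleftrightarrow>
              bij_betw (chi M q) (carrier N) (finite_dual R A M ract))))"
proof -
  have \<alpha>: "alpha_pairing R A C p" and A: "r_algebra R A" and p: "pairing R A C p"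
    using assms(4) by (auto simp: measuring_alpha_pairing_def measuring_pairing_def)
  note Q = assms(5) and q = right_P_pairingD[OF assms(5)]
  have annihilated: "\<exists>L. cofinite_submodule R A M ract L \<and> (\<forall>f\<in>F. \<forall>x\<in>L. f x = \<zero>\<^bsub>R\<^esub>)"
    if "finite F" "F \<subseteq> rat_dual R A C p M ract" for F
    by (rule rational_annihilated_by_cofinite[OF assms(3) A p q(2) that])
  have eq: "rat_dual R A C p M ract = finite_dual R A M ract" if cor: "coreflexive R A M ract N q"
  proof (intro equalityI subsetI)
    fix f assume "f \<in> rat_dual R A C p M ract"
    then show "f \<in> finite_dual R A M ract"
      using annihilated[of "{f}"] rat_dual_iff[OF p q(2)] by (auto simp: finite_dual_def)
  next
    fix f assume "f \<in> finite_dual R A M ract"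
    then obtain L where "f \<in> carrier (dual_module R M)" "cofinite_submodule R A M ract L"
      "\<And>x. x \<in> L \<Longrightarrow> f x = \<zero>\<^bsub>R\<^esub>"
      by (auto simp: finite_dual_def)
    then show "f \<in> rat_dual R A C p M ract"
      using rational_of_annihilator[OF \<alpha> Q] coreflexiveD[OF q(1) cor] by metis
  qed
  have cor: "coreflexive R A M ract N q"
    if cogen: "cofinitely_cogenerated R A M ract"
      and bij: "bij_betw (chi M q) (carrier N) (finite_dual R A M ract)"
  proof (rule coreflexiveI[OF q(1)])
    fix L assume "cofinite_submodule R A M ract L"
    then show "\<exists>S. finite S \<and> S \<subseteq> carrier N \<and> annihilator R M q S \<subseteq> L"
      using cofinite_contains_annihilator[OF assms(3) q(1) bij] cogen
      by (simp add: cofinitely_cogenerated_def)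
  next
    fix S assume S: "finite S" "S \<subseteq> carrier N"
    obtain L where L: "cofinite_submodule R A M ract L"
      "\<And>n x. \<lbrakk>n \<in> S; x \<in> L\<rbrakk> \<Longrightarrow> chi M q n x = \<zero>\<^bsub>R\<^esub>"
      using annihilated[of "chi M q ` S"] S chi_rational[OF p Q] by blast
    have "L \<subseteq> carrier M"
      using L(1) Module.module.submoduleE(1)[OF q(4)] by (auto simp: cofinite_submodule_def)
    then have "L \<subseteq> annihilator R M q S"
      using L(2) by (force simp: annihilator_def chi_def)
    then show "\<exists>L. cofinite_submodule R A M ract L \<and> L \<subseteq> annihilator R M q S"
      using L(1) by blast
  qed
  show ?thesis
    using eq cor by (auto simp: weakly_coreflexive_def)
qed

end
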